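(* Let $n\ge 3$ be an integer and let $G$ be a graph on $[n]$. Assume that we know the top $\lceil\frac{2n+4}{3}\rceil$ coefficients of each of the two polynomials in the pair $(\phi^{G\setminus i},\phi^{\overline{G}\setminus i})$ for every $i\in[n]$. Then it is possible to efficiently determine whether the rank of the walk matrix $W^G$ is at least $\lfloor\frac{n-1}{3}\rfloor$, and if so, to efficiently reconstruct $(\phi^G,\phi^{\overline{G}})$. That is: there is an algorithm, running in time polynomial in $n$, which for every graph $G$ on $[n]$, given the multiset over $i\in[n]$ of these pairs of truncated coefficient lists, decides correctly whether $\operatorname{rank}(W^G)\ge\lfloor\frac{n-1}{3}\rfloor$, and, if this holds, outputs $(\phi^G,\phi^{\overline{G}})$.
   Context: Graphs are finite, simple and undirected. For a graph $G$ with vertex set $[n]=\{1,\dots,n\}$ and adjacency matrix $A$, the characteristic polynomial is $\phi^G(x)=\det(xI-A)$. $\overline{G}$ denotes the complement of $G$; $G\setminus i$ is the graph obtained by deleting vertex $i$, and $\overline{G}\setminus i=\overline{G\setminus i}$. The walk matrix of $G$ is the $n\times n$ matrix $W^G=(\mathbf{1}\ \ A\mathbf{1}\ \ \cdots\ \ A^{n-1}\mathbf{1})$, where $\mathbf{1}$ is the all-ones vector; its rank is taken over $\mathbb{Q}$ (equivalently $\mathbb{R}$). The top $k$ coefficients of a monic polynomial of degree $d$ are the coefficients of $x^d,x^{d-1},\dots,x^{d-k+1}$ (all coefficients if $k>d+1$). "Efficiently" means by an algorithm running in time polynomial in $n$. *)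

theory Defs
  imports
    "Jordan_Normal_Form.Char_Poly"
    "Jordan_Normal_Form.DL_Rank"
    "HOL-Library.Log_Nat"
    "HOL-Library.Multiset"
begin

section \<open>Graphs, characteristic polynomials and walk matrices\<close>

record ugraph =
  verts :: "nat set"
  edges :: "nat set set"

definition simple_graph_on :: "nat \<Rightarrow> ugraph \<Rightarrow> bool" where
  "simple_graph_on n G \<longleftrightarrow> verts G = {1..n} \<and> (\<forall>e\<in>edges G. e \<subseteq> verts G \<and> card e = 2)"

definition complement :: "ugraph \<Rightarrow> ugraph" where
  "complement G = \<lparr> verts = verts G, edges = {e. e \<subseteq> verts G \<and> card e = 2} - edges G \<rparr>"

definition delete_vertex :: "ugraph \<Rightarrow> nat \<Rightarrow> ugraph" where
  "delete_vertex G i = \<lparr> verts = verts G - {i}, edges = {e \<in> edges G. i \<notin> e} \<rparr>"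

text \<open>Rows and columns follow the increasing order of the vertices; after deleting vertices,
  row \<open>i\<close> thus belongs to the \<open>i\<close>-th smallest remaining vertex (counting from \<open>0\<close>).\<close>

definition adj_mat :: "ugraph \<Rightarrow> int mat" where
  "adj_mat G = (let vs = sorted_list_of_set (verts G); n = length vs in
     mat n n (\<lambda>(i, j). if {vs ! i, vs ! j} \<in> edges G then 1 else 0))"

definition graph_poly :: "ugraph \<Rightarrow> int poly" where
  "graph_poly G = char_poly (adj_mat G)"

definition walk_mat :: "ugraph \<Rightarrow> int mat" where
  "walk_mat G = (let A = adj_mat G; n = dim_row A in
     mat_of_cols n (map (\<lambda>k. (A ^\<^sub>m k) *\<^sub>v vec n (\<lambda>_. 1)) [0..<n]))"

definition walk_rank :: "ugraph \<Rightarrow> nat" where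
  "walk_rank G = vec_space.rank (dim_row (walk_mat G)) (map_mat rat_of_int (walk_mat G))"

definition top_coeffs :: "nat \<Rightarrow> int poly \<Rightarrow> int list" where
  "top_coeffs k p = map (\<lambda>j. coeff p (degree p - j)) [0..<min k (degree p + 1)]"

definition truncated_deck :: "nat \<Rightarrow> ugraph \<Rightarrow> (int list \<times> int list) multiset" where
  "truncated_deck k G = image_mset
     (\<lambda>i. (top_coeffs k (graph_poly (delete_vertex G i)),
           top_coeffs k (graph_poly (delete_vertex (complement G) i))))
     (mset_set (verts G))"

section \<open>Programs with logarithmic cost\<close>

text \<open>Algorithms are terms of a small untyped first-order language over integers and nested lists.
  Variables are de Bruijn indices into the list of current values. Time is charged by the
  logarithmic cost criterion: every step costs the total bit size of the values it consumes and
  produces. In particular arithmetic on long integers and copying of long lists are not free, so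
  polynomial time here is polynomial time on Turing machines.\<close>

datatype val = Num int | Lst "val list"

fun vsize :: "val \<Rightarrow> nat" where
  "vsize (Num k) = 1 + floorlog 2 (nat \<bar>k\<bar>)"
| "vsize (Lst vs) = 1 + sum_list (map vsize vs)"

datatype unop = HdOp | TlOp | NullOp

datatype binop = AddOp | SubOp | MulOp | DivOp | ModOp | LessOp | EqOp | ConsOp

text \<open>An operation applied to operands of the wrong shape yields \<open>None\<close>, and the program is stuck.\<close>

fun unop_val :: "unop \<Rightarrow> val \<Rightarrow> val option" where
  "unop_val HdOp (Lst (v # vs)) = Some v"
| "unop_val TlOp (Lst (v # vs)) = Some (Lst vs)"
| "unop_val NullOp (Lst vs) = Some (Num (if vs = [] then 1 else 0))"
| "unop_val _ _ = None"

fun binop_val :: "binop \<Rightarrow> val \<Rightarrow> val \<Rightarrow> val option" where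
  "binop_val AddOp (Num a) (Num b) = Some (Num (a + b))"
| "binop_val SubOp (Num a) (Num b) = Some (Num (a - b))"
| "binop_val MulOp (Num a) (Num b) = Some (Num (a * b))"
| "binop_val DivOp (Num a) (Num b) = Some (Num (a div b))"
| "binop_val ModOp (Num a) (Num b) = Some (Num (a mod b))"
| "binop_val LessOp (Num a) (Num b) = Some (Num (if a < b then 1 else 0))"
| "binop_val EqOp (Num a) (Num b) = Some (Num (if a = b then 1 else 0))"
| "binop_val ConsOp v (Lst vs) = Some (Lst (v # vs))"
| "binop_val _ _ _ = None"

datatype exp =
    Var nat
  | Const int
  | Empty
  | Unary unop exp
  | Binary binop exp exp
  | LetIn exp exp
  | Cond exp exp exp
  | While exp exp

text \<open>\<open>eval env e v t\<close>: in environment \<open>env\<close>, the program \<open>e\<close> terminates with value \<open>v\<close> after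
  time \<open>t\<close>. \<open>While c b\<close> repeatedly replaces variable \<open>0\<close> by the value of \<open>b\<close> as long as \<open>c\<close> is
  nonzero, and returns the final value of that variable.\<close>

inductive eval :: "val list \<Rightarrow> exp \<Rightarrow> val \<Rightarrow> nat \<Rightarrow> bool" where
  Var: "i < length env \<Longrightarrow> eval env (Var i) (env ! i) (1 + vsize (env ! i))"
| Const: "eval env (Const k) (Num k) (1 + vsize (Num k))"
| Empty: "eval env Empty (Lst []) (1 + vsize (Lst []))"
| Unary: "eval env e v t \<Longrightarrow> unop_val f v = Some w \<Longrightarrow>
    eval env (Unary f e) w (1 + t + vsize v + vsize w)"
| Binary: "eval env e\<^sub>1 v\<^sub>1 t\<^sub>1 \<Longrightarrow> eval env e\<^sub>2 v\<^sub>2 t\<^sub>2 \<Longrightarrow> binop_val f v\<^sub>1 v\<^sub>2 = Some w \<Longrightarrow>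
    eval env (Binary f e\<^sub>1 e\<^sub>2) w (1 + t\<^sub>1 + t\<^sub>2 + vsize v\<^sub>1 + vsize v\<^sub>2 + vsize w)"
| LetIn: "eval env e\<^sub>1 v t\<^sub>1 \<Longrightarrow> eval (v # env) e\<^sub>2 w t\<^sub>2 \<Longrightarrow>
    eval env (LetIn e\<^sub>1 e\<^sub>2) w (1 + t\<^sub>1 + t\<^sub>2)"
| CondT: "eval env c (Num k) t\<^sub>1 \<Longrightarrow> k \<noteq> 0 \<Longrightarrow> eval env e\<^sub>1 w t\<^sub>2 \<Longrightarrow>
    eval env (Cond c e\<^sub>1 e\<^sub>2) w (1 + t\<^sub>1 + t\<^sub>2)"
| CondF: "eval env c (Num 0) t\<^sub>1 \<Longrightarrow> eval env e\<^sub>2 w t\<^sub>2 \<Longrightarrow>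
    eval env (Cond c e\<^sub>1 e\<^sub>2) w (1 + t\<^sub>1 + t\<^sub>2)"
| WhileT: "eval (v # env) c (Num k) t\<^sub>1 \<Longrightarrow> k \<noteq> 0 \<Longrightarrow> eval (v # env) b v' t\<^sub>2 \<Longrightarrow>
    eval (v' # env) (While c b) w t\<^sub>3 \<Longrightarrow>
    eval (v # env) (While c b) w (1 + t\<^sub>1 + t\<^sub>2 + t\<^sub>3)"
| WhileF: "eval (v # env) c (Num 0) t \<Longrightarrow>
    eval (v # env) (While c b) v (1 + t + vsize v)"

inductive_cases eval_VarE: "eval env (Var i) v t"
inductive_cases eval_ConstE: "eval env (Const k) v t"
inductive_cases eval_EmptyE: "eval env Empty v t"
inductive_cases eval_UnaryE: "eval env (Unary f e) v t"
inductive_cases eval_BinaryE: "eval env (Binary f e\<^sub>1 e\<^sub>2) v t"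
inductive_cases eval_LetInE: "eval env (LetIn e\<^sub>1 e\<^sub>2) v t"
inductive_cases eval_CondE: "eval env (Cond c e\<^sub>1 e\<^sub>2) v t"
inductive_cases eval_WhileE: "eval (v # env) (While c b) w t"

lemma eval_deterministic:
  "eval env e v t \<Longrightarrow> eval env e v' t' \<Longrightarrow> v' = v \<and> t' = t"
proof (induction arbitrary: v' t' rule: eval.induct)
  case Var then show ?case by (auto elim: eval_VarE)
next
  case Const then show ?case by (auto elim: eval_ConstE)
next
  case Empty then show ?case by (auto elim: eval_EmptyE)
next
  case Unary
  from Unary.prems show ?case
    by (rule eval_UnaryE) (use Unary.hyps in \<open>auto dest!: Unary.IH\<close>)
next
  case Binary
  from Binary.prems show ?case
    by (rule eval_BinaryE) (use Binary.hyps in \<open>auto dest!: Binary.IH\<close>)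
next
  case LetIn
  from LetIn.prems show ?case
    by (rule eval_LetInE) (auto dest!: LetIn.IH)
next
  case CondT
  from CondT.prems show ?case
    by (rule eval_CondE) (use CondT.hyps in \<open>auto dest!: CondT.IH\<close>)
next
  case CondF
  from CondF.prems show ?case
    by (rule eval_CondE) (auto dest!: CondF.IH)
next
  case (WhileT v env c k t\<^sub>1 b u t\<^sub>2 w t\<^sub>3)
  from WhileT.prems show ?case
  proof (rule eval_WhileE, goal_cases)
    case 1 then show ?case using WhileT.hyps by (auto dest!: WhileT.IH)
  next
    case (2 s)
    then have "eval (v # env) c (Num 0) s" by simp
    from WhileT.IH(1)[OF this] WhileT.hyps show ?case by simp
  qed
next
  case (WhileF v env c t b)
  from WhileF.prems show ?case
  proof (rule eval_WhileE, goal_cases)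
    case (1 k)
    then show ?case by (auto dest!: WhileF.IH)
  next
    case (2 s)
    then have "eval (v # env) c (Num 0) s" by simp
    from WhileF.IH[OF this] 2 show ?case by simp
  qed
qed

section \<open>Encoding of inputs and outputs\<close>

definition enc_ints :: "int list \<Rightarrow> val" where
  "enc_ints as = Lst (map Num as)"

definition enc_cards :: "(int list \<times> int list) list \<Rightarrow> val" where
  "enc_cards cs = Lst (map (\<lambda>(as, bs). Lst [enc_ints as, enc_ints bs]) cs)"

text \<open>\<open>None\<close> is the answer that the rank is below the threshold. Polynomials are output as their
  full coefficient lists, constant coefficient first.\<close>

fun enc_answer :: "(int poly \<times> int poly) option \<Rightarrow> val" where
  "enc_answer None = Lst []"
| "enc_answer (Some (p, q)) = Lst [enc_ints (coeffs p), enc_ints (coeffs q)]"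

end

theory Submission
  imports Defs
begin

text \<open>Let \<open>A\<close> be the adjacency matrix of \<open>G\<close>, \<open>\<phi>\<close> its characteristic polynomial, \<open>J\<close> the all-ones matrix
and \<open>f = det (x I - A + J)\<close>. The complement has adjacency matrix \<open>J - I - A\<close>, so substituting
\<open>- 1 - x\<close> in its characteristic polynomial gives \<open>f\<close> up to sign. This substitution determines the
top coefficients on one side from the top coefficients on the other
(\<open>coeff_char_poly_neg_shift\<close>). Hence each card amounts to the top \<open>K\<close> coefficients of \<open>\<phi>\<^sub>i\<close> and
\<open>f\<^sub>i\<close>, the polynomials \<open>\<phi>\<close> and \<open>f\<close> of the graph without vertex \<open>i\<close>; and since the derivative of
a characteristic polynomial is the sum of the principal minors, the deck gives the top \<open>K\<close>
coefficients of \<open>\<phi>\<close> and \<open>f\<close>, for \<open>K \<le> n\<close>.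

Let \<open>a = adj (x I - A) \<one>\<close>. Comparing the adjugates of \<open>x I - A\<close> and of its rank-one update
\<open>x I - A + J\<close> yields \<open>f \<phi>\<^sub>i - \<phi> f\<^sub>i = a\<^sub>i\<^sup>2\<close> (\<open>rank_one_update\<close>). Moreover \<open>a\<^sub>i = \<phi> \<Sum>\<^sub>t w\<^sub>t(i) / x^(t + 1)\<close>,
where \<open>w\<^sub>t(i) = (A\<^sup>t \<one>)\<^sub>i\<close> counts the walks of length \<open>t\<close> from \<open>i\<close>. Both \<open>a\<^sub>i\<close> and \<open>\<phi>\<close> are monic,
so the known coefficients of \<open>a\<^sub>i\<^sup>2\<close> can be solved successively for \<open>w\<^sub>t(i)\<close> with \<open>t \<le> K - 2\<close>
(\<open>walk_list_correct\<close>). As \<open>A\<close> is symmetric, \<open>N\<^sub>s\<^sub>+\<^sub>t = \<Sum>\<^sub>i w\<^sub>s(i) w\<^sub>t(i)\<close>, where \<open>N\<^sub>t\<close> is the number of all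
walks of length \<open>t\<close>; so \<open>N\<^sub>t\<close> is known for \<open>t \<le> 2 K - 4\<close>, about twice as far as the individual
walk numbers.

There remain \<open>m = n + 1 - K = \<lfloor>(n - 1) / 3\<rfloor>\<close> unknown coefficients of \<open>\<phi>\<close>. By the Cayley-Hamilton
theorem they satisfy \<open>\<Sum>\<^sub>j \<phi>\<^sub>j N\<^sub>j\<^sub>+\<^sub>s = 0\<close> for \<open>s < m\<close>. These \<open>m\<close> equations involve \<open>N\<^sub>t\<close> for
\<open>t \<le> n + m - 1\<close> only, and this is at most \<open>2 K - 4\<close> exactly when \<open>3 K \<ge> 2 n + 4\<close>. Their matrix is the
Hankel matrix \<open>N\<^sub>i\<^sub>+\<^sub>j\<close>, the Gram matrix of \<open>\<one>, A \<one>, \<dots>, A\<^sup>m\<^sup>-\<^sup>1 \<one>\<close>. It is nonsingular if and only if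
these vectors are independent (\<open>hankel_singular_iff\<close>), and, because the columns of the walk
matrix form a Krylov sequence, if and only if the walk matrix has rank at least \<open>m\<close>
(\<open>walk_rank_ge_iff\<close>). So one determinant decides about the rank, and if it is nonzero the system
gives \<open>\<phi>\<close>; finally \<open>f = \<phi> + \<Sum>\<^sub>i a\<^sub>i\<close> is determined by \<open>\<phi>\<close> and the \<open>N\<^sub>t\<close>. For \<open>n = 3\<close>, where the cards
are complete but \<open>m = 0\<close>, the number of edges determines everything.

For the running time, functions on encoded data that some program computes in time polynomial in
the size of the input are shown to be closed under composition and under folds whose intermediate
results have polynomial size (\<open>pt_foldl\<close>). The algorithm then only has to be written with such
operations. Besides sums and products over lists it contains two proper loops. The
first computes the \<open>w\<^sub>t(i)\<close>, which are at most \<open>n\<^sup>n\<close>. The second is the Faddeev-LeVerrier recursion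
for the Hankel matrix \<open>H\<close>; its intermediate results are the coefficients of \<open>adj (x I - H)\<close>, which
grow by a fixed factor per step (\<open>resolvent_coeff_bound\<close>). The same bound, applied to
adjacency matrices, shows that the deck itself has size polynomial in \<open>n\<close>.\<close>

section \<open>Adjugates of characteristic matrices\<close>

text \<open>The entries of \<open>adj (x I - A)\<close>: divided by the characteristic polynomial they are the entries of
the resolvent \<open>(x I - A)\<^sup>-\<^sup>1\<close>, whose expansion in \<open>1 / x\<close> counts walks.\<close>

definition resolvent_num :: "int mat \<Rightarrow> nat \<Rightarrow> nat \<Rightarrow> int poly" where
  "resolvent_num A i j = Determinant.adj_mat (char_poly_matrix A) $$ (i, j)"

lemma char_poly_matrix_index:
  assumes "A \<in> carrier_mat n n" "i < n" "j < n"
  shows "char_poly_matrix A $$ (i, j) = (if i = j then [:0, 1:] else 0) - [:A $$ (i, j):]"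
  using assms by (auto simp: char_poly_matrix_def)

lemma mat_mult_index:
  assumes "A \<in> carrier_mat n k" "B \<in> carrier_mat k m" "i < n" "j < m"
  shows "(A * B) $$ (i, j) = (\<Sum>l<k. A $$ (i, l) * B $$ (l, j))"
  using assms by (auto simp: scalar_prod_def atLeast0LessThan)

lemma resolvent_left:
  assumes A: "A \<in> carrier_mat n n" and ij: "i < n" "j < n"
  shows "[:0, 1:] * resolvent_num A i j - (\<Sum>l<n. [:A $$ (i, l):] * resolvent_num A l j)
    = (if i = j then char_poly A else 0)"
proof -
  let ?X = "char_poly_matrix A"
  have X: "?X \<in> carrier_mat n n" using A by simp
  note adj = adj_mat[OF X]
  have "(?X * Determinant.adj_mat ?X) $$ (i, j) = (if i = j then char_poly A else 0)"
    unfolding adj(2) char_poly_def using ij by simp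
  moreover have "(?X * Determinant.adj_mat ?X) $$ (i, j) =
      (\<Sum>l<n. ((if i = l then [:0, 1:] else 0) - [:A $$ (i, l):]) * resolvent_num A l j)"
    unfolding mat_mult_index[OF X adj(1) ij] resolvent_num_def
    using char_poly_matrix_index[OF A ij(1)] by (intro sum.cong) auto
  moreover have "\<dots> = (\<Sum>l<n. (if i = l then [:0, 1:] * resolvent_num A l j else 0)
      - [:A $$ (i, l):] * resolvent_num A l j)"
    by (intro sum.cong) (auto simp: left_diff_distrib)
  ultimately show ?thesis using ij by (simp add: sum_subtractf)
qed

lemma resolvent_right:
  assumes A: "A \<in> carrier_mat n n" and ij: "i < n" "j < n"
  shows "[:0, 1:] * resolvent_num A i j - (\<Sum>l<n. resolvent_num A i l * [:A $$ (l, j):])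
    = (if i = j then char_poly A else 0)"
proof -
  let ?X = "char_poly_matrix A"
  have X: "?X \<in> carrier_mat n n" using A by simp
  note adj = adj_mat[OF X]
  have "(Determinant.adj_mat ?X * ?X) $$ (i, j) = (if i = j then char_poly A else 0)"
    unfolding adj(3) char_poly_def using ij by simp
  moreover have "(Determinant.adj_mat ?X * ?X) $$ (i, j) =
      (\<Sum>l<n. resolvent_num A i l * ((if l = j then [:0, 1:] else 0) - [:A $$ (l, j):]))"
    unfolding mat_mult_index[OF adj(1) X ij] resolvent_num_def
    using char_poly_matrix_index[OF A _ ij(2)] by (intro sum.cong) auto
  moreover have "\<dots> = (\<Sum>l<n. (if l = j then [:0, 1:] * resolvent_num A i l else 0)
      - resolvent_num A i l * [:A $$ (l, j):])"
    by (intro sum.cong) (auto simp: right_diff_distrib)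
  ultimately show ?thesis using ij by (simp add: sum_subtractf)
qed

lemma mat_delete_char_poly_matrix:
  assumes A: "A \<in> carrier_mat n n" and i: "i < n"
  shows "mat_delete (char_poly_matrix A) i i = char_poly_matrix (mat_delete A i i)"
  using A i by (intro eq_matI) (auto simp: mat_delete_def char_poly_matrix_def)

text \<open>The diagonal is what a vertex-deleted subgraph shows: deleting row and column \<open>i\<close> from
\<open>x I - A\<close> leaves the characteristic matrix of the smaller matrix.\<close>

lemma resolvent_diag:
  assumes A: "A \<in> carrier_mat n n" and i: "i < n"
  shows "resolvent_num A i i = char_poly (mat_delete A i i)"
proof -
  have "char_poly_matrix A \<in> carrier_mat n n" using A by simp
  then show ?thesis using i
    unfolding resolvent_num_def Determinant.adj_mat_def cofactor_def char_poly_def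
      mat_delete_char_poly_matrix[OF A i, symmetric] by auto
qed

lemma sum_resolvent_diag:
  assumes A: "A \<in> carrier_mat n n"
  shows "(\<Sum>i<n. resolvent_num A i i) = pderiv (char_poly A)"
  using pderiv_char_poly[OF A] resolvent_diag[OF A] by simp

lemma resolvent_symmetric:
  assumes A: "A \<in> carrier_mat n n" and sym: "\<And>i j. i < n \<Longrightarrow> j < n \<Longrightarrow> A $$ (i, j) = A $$ (j, i)"
    and ij: "i < n" "j < n"
  shows "resolvent_num A i j = resolvent_num A j i"
proof -
  let ?X = "char_poly_matrix A"
  have X: "?X \<in> carrier_mat n n" using A by simp
  have T: "transpose_mat ?X = ?X"
    using X char_poly_matrix_index[OF A] sym by (intro eq_matI) auto
  have "mat_delete ?X i j = transpose_mat (mat_delete ?X j i)"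
    using X char_poly_matrix_index[OF A] sym ij
    by (intro eq_matI) (auto simp: mat_delete_def)
  then have "det (mat_delete ?X i j) = det (mat_delete ?X j i)"
    using det_transpose[of "mat_delete ?X j i" "n - 1"] mat_delete_carrier[OF X, of j i] by simp
  then show ?thesis
    using X ij unfolding resolvent_num_def Determinant.adj_mat_def cofactor_def
    by (auto simp: add.commute)
qed

text \<open>Writing \<open>adj (x I - A) = \<Sum>\<^sub>k B\<^sub>k x\<^sup>k\<close>, the matrix \<open>B\<^sub>k\<close> has the entries \<open>resolvent_coeff A k i j\<close>. Comparing
coefficients in \<open>(x I - A) adj (x I - A) = \<phi> I\<close> gives \<open>B\<^sub>k = A B\<^sub>k\<^sub>+\<^sub>1 + \<phi>\<^sub>k\<^sub>+\<^sub>1 I\<close>. Together with the trace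
formula below this is the Faddeev-LeVerrier recursion.\<close>

definition resolvent_coeff :: "int mat \<Rightarrow> nat \<Rightarrow> nat \<Rightarrow> nat \<Rightarrow> int" where
  "resolvent_coeff A k i j = coeff (resolvent_num A i j) k"

lemma resolvent_coeff_rec:
  assumes A: "A \<in> carrier_mat n n" and ij: "i < n" "j < n"
  shows "resolvent_coeff A k i j = (\<Sum>l<n. A $$ (i, l) * resolvent_coeff A (Suc k) l j)
    + (if i = j then coeff (char_poly A) (Suc k) else 0)"
proof -
  have "coeff ([:0, 1:] * resolvent_num A i j) (Suc k) =
     (\<Sum>l<n. A $$ (i, l) * resolvent_coeff A (Suc k) l j)
    + (if i = j then coeff (char_poly A) (Suc k) else 0)"
    using arg_cong[OF resolvent_left[OF assms], of "\<lambda>p. coeff p (Suc k)"]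
    by (auto simp: coeff_sum resolvent_coeff_def algebra_simps)
  then show ?thesis by (simp add: resolvent_coeff_def)
qed

lemma resolvent_coeff_0:
  assumes A: "A \<in> carrier_mat n n" and ij: "i < n" "j < n"
  shows "(\<Sum>l<n. A $$ (i, l) * resolvent_coeff A 0 l j) = (if i = j then - coeff (char_poly A) 0 else 0)"
  using arg_cong[OF resolvent_left[OF assms], of "\<lambda>p. coeff p 0"]
  by (auto simp: coeff_sum resolvent_coeff_def split: if_splits)

lemma char_poly_coeffs:
  assumes A: "A \<in> carrier_mat n n"
  shows "coeff (char_poly A) n = 1" "k > n \<Longrightarrow> coeff (char_poly A) k = 0"
  using degree_monic_char_poly[OF A] by (auto intro: coeff_eq_0)

text \<open>The recursion runs downwards, and far enough up every coefficient vanishes because the entries are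
polynomials.\<close>

lemma resolvent_coeff_ge:
  assumes A: "A \<in> carrier_mat n n" and ij: "i < n" "j < n" and k: "k \<ge> n"
  shows "resolvent_coeff A k i j = 0"
proof -
  define D where "D = Max (insert n ((\<lambda>(i, j). degree (resolvent_num A i j)) ` ({..<n} \<times> {..<n})))"
  have D: "degree (resolvent_num A i j) \<le> D" if "i < n" "j < n" for i j
    unfolding D_def using that by (intro Max_ge) auto
  have "\<forall>i<n. \<forall>j<n. resolvent_coeff A (Suc D + n - t) i j = 0" if "t \<le> Suc D" for t
    using that
  proof (induction t)
    case 0
    have "degree (resolvent_num A i j) < Suc D + n - 0" if "i < n" "j < n" for i j
      using D[OF that] by linarith
    then show ?case unfolding resolvent_coeff_def by (auto intro!: coeff_eq_0)
  next
    case (Suc t)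
    define k where "k = Suc D + n - Suc t"
    have k: "Suc k = Suc D + n - t" "Suc k > n" using Suc.prems by (simp_all add: k_def)
    have "\<forall>i<n. \<forall>j<n. resolvent_coeff A (Suc k) i j = 0" using Suc by (simp add: k(1))
    then have "\<forall>i<n. \<forall>j<n. resolvent_coeff A k i j = 0"
      by (simp add: resolvent_coeff_rec[OF A, of _ _ k] char_poly_coeffs(2)[OF A k(2)])
    then show ?case by (simp add: k_def)
  qed
  from this[of "Suc D + n - k"] ij k show ?thesis
    by (cases "k \<le> Suc D + n")
      (auto simp: resolvent_coeff_def intro!: coeff_eq_0 le_less_trans[OF D])
qed

lemma resolvent_coeff_top:
  assumes A: "A \<in> carrier_mat n n" and ij: "i < n" "j < n"
  shows "resolvent_coeff A (n - 1) i j = (if i = j then 1 else 0)"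
proof -
  have n: "Suc (n - 1) = n" using ij by simp
  show ?thesis
    by (subst resolvent_coeff_rec[OF assms])
      (use ij in \<open>simp add: n resolvent_coeff_ge[OF A] char_poly_coeffs[OF A]\<close>)
qed

lemma trace_resolvent_coeff:
  assumes A: "A \<in> carrier_mat n n"
  shows "(\<Sum>i<n. resolvent_coeff A k i i) = int (Suc k) * coeff (char_poly A) (Suc k)"
  using arg_cong[OF sum_resolvent_diag[OF A], of "\<lambda>p. coeff p k"]
  by (simp add: coeff_sum resolvent_coeff_def coeff_pderiv)

text \<open>The trace of \<open>B\<^sub>k = A B\<^sub>k\<^sub>+\<^sub>1 + \<phi>\<^sub>k\<^sub>+\<^sub>1 I\<close> is also a coefficient of the derivative of \<open>\<phi>\<close>; eliminating it
expresses the next coefficient of \<open>\<phi>\<close> by matrices that are already computed.\<close>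

lemma char_poly_coeff_trace:
  assumes A: "A \<in> carrier_mat n n"
  shows "(\<Sum>i<n. \<Sum>l<n. A $$ (i, l) * resolvent_coeff A k l i) = (int k - int n) * coeff (char_poly A) k"
proof (cases k)
  case 0
  have "(\<Sum>i<n. \<Sum>l<n. A $$ (i, l) * resolvent_coeff A 0 l i) = (\<Sum>i<n. - coeff (char_poly A) 0)"
    by (intro sum.cong refl) (simp add: resolvent_coeff_0[OF A])
  with 0 show ?thesis by simp
next
  case (Suc k')
  have "(\<Sum>i<n. resolvent_coeff A k' i i) =
      (\<Sum>i<n. (\<Sum>l<n. A $$ (i, l) * resolvent_coeff A k l i) + coeff (char_poly A) k)"
    unfolding Suc by (intro sum.cong refl) (simp add: resolvent_coeff_rec[OF A, of _ _ k'])
  then show ?thesis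
    unfolding trace_resolvent_coeff[OF A] using Suc by (simp add: sum.distrib algebra_simps)
qed

text \<open>One step of the recursion multiplies entries by at most \<open>n h\<close> in the product \<open>A B\<close> and adds a
coefficient of \<open>\<phi>\<close>, which is at most the trace of that product.\<close>

lemma resolvent_coeff_bound:
  assumes A: "A \<in> carrier_mat n n" and h: "\<And>i j. i < n \<Longrightarrow> j < n \<Longrightarrow> \<bar>A $$ (i, j)\<bar> \<le> h" "1 \<le> h"
  shows "s < n \<Longrightarrow> i < n \<Longrightarrow> j < n \<Longrightarrow> \<bar>resolvent_coeff A (n - 1 - s) i j\<bar> \<le> (int n * h * (int n + 1)) ^ s"
proof (induction s arbitrary: i j)
  case 0
  then show ?case using resolvent_coeff_top[OF A 0(2,3)] by (auto split: if_splits)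
next
  case (Suc s)
  define k where "k = n - 1 - Suc s"
  define a where "a = (int n * h * (int n + 1)) ^ s"
  have k: "Suc k = n - 1 - s" using Suc.prems by (simp add: k_def)
  have IH: "\<bar>A $$ (i, l) * resolvent_coeff A (Suc k) l j\<bar> \<le> h * a" if "i < n" "l < n" "j < n" for i l j
    unfolding abs_mult k a_def using Suc.IH[of l j] Suc.prems that h(1)[of i l] h(2)
    by (intro mult_mono) auto
  have row: "\<bar>\<Sum>l<n. A $$ (i, l) * resolvent_coeff A (Suc k) l j\<bar> \<le> int n * (h * a)"
    if "i < n" "j < n" for i j
  proof -
    have "\<bar>\<Sum>l<n. A $$ (i, l) * resolvent_coeff A (Suc k) l j\<bar> \<le> (\<Sum>l<n. h * a)"
      by (rule order.trans[OF sum_abs sum_mono]) (use IH that in auto)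
    then show ?thesis by simp
  qed
  have "\<bar>coeff (char_poly A) (Suc k)\<bar> * 1 \<le> \<bar>coeff (char_poly A) (Suc k)\<bar> * \<bar>int (Suc k) - int n\<bar>"
    using Suc.prems by (intro mult_left_mono) (auto simp: k_def)
  also have "\<dots> = \<bar>\<Sum>i<n. \<Sum>l<n. A $$ (i, l) * resolvent_coeff A (Suc k) l i\<bar>"
    unfolding char_poly_coeff_trace[OF A] by (simp add: abs_mult mult.commute)
  also have "\<dots> \<le> (\<Sum>i<n. int n * (h * a))"
    by (rule order.trans[OF sum_abs sum_mono]) (use row in auto)
  finally have c: "\<bar>coeff (char_poly A) (Suc k)\<bar> \<le> int n * (int n * (h * a))" by simp
  have "\<bar>resolvent_coeff A k i j\<bar> \<le> int n * (h * a) + int n * (int n * (h * a))"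
    unfolding resolvent_coeff_rec[OF A Suc.prems(2,3), of k]
    using row[OF Suc.prems(2,3)] c by auto
  then show ?case by (simp add: k_def a_def algebra_simps)
qed

lemma char_poly_coeff_bound:
  assumes A: "A \<in> carrier_mat n n" and h: "\<And>i j. i < n \<Longrightarrow> j < n \<Longrightarrow> \<bar>A $$ (i, j)\<bar> \<le> h" "1 \<le> h"
  shows "\<bar>coeff (char_poly A) k\<bar> \<le> (int n * h * (int n + 1)) ^ n"
proof -
  consider "k > n" | "k = n" | "k < n" by linarith
  then show ?thesis
  proof cases
    case 2
    have "1 \<le> int n * h * (int n + 1)" if "n > 0"
    proof -
      have "1 * 1 * 1 \<le> int n * h * (int n + 1)" using h(2) that by (intro mult_mono) auto
      then show ?thesis by simp
    qed
    then show ?thesis using 2 char_poly_coeffs(1)[OF A] by (cases "n = 0") (auto simp: one_le_power)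
  next
    case 3
    let ?a = "(int n * h * (int n + 1)) ^ (n - 1)"
    have s: "n - 1 - k < n" "n - 1 - (n - 1 - k) = k" using 3 by auto
    have one: "1 \<le> int n * h * (int n + 1)"
    proof -
      have "1 * 1 * 1 \<le> int n * h * (int n + 1)" using h(2) 3 by (intro mult_mono) auto
      then show ?thesis by simp
    qed
    have b: "\<bar>resolvent_coeff A k l i\<bar> \<le> ?a" if "l < n" "i < n" for l i
      using resolvent_coeff_bound[OF A h s(1) that] unfolding s(2)
      by (rule order.trans) (use one in \<open>auto intro!: power_increasing\<close>)
    have "\<bar>coeff (char_poly A) k\<bar> * 1 \<le> \<bar>coeff (char_poly A) k\<bar> * \<bar>int k - int n\<bar>"
      using 3 by (intro mult_left_mono) auto
    also have "\<dots> = \<bar>\<Sum>i<n. \<Sum>l<n. A $$ (i, l) * resolvent_coeff A k l i\<bar>"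
      unfolding char_poly_coeff_trace[OF A] by (simp add: abs_mult mult.commute)
    also have "\<dots> \<le> (\<Sum>i<n. \<Sum>l<n. h * ?a)"
      by (rule order.trans[OF sum_abs sum_mono], rule order.trans[OF sum_abs sum_mono])
        (use h b in \<open>auto simp: abs_mult intro!: mult_mono\<close>)
    also have "\<dots> = int n * h * int n * ?a" by simp
    also have "\<dots> \<le> (int n * h * (int n + 1)) * ?a"
      using h(2) by (intro mult_right_mono mult_left_mono) auto
    also have "\<dots> = (int n * h * (int n + 1)) ^ n" using 3 by (simp flip: power_Suc)
    finally show ?thesis by simp
  qed (use char_poly_coeffs(2)[OF A] h in simp)
qed

section \<open>Walks and the characteristic polynomial\<close>

fun walks :: "int mat \<Rightarrow> nat \<Rightarrow> nat \<Rightarrow> int" where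
  "walks A 0 i = 1"
| "walks A (Suc t) i = (\<Sum>l<dim_row A. A $$ (i, l) * walks A t l)"

text \<open>The row sums of \<open>adj (x I - A)\<close>: the numerators of the generating functions of the walks that start
at a given vertex.\<close>

definition row_num :: "int mat \<Rightarrow> nat \<Rightarrow> int poly" where
  "row_num A i = (\<Sum>j<dim_row A. resolvent_num A i j)"

lemma coeff_row_num: "coeff (row_num A i) k = (\<Sum>j<dim_row A. resolvent_coeff A k i j)"
  by (simp add: row_num_def coeff_sum resolvent_coeff_def)

lemma coeff_row_num_rec:
  assumes A: "A \<in> carrier_mat n n" and i: "i < n"
  shows "coeff (row_num A i) k = (\<Sum>l<n. A $$ (i, l) * coeff (row_num A l) (Suc k)) + coeff (char_poly A) (Suc k)"
proof -
  have [simp]: "dim_row A = n" using A by simp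
  have "coeff (row_num A i) k = (\<Sum>j<n. (\<Sum>l<n. A $$ (i, l) * resolvent_coeff A (Suc k) l j)
    + (if i = j then coeff (char_poly A) (Suc k) else 0))"
    unfolding coeff_row_num by (simp add: resolvent_coeff_rec[OF A i])
  also have "\<dots> = (\<Sum>j<n. \<Sum>l<n. A $$ (i, l) * resolvent_coeff A (Suc k) l j) + coeff (char_poly A) (Suc k)"
    using i by (simp add: sum.distrib)
  also have "(\<Sum>j<n. \<Sum>l<n. A $$ (i, l) * resolvent_coeff A (Suc k) l j) =
     (\<Sum>l<n. A $$ (i, l) * coeff (row_num A l) (Suc k))"
    unfolding coeff_row_num by (subst sum.swap) (simp add: sum_distrib_left)
  finally show ?thesis .
qed

text \<open>This is \<open>adj (x I - A) \<one> = \<phi> \<Sum>\<^sub>t A\<^sup>t \<one> / x^(t + 1)\<close>, read off coefficient by coefficient from the top.\<close>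

lemma coeff_row_num_walks:
  assumes A: "A \<in> carrier_mat n n"
  shows "t < n \<Longrightarrow> i < n \<Longrightarrow>
    coeff (row_num A i) (n - 1 - t) = (\<Sum>j\<le>t. coeff (char_poly A) (n - (t - j)) * walks A j i)"
proof (induction t arbitrary: i)
  case 0
  have "(\<Sum>j<n. resolvent_coeff A (n - 1) i j) = (\<Sum>j<n. if i = j then 1 else 0)"
    by (rule sum.cong[OF refl], rule resolvent_coeff_top[OF A 0(2)]) auto
  also have "\<dots> = 1" using 0(2) by simp
  finally have "coeff (row_num A i) (n - 1) = 1"
    by (simp only: coeff_row_num carrier_matD(1)[OF A])
  then show ?case by (simp add: char_poly_coeffs(1)[OF A])
next
  case (Suc t)
  define k where "k = n - 1 - Suc t"
  have k: "Suc k = n - 1 - t" "n - Suc t = Suc k" using Suc.prems by (simp_all add: k_def)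
  have [simp]: "dim_row A = n" using A by simp
  have "coeff (row_num A i) k = (\<Sum>l<n. A $$ (i, l) * (\<Sum>j\<le>t. coeff (char_poly A) (n - (t - j)) * walks A j l))
     + coeff (char_poly A) (Suc k)"
    unfolding coeff_row_num_rec[OF A Suc.prems(2)] k(1) using Suc by simp
  also have "(\<Sum>l<n. A $$ (i, l) * (\<Sum>j\<le>t. coeff (char_poly A) (n - (t - j)) * walks A j l)) =
     (\<Sum>j\<le>t. coeff (char_poly A) (n - (t - j)) * walks A (Suc j) i)"
    by (simp add: sum_distrib_left mult.left_commute) (rule sum.swap)
  also have "(\<Sum>j\<le>t. coeff (char_poly A) (n - (t - j)) * walks A (Suc j) i) + coeff (char_poly A) (Suc k) =
     (\<Sum>j\<le>Suc t. coeff (char_poly A) (n - (Suc t - j)) * walks A j i)"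
    by (subst sum.atMost_Suc_shift) (simp add: k(2))
  finally show ?case unfolding k_def .
qed

text \<open>The Cayley-Hamilton theorem applied to \<open>A\<^sup>s \<one>\<close>: the case \<open>s = 0\<close> is the constant coefficient of
\<open>(x I - A) adj (x I - A) \<one> = \<phi> \<one>\<close>.\<close>

lemma walks_recurrence:
  assumes A: "A \<in> carrier_mat n n"
  shows "i < n \<Longrightarrow> (\<Sum>j\<le>n. coeff (char_poly A) j * walks A (j + s) i) = 0"
proof (induction s arbitrary: i)
  case 0
  have [simp]: "dim_row A = n" using A by simp
  have "(\<Sum>l<n. A $$ (i, l) * coeff (row_num A l) 0) = (\<Sum>j<n. \<Sum>l<n. A $$ (i, l) * resolvent_coeff A 0 l j)"
    unfolding coeff_row_num by (subst sum.swap) (simp add: sum_distrib_left)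
  also have "\<dots> = (\<Sum>j<n. if i = j then - coeff (char_poly A) 0 else 0)"
    using 0 by (intro sum.cong refl resolvent_coeff_0[OF A]) auto
  also have "\<dots> = - coeff (char_poly A) 0" using 0 by simp
  finally have 1: "(\<Sum>l<n. A $$ (i, l) * coeff (row_num A l) 0) = - coeff (char_poly A) 0" .
  obtain n' where n': "n = Suc n'" using 0 by (cases n) auto
  have "coeff (row_num A l) 0 = (\<Sum>j\<le>n'. coeff (char_poly A) (Suc j) * walks A j l)" if "l < n" for l
  proof -
    have "coeff (row_num A l) (n - 1 - n') = (\<Sum>j\<le>n'. coeff (char_poly A) (n - (n' - j)) * walks A j l)"
      by (rule coeff_row_num_walks[OF A _ that]) (simp add: n')
    also have "\<dots> = (\<Sum>j\<le>n'. coeff (char_poly A) (Suc j) * walks A j l)"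
      by (intro sum.cong refl) (simp add: n' Suc_diff_le)
    finally show ?thesis by (simp add: n')
  qed
  then have "(\<Sum>l<n. A $$ (i, l) * coeff (row_num A l) 0) =
      (\<Sum>l<n. A $$ (i, l) * (\<Sum>j\<le>n'. coeff (char_poly A) (Suc j) * walks A j l))" by simp
  also have "\<dots> = (\<Sum>j\<le>n'. coeff (char_poly A) (Suc j) * walks A (Suc j) i)"
    by (simp add: sum_distrib_left mult.left_commute) (rule sum.swap)
  finally show ?case using 1 unfolding n' by (subst sum.atMost_Suc_shift) simp
next
  case (Suc s)
  have [simp]: "dim_row A = n" using A by simp
  have "(\<Sum>j\<le>n. coeff (char_poly A) j * walks A (j + Suc s) i) =
      (\<Sum>l<n. A $$ (i, l) * (\<Sum>j\<le>n. coeff (char_poly A) j * walks A (j + s) l))"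
    by (simp add: sum_distrib_left mult.left_commute) (rule sum.swap)
  also have "\<dots> = 0" using Suc by simp
  finally show ?case .
qed

section \<open>Adding the all-ones matrix\<close>

text \<open>The matrix determinant lemma for \<open>X + u v\<close> with \<open>u\<close> and \<open>v\<close> all-ones. The bordered matrix \<open>Z\<close> with
blocks \<open>X, - u, v, 1\<close> becomes block triangular in two ways, by clearing its lower left and its upper
right corner; the latter uses the adjugate and hence costs a factor \<open>det X\<close> to be cancelled.\<close>

lemma det_add_all_ones:
  fixes X :: "'a :: idom mat"
  assumes X: "X \<in> carrier_mat n n" and nz: "det X \<noteq> 0"
  shows "det (X + mat n n (\<lambda>_. 1)) = det X + (\<Sum>i<n. \<Sum>j<n. Determinant.adj_mat X $$ (i, j))"
proof -
  let ?u = "mat n 1 (\<lambda>_. 1 :: 'a)" and ?v = "mat 1 n (\<lambda>_. 1 :: 'a)" and ?d = "det X"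
  let ?R = "Determinant.adj_mat X" and ?I = "1\<^sub>m 1 :: 'a mat"
  let ?s = "\<Sum>i<n. \<Sum>j<n. ?R $$ (i, j)"
  let ?Z = "four_block_mat X (- ?u) ?v ?I"
  note adj = adj_mat[OF X]
  have Zc: "?Z \<in> carrier_mat (n + 1) (n + 1)"
    and Z1c: "four_block_mat (X + ?u * ?v) (- ?u) (0\<^sub>m 1 n) ?I \<in> carrier_mat (n + 1) (n + 1)"
    and Z2c: "four_block_mat (1\<^sub>m n) (0\<^sub>m n 1) ?v ?I \<in> carrier_mat (n + 1) (n + 1)"
    and Z3c: "four_block_mat (1\<^sub>m n) (?R * ?u) (0\<^sub>m 1 n) (?d \<cdot>\<^sub>m ?I) \<in> carrier_mat (n + 1) (n + 1)"
    using X by (auto intro!: four_block_carrier_mat)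
  have Rc: "?R \<in> carrier_mat n n" by (rule adj(1))
  have uv: "?u * ?v = mat n n (\<lambda>_. 1)"
    by (intro eq_matI) (auto simp: scalar_prod_def)
  have "?Z = four_block_mat (X + ?u * ?v) (- ?u) (0\<^sub>m 1 n) ?I * four_block_mat (1\<^sub>m n) (0\<^sub>m n 1) ?v ?I"
  proof (subst mult_four_block_mat[of _ n n _ 1 _ 1 _ _ n _ 1])
    have "(X + ?u * ?v) * 1\<^sub>m n + (- ?u) * ?v = X"
      using X unfolding uv by (intro eq_matI) (auto simp: scalar_prod_def)
    moreover have "(X + ?u * ?v) * 0\<^sub>m n 1 + (- ?u) * ?I = - ?u"
      using X unfolding uv by (intro eq_matI) (auto simp: scalar_prod_def)
    moreover have "0\<^sub>m 1 n * 1\<^sub>m n + ?I * ?v = ?v" "0\<^sub>m 1 n * 0\<^sub>m n 1 + ?I * ?I = ?I"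
      by (intro eq_matI; auto simp: scalar_prod_def)+
    ultimately show "?Z = four_block_mat ((X + ?u * ?v) * 1\<^sub>m n + (- ?u) * ?v) ((X + ?u * ?v) * 0\<^sub>m n 1 + (- ?u) * ?I)
       (0\<^sub>m 1 n * 1\<^sub>m n + ?I * ?v) (0\<^sub>m 1 n * 0\<^sub>m n 1 + ?I * ?I)" by simp
  qed (use X in auto)
  then have "det ?Z = det (four_block_mat (X + ?u * ?v) (- ?u) (0\<^sub>m 1 n) ?I)
      * det (four_block_mat (1\<^sub>m n) (0\<^sub>m n 1) ?v ?I)"
    using det_mult[OF Z1c Z2c] by (rule trans[OF arg_cong[of _ _ det]])
  also have "det (four_block_mat (X + ?u * ?v) (- ?u) (0\<^sub>m 1 n) ?I) = det (X + ?u * ?v) * det ?I"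
    by (rule det_four_block_mat_lower_left_zero[of _ n _ 1]) (use X in auto)
  also have "det (four_block_mat (1\<^sub>m n) (0\<^sub>m n 1) ?v ?I) = det (1\<^sub>m n) * det ?I"
    by (rule det_four_block_mat_upper_right_zero[of _ n _ 1]) auto
  finally have Z1: "det ?Z = det (X + ?u * ?v)" by simp
  have "?Z * four_block_mat (1\<^sub>m n) (?R * ?u) (0\<^sub>m 1 n) (?d \<cdot>\<^sub>m ?I) =
     four_block_mat X (0\<^sub>m n 1) ?v ((?d + ?s) \<cdot>\<^sub>m ?I)"
  proof (subst mult_four_block_mat[of _ n n _ 1 _ 1 _ _ n _ 1])
    have "X * (?R * ?u) = ?d \<cdot>\<^sub>m ?u"
    proof -
      have "X * (?R * ?u) = (X * ?R) * ?u" using X Rc by (simp add: assoc_mult_mat[of _ n n _ n _ 1])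
      also have "\<dots> = ?d \<cdot>\<^sub>m ?u" unfolding adj(2) by (simp add: mult_smult_assoc_mat[of _ n n _ 1])
      finally show ?thesis .
    qed
    then have "X * (?R * ?u) + (- ?u) * (?d \<cdot>\<^sub>m ?I) = 0\<^sub>m n 1"
      by (intro eq_matI) (auto simp: scalar_prod_def)
    moreover have "X * 1\<^sub>m n + (- ?u) * 0\<^sub>m 1 n = X"
      using X by (intro eq_matI) (auto simp: scalar_prod_def)
    moreover have "?v * 1\<^sub>m n + ?I * 0\<^sub>m 1 n = ?v"
      by (intro eq_matI) (auto simp: scalar_prod_def)
    moreover have "?v * (?R * ?u) + ?I * (?d \<cdot>\<^sub>m ?I) = (?d + ?s) \<cdot>\<^sub>m ?I"
      using Rc by (intro eq_matI) (auto simp: scalar_prod_def atLeast0LessThan)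
    ultimately show "four_block_mat (X * 1\<^sub>m n + (- ?u) * 0\<^sub>m 1 n) (X * (?R * ?u) + (- ?u) * (?d \<cdot>\<^sub>m ?I))
       (?v * 1\<^sub>m n + ?I * 0\<^sub>m 1 n) (?v * (?R * ?u) + ?I * (?d \<cdot>\<^sub>m ?I)) =
       four_block_mat X (0\<^sub>m n 1) ?v ((?d + ?s) \<cdot>\<^sub>m ?I)" by simp
  qed (use X Rc in auto)
  then have "det ?Z * det (four_block_mat (1\<^sub>m n) (?R * ?u) (0\<^sub>m 1 n) (?d \<cdot>\<^sub>m ?I)) =
     det (four_block_mat X (0\<^sub>m n 1) ?v ((?d + ?s) \<cdot>\<^sub>m ?I))"
    using det_mult[OF Zc Z3c] by (metis)
  also have "det (four_block_mat (1\<^sub>m n) (?R * ?u) (0\<^sub>m 1 n) (?d \<cdot>\<^sub>m ?I)) = det (1\<^sub>m n) * det (?d \<cdot>\<^sub>m ?I)"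
    by (rule det_four_block_mat_lower_left_zero[of _ n _ 1]) (use Rc in auto)
  also have "det (four_block_mat X (0\<^sub>m n 1) ?v ((?d + ?s) \<cdot>\<^sub>m ?I)) = det X * det ((?d + ?s) \<cdot>\<^sub>m ?I)"
    by (rule det_four_block_mat_upper_right_zero[of _ n _ 1]) (use X in auto)
  finally have "det ?Z * ?d = ?d * (?d + ?s)" by (simp add: det_smult)
  then have "det ?Z = ?d + ?s" using nz by simp
  with Z1 uv show ?thesis by simp
qed

text \<open>The characteristic matrix of \<open>A - J\<close> is \<open>x I - A + J\<close>, so the polynomial \<open>f\<close> is a characteristic
polynomial too and all of the above applies to it.\<close>

definition minus_ones :: "int mat \<Rightarrow> int mat" where
  "minus_ones A = mat (dim_row A) (dim_row A) (\<lambda>(i, j). A $$ (i, j) - 1)"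

lemma minus_ones_carrier [simp]: "A \<in> carrier_mat n n \<Longrightarrow> minus_ones A \<in> carrier_mat n n"
  by (simp add: minus_ones_def)

lemma char_poly_nonzero: "A \<in> carrier_mat n n \<Longrightarrow> char_poly (A :: int mat) \<noteq> 0"
  using char_poly_coeffs(1)[of A n] by auto

lemma char_poly_minus_ones:
  assumes A: "A \<in> carrier_mat n n"
  shows "char_poly (minus_ones A) = char_poly A + (\<Sum>i<n. row_num A i)"
proof -
  let ?X = "char_poly_matrix A"
  have X: "?X \<in> carrier_mat n n" using A by simp
  have "char_poly_matrix (minus_ones A) = ?X + mat n n (\<lambda>_. 1)"
    using A X by (intro eq_matI) (auto simp: minus_ones_def char_poly_matrix_def)
  then show ?thesis
    using det_add_all_ones[OF X] char_poly_nonzero[OF A] A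
    by (simp add: char_poly_def row_num_def resolvent_num_def)
qed

text \<open>Let \<open>R\<close> and \<open>S\<close> be the adjugates of \<open>X = x I - A\<close> and \<open>Y = X + J\<close>. Evaluating \<open>S Y R\<close> in both ways gives
\<open>f R - \<phi> S = (S \<one>) (\<one>\<^sup>T R)\<close>. Summing over a row and using \<open>f = \<phi> + \<one>\<^sup>T R \<one>\<close> shows \<open>S \<one> = R \<one>\<close>,
so the right-hand side is the outer square of the vector of row sums of \<open>R\<close>.\<close>

lemma rank_one_update:
  assumes A: "A \<in> carrier_mat n n" and sym: "\<And>i j. i < n \<Longrightarrow> j < n \<Longrightarrow> A $$ (i, j) = A $$ (j, i)"
    and ij: "i < n" "j < n"
  shows "char_poly (minus_ones A) * resolvent_num A i j - char_poly A * resolvent_num (minus_ones A) i j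
    = row_num A i * row_num A j"
proof -
  let ?B = "minus_ones A"
  let ?f = "char_poly ?B" and ?p = "char_poly A"
  let ?R = "resolvent_num A" and ?S = "resolvent_num ?B"
  define x :: "int poly" where "x = [:0, 1:]"
  have B: "?B \<in> carrier_mat n n" using A by simp
  have dim: "dim_row A = n" "dim_row ?B = n" using A by (simp_all add: minus_ones_def)
  have col: "(\<Sum>k<n. ?R k j) = row_num A j" if "j < n" for j
    unfolding row_num_def dim using resolvent_symmetric[OF A sym] that by simp
  have key: "?f * ?R i j = ?p * ?S i j + row_num ?B i * row_num A j" if ij: "i < n" "j < n" for i j
  proof -
    define a where "a l k = [:A $$ (l, k):]" for l k
    have e: "[:?B $$ (l, k):] = a l k - 1" if "l < n" "k < n" for l k
      using that A by (simp add: a_def minus_ones_def one_pCons)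
    have right: "(if i = k then ?f else 0) = x * ?S i k - (\<Sum>l<n. ?S i l * a l k) + row_num ?B i" if "k < n" for k
    proof -
      have "(if i = k then ?f else 0) = x * ?S i k - (\<Sum>l<n. ?S i l * [:?B $$ (l, k):])"
        unfolding x_def by (rule resolvent_right[OF B ij(1) that, symmetric])
      also have "(\<Sum>l<n. ?S i l * [:?B $$ (l, k):]) = (\<Sum>l<n. ?S i l * a l k - ?S i l)"
        by (intro sum.cong refl) (simp add: e that right_diff_distrib)
      finally show ?thesis by (simp add: sum_subtractf row_num_def dim)
    qed
    have left: "x * ?R l j - (\<Sum>k<n. a l k * ?R k j) = (if l = j then ?p else 0)" if "l < n" for l
      unfolding x_def a_def by (rule resolvent_left[OF A that ij(2)])
    have "?f * ?R i j = (\<Sum>k<n. if i = k then ?f * ?R k j else 0)"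
      using ij by simp
    also have "\<dots> = (\<Sum>k<n. (if i = k then ?f else 0) * ?R k j)"
      by (intro sum.cong refl) simp
    also have "\<dots> = (\<Sum>k<n. ?S i k * (x * ?R k j) - (\<Sum>l<n. ?S i l * (a l k * ?R k j)) + row_num ?B i * ?R k j)"
    proof (intro sum.cong refl)
      fix k assume "k \<in> {..<n}"
      then have "(if i = k then ?f else 0) * ?R k j =
          (x * ?S i k - (\<Sum>l<n. ?S i l * a l k) + row_num ?B i) * ?R k j"
        by (simp only: right lessThan_iff)
      also have "\<dots> = ?S i k * (x * ?R k j) - (\<Sum>l<n. ?S i l * a l k) * ?R k j + row_num ?B i * ?R k j"
        by (simp only: distrib_right left_diff_distrib mult.assoc mult.left_commute)
      also have "(\<Sum>l<n. ?S i l * a l k) * ?R k j = (\<Sum>l<n. ?S i l * (a l k * ?R k j))"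
        by (simp only: sum_distrib_right mult.assoc)
      finally show "(if i = k then ?f else 0) * ?R k j =
          ?S i k * (x * ?R k j) - (\<Sum>l<n. ?S i l * (a l k * ?R k j)) + row_num ?B i * ?R k j" .
    qed
    also have "\<dots> = (\<Sum>l<n. ?S i l * (x * ?R l j)) - (\<Sum>k<n. \<Sum>l<n. ?S i l * (a l k * ?R k j))
        + row_num ?B i * (\<Sum>k<n. ?R k j)"
      by (simp only: sum.distrib sum_subtractf sum_distrib_left)
    also have "(\<Sum>k<n. \<Sum>l<n. ?S i l * (a l k * ?R k j)) = (\<Sum>l<n. ?S i l * (\<Sum>k<n. a l k * ?R k j))"
      by (subst sum.swap) (simp only: sum_distrib_left)
    also have "(\<Sum>l<n. ?S i l * (x * ?R l j)) - (\<Sum>l<n. ?S i l * (\<Sum>k<n. a l k * ?R k j)) =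
        (\<Sum>l<n. ?S i l * (x * ?R l j - (\<Sum>k<n. a l k * ?R k j)))"
      by (simp only: right_diff_distrib sum_subtractf)
    also have "\<dots> = (\<Sum>l<n. if l = j then ?p * ?S i j else 0)"
      by (intro sum.cong refl) (simp add: left mult.commute)
    also have "\<dots> = ?p * ?S i j" using ij by simp
    also have "(\<Sum>k<n. ?R k j) = row_num A j" by (rule col[OF ij(2)])
    finally show ?thesis .
  qed
  have "?f * row_num A i = (\<Sum>j<n. ?f * ?R i j)" by (simp add: row_num_def dim sum_distrib_left)
  also have "\<dots> = (\<Sum>j<n. ?p * ?S i j + row_num ?B i * row_num A j)" using key ij by simp
  also have "\<dots> = row_num ?B i * (?p + (\<Sum>j<n. row_num A j))"
    by (simp add: sum.distrib row_num_def dim sum_distrib_left distrib_left mult.commute)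
  also have "\<dots> = ?f * row_num ?B i" by (simp add: char_poly_minus_ones[OF A] mult.commute)
  finally have "row_num A i = row_num ?B i" using char_poly_nonzero[OF B] by simp
  with key[OF ij] show ?thesis by simp
qed

section \<open>Complements\<close>

text \<open>The map \<open>B \<mapsto> - I - B\<close>; it sends \<open>A - J\<close> to the adjacency matrix of the complement and back.\<close>

definition neg_shift :: "int mat \<Rightarrow> int mat" where
  "neg_shift B = mat (dim_row B) (dim_row B) (\<lambda>(i, j). (if i = j then -1 else 0) - B $$ (i, j))"

lemma neg_shift_carrier [simp]: "B \<in> carrier_mat n n \<Longrightarrow> neg_shift B \<in> carrier_mat n n"
  by (simp add: neg_shift_def)

lemma neg_shift_neg_shift: "B \<in> carrier_mat n n \<Longrightarrow> neg_shift (neg_shift B) = B"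
  by (intro eq_matI) (auto simp: neg_shift_def)

lemma char_poly_neg_shift:
  assumes B: "B \<in> carrier_mat n n"
  shows "char_poly (neg_shift B) \<circ>\<^sub>p [:-1, -1:] = (-1) ^ n * char_poly B"
proof -
  let ?h = "\<lambda>p. p \<circ>\<^sub>p [:-1, -1 :: int:]"
  have h: "comm_ring_hom ?h"
    by unfold_locales (simp_all add: pcompose_add pcompose_mult)
  have "map_mat ?h (char_poly_matrix (neg_shift B)) = (-1) \<cdot>\<^sub>m char_poly_matrix B"
    using B by (intro eq_matI) (auto simp: char_poly_matrix_def neg_shift_def pcompose_pCons)
  then have "det (map_mat ?h (char_poly_matrix (neg_shift B))) = (-1) ^ n * char_poly B"
    using carrier_matD(2)[OF char_poly_matrix_closed[OF B]] by (simp add: det_smult char_poly_def)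
  then show ?thesis
    by (simp only: comm_ring_hom.hom_det[OF h] char_poly_def)
qed

lemma coeff_pcompose_neg_shift:
  fixes p :: "int poly"
  assumes p: "degree p \<le> n"
  shows "coeff (p \<circ>\<^sub>p [:-1, -1:]) i = (\<Sum>k\<le>n. coeff p k * ((-1) ^ k * int (k choose i)))"
proof -
  let ?q = "[:-1, -1 :: int:]"
  have pw: "coeff (?q ^ k) i = (-1) ^ k * int (k choose i)" for k
  proof (cases "i \<le> k")
    case True
    then show ?thesis by (simp add: coeff_linear_poly_power mult.commute flip: power_add)
  next
    case False
    have "degree (?q ^ k) \<le> k" using degree_power_le[of ?q k] by simp
    with False show ?thesis by (simp add: coeff_eq_0)
  qed
  have "p = (\<Sum>k\<le>n. monom (coeff p k) k)" using poly_as_sum_of_monoms'[OF p] by simp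
  then have "p \<circ>\<^sub>p ?q = (\<Sum>k\<le>n. monom (coeff p k) k) \<circ>\<^sub>p ?q" by simp
  also have "\<dots> = (\<Sum>k\<le>n. Polynomial.smult (coeff p k) (?q ^ k))"
    by (simp add: pcompose_sum monom_altdef pcompose_smult pcompose_hom.hom_power pcompose_pCons)
  finally show ?thesis by (simp add: coeff_sum pw)
qed

text \<open>In this form only the coefficients with \<open>j \<le> l\<close> contribute, since the binomial coefficient vanishes
for \<open>j > l\<close>: the top coefficients of one polynomial determine the top coefficients of the other.\<close>

lemma coeff_char_poly_neg_shift:
  assumes B: "B \<in> carrier_mat n n" and l: "l \<le> n"
  shows "coeff (char_poly B) (n - l) =
    (\<Sum>j\<le>n. (-1) ^ j * coeff (char_poly (neg_shift B)) (n - j) * int ((n - j) choose (n - l)))"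
proof -
  let ?C = "char_poly (neg_shift B)"
  have deg: "degree ?C \<le> n" using degree_monic_char_poly[OF neg_shift_carrier[OF B]] by simp
  have "coeff (?C \<circ>\<^sub>p [:-1, -1:]) (n - l) = (-1) ^ n * coeff (char_poly B) (n - l)"
    unfolding char_poly_neg_shift[OF B] by (cases "even n") auto
  then have "coeff (char_poly B) (n - l) = (-1) ^ n * coeff (?C \<circ>\<^sub>p [:-1, -1:]) (n - l)"
    by (cases "even n") auto
  also have "\<dots> = (\<Sum>k\<le>n. (-1) ^ n * ((-1) ^ k * coeff ?C k * int (k choose (n - l))))"
    unfolding coeff_pcompose_neg_shift[OF deg] by (simp add: sum_distrib_left mult_ac)
  also have "\<dots> = (\<Sum>j\<le>n. (-1) ^ j * coeff ?C (n - j) * int ((n - j) choose (n - l)))"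
  proof (rule sum.reindex_bij_witness[of _ "\<lambda>j. n - j" "\<lambda>k. n - k"])
    fix k assume k: "k \<in> {..n}"
    then have "(-1 :: int) ^ n = (-1) ^ (n - k) * (-1) ^ k" by (simp flip: power_add)
    moreover have "(-1 :: int) ^ k * (-1) ^ k = 1" by (simp flip: power_add)
    ultimately have "(-1 :: int) ^ n * (-1) ^ k = (-1) ^ (n - k)" by (simp add: mult.assoc)
    then show "(-1) ^ (n - k) * coeff ?C (n - (n - k)) * int ((n - (n - k)) choose (n - l)) =
      (-1) ^ n * ((-1) ^ k * coeff ?C k * int (k choose (n - l)))"
      using k by (simp flip: mult.assoc)
  qed auto
  finally show ?thesis .
qed

section \<open>Adjacency matrices and decks\<close>

context
  fixes n G
  assumes G: "simple_graph_on n G"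
begin

lemma verts_list: "sorted_list_of_set (verts G) = [1..<Suc n]"
  using G by (simp add: simple_graph_on_def atLeastLessThanSuc_atLeastAtMost[symmetric]
      del: upt_Suc)

lemma adjacency_carrier [simp]: "adj_mat G \<in> carrier_mat n n"
  by (simp add: adj_mat_def verts_list Let_def del: upt_Suc)

lemma adjacency_index:
  "i < n \<Longrightarrow> j < n \<Longrightarrow> adj_mat G $$ (i, j) = (if {Suc i, Suc j} \<in> edges G then 1 else 0)"
  by (simp add: adj_mat_def verts_list Let_def del: upt_Suc)

lemma adjacency_symmetric:
  "i < n \<Longrightarrow> j < n \<Longrightarrow> adj_mat G $$ (i, j) = adj_mat G $$ (j, i)"
  by (simp add: adjacency_index insert_commute)

lemma adjacency_bound: "i < n \<Longrightarrow> j < n \<Longrightarrow> \<bar>adj_mat G $$ (i, j)\<bar> \<le> 1"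
  by (simp add: adjacency_index)

lemma adjacency_diag: "i < n \<Longrightarrow> adj_mat G $$ (i, i) = 0"
  using G by (auto simp: adjacency_index simple_graph_on_def)

lemma simple_complement: "simple_graph_on n (complement G)"
  using G by (auto simp: simple_graph_on_def complement_def)

lemma adjacency_delete:
  assumes i: "i < n"
  shows "adj_mat (delete_vertex G (Suc i)) = mat_delete (adj_mat G) i i"
proof -
  define L where "L = [1..<Suc i] @ [Suc (Suc i)..<Suc n]"
  have "sorted_list_of_set ({1..n} - {Suc i}) = L"
    using i by (intro sorted_distinct_set_unique) (auto simp: L_def sorted_append simp del: upt_Suc)
  then have l: "sorted_list_of_set (verts (delete_vertex G (Suc i))) = L"
    using G by (simp add: delete_vertex_def simple_graph_on_def)
  have len: "length L = n - 1" using i by (auto simp: L_def)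
  have nth: "L ! j = Suc (if j < i then j else Suc j)" if "j < n - 1" for j
    using i that by (auto simp: L_def nth_append simp del: upt_Suc)
  show ?thesis
  proof (rule eq_matI)
    fix a b assume "a < dim_row (mat_delete (adj_mat G) i i)" "b < dim_col (mat_delete (adj_mat G) i i)"
    then have ab: "a < n - 1" "b < n - 1" using adjacency_carrier by (auto simp: mat_delete_def)
    let ?a = "if a < i then a else Suc a" and ?b = "if b < i then b else Suc b"
    have lt: "?a < n" "?b < n" using ab by auto
    have "adj_mat (delete_vertex G (Suc i)) $$ (a, b) =
        (if {Suc ?a, Suc ?b} \<in> edges (delete_vertex G (Suc i)) then 1 else 0)"
      using ab i unfolding adj_mat_def l Let_def by (simp add: nth len)
    also have "\<dots> = adj_mat G $$ (?a, ?b)"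
      unfolding adjacency_index[OF lt] by (auto simp: delete_vertex_def split: if_splits)
    also have "\<dots> = mat_delete (adj_mat G) i i $$ (a, b)"
      using ab by (simp add: mat_delete_def carrier_matD[OF adjacency_carrier])
    finally show "adj_mat (delete_vertex G (Suc i)) $$ (a, b) = mat_delete (adj_mat G) i i $$ (a, b)" .
  qed (simp_all add: adj_mat_def[of "delete_vertex G (Suc i)"] l Let_def len mat_delete_def
      carrier_matD[OF adjacency_carrier])
qed

end

lemma adjacency_complement:
  assumes G: "simple_graph_on n G"
  shows "adj_mat (complement G) = neg_shift (minus_ones (adj_mat G))"
proof (rule eq_matI)
  note A = adjacency_carrier[OF G] and A' = adjacency_carrier[OF simple_complement[OF G]]
  show "dim_row (adj_mat (complement G)) = dim_row (neg_shift (minus_ones (adj_mat G)))"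
    "dim_col (adj_mat (complement G)) = dim_col (neg_shift (minus_ones (adj_mat G)))"
    using A A' by (auto simp: neg_shift_def minus_ones_def)
  fix i j assume "i < dim_row (neg_shift (minus_ones (adj_mat G)))" "j < dim_col (neg_shift (minus_ones (adj_mat G)))"
  then have ij: "i < n" "j < n" using A by (auto simp: neg_shift_def minus_ones_def)
  have r: "neg_shift (minus_ones (adj_mat G)) $$ (i, j) = (if i = j then -1 else 0) - (adj_mat G $$ (i, j) - 1)"
    using ij A by (auto simp: neg_shift_def minus_ones_def)
  show "adj_mat (complement G) $$ (i, j) = neg_shift (minus_ones (adj_mat G)) $$ (i, j)"
  proof (cases "i = j")
    case True
    then show ?thesis
      unfolding r using adjacency_diag[OF G ij(1)] adjacency_diag[OF simple_complement[OF G] ij(1)] by simp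
  next
    case False
    then have "{Suc i, Suc j} \<subseteq> verts G" "card {Suc i, Suc j} = 2"
      using ij G by (auto simp: simple_graph_on_def)
    then show ?thesis
      unfolding r using False
      by (simp add: adjacency_index[OF G ij] adjacency_index[OF simple_complement[OF G] ij])
        (simp add: complement_def)
  qed
qed

lemma mat_delete_neg_shift:
  assumes B: "B \<in> carrier_mat n n" and i: "i < n"
  shows "mat_delete (neg_shift B) i i = neg_shift (mat_delete B i i)"
  using B i by (intro eq_matI) (auto simp: mat_delete_def neg_shift_def)

lemma graph_poly_delete:
  assumes G: "simple_graph_on n G" and i: "i < n"
  shows "graph_poly (delete_vertex G (Suc i)) = resolvent_num (adj_mat G) i i"
  unfolding graph_poly_def adjacency_delete[OF G i] resolvent_diag[OF adjacency_carrier[OF G] i] ..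

lemma graph_poly_delete_degree:
  assumes G: "simple_graph_on n G" and i: "i < n"
  shows "degree (graph_poly (delete_vertex G (Suc i))) = n - 1"
  unfolding graph_poly_def adjacency_delete[OF G i]
  using degree_monic_char_poly[OF mat_delete_carrier[OF adjacency_carrier[OF G]], of i i] by simp

lemma coeff_graph_poly_complement:
  assumes G: "simple_graph_on n G" and l: "l \<le> n"
  shows "coeff (char_poly (minus_ones (adj_mat G))) (n - l) =
    (\<Sum>j\<le>n. (-1) ^ j * coeff (graph_poly (complement G)) (n - j) * int ((n - j) choose (n - l)))"
    "coeff (graph_poly (complement G)) (n - l) =
    (\<Sum>j\<le>n. (-1) ^ j * coeff (char_poly (minus_ones (adj_mat G))) (n - j) * int ((n - j) choose (n - l)))"
proof -
  have M: "minus_ones (adj_mat G) \<in> carrier_mat n n" using G by simp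
  show "coeff (char_poly (minus_ones (adj_mat G))) (n - l) =
    (\<Sum>j\<le>n. (-1) ^ j * coeff (graph_poly (complement G)) (n - j) * int ((n - j) choose (n - l)))"
    unfolding graph_poly_def adjacency_complement[OF G] by (rule coeff_char_poly_neg_shift[OF M l])
  show "coeff (graph_poly (complement G)) (n - l) =
    (\<Sum>j\<le>n. (-1) ^ j * coeff (char_poly (minus_ones (adj_mat G))) (n - j) * int ((n - j) choose (n - l)))"
    unfolding graph_poly_def adjacency_complement[OF G]
    using coeff_char_poly_neg_shift[OF neg_shift_carrier[OF M] l] by (simp add: neg_shift_neg_shift[OF M])
qed

lemma coeff_graph_poly_delete_complement:
  assumes G: "simple_graph_on n G" and i: "i < n" and l: "l \<le> n - 1"
  shows "coeff (resolvent_num (minus_ones (adj_mat G)) i i) (n - 1 - l) =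
    (\<Sum>j\<le>n - 1. (-1) ^ j * coeff (graph_poly (delete_vertex (complement G) (Suc i))) (n - 1 - j)
      * int ((n - 1 - j) choose (n - 1 - l)))"
proof -
  have M: "minus_ones (adj_mat G) \<in> carrier_mat n n" using G by simp
  have d: "graph_poly (delete_vertex (complement G) (Suc i)) = char_poly (neg_shift (mat_delete (minus_ones (adj_mat G)) i i))"
    unfolding graph_poly_def adjacency_delete[OF simple_complement[OF G] i] adjacency_complement[OF G]
      mat_delete_neg_shift[OF M i] ..
  show ?thesis
    unfolding d resolvent_diag[OF M i] by (rule coeff_char_poly_neg_shift[OF mat_delete_carrier[OF M] l])
qed

definition deck_card :: "nat \<Rightarrow> ugraph \<Rightarrow> nat \<Rightarrow> int list \<times> int list" where
  "deck_card k G i = (top_coeffs k (graph_poly (delete_vertex G (Suc i))),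
     top_coeffs k (graph_poly (delete_vertex (complement G) (Suc i))))"

lemma image_mset_deck_card:
  assumes G: "simple_graph_on n G"
  shows "truncated_deck k G = image_mset (deck_card k G) (mset_set {..<n})"
proof -
  have "mset_set {1..n} = image_mset Suc (mset_set {..<n})"
    by (subst image_mset_mset_set) (auto simp: image_Suc_lessThan)
  then show ?thesis
    using G by (simp add: truncated_deck_def simple_graph_on_def image_mset.compositionality)
      (simp add: comp_def deck_card_def[abs_def])
qed

text \<open>The deck is an unordered collection, but sums over all cards are sums over all vertices. Apart from
the number of cards and of coefficients per card, the reconstruction uses the deck only in such sums.\<close>

lemma sum_list_deck:
  fixes g :: "_ \<Rightarrow> 'a::comm_monoid_add"
  assumes G: "simple_graph_on n G" and "mset cards = truncated_deck k G"
  shows "sum_list (map g cards) = (\<Sum>i<n. g (deck_card k G i))"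
proof -
  have "sum_list (map g cards) = sum_mset (image_mset g (mset cards))"
    by (simp flip: sum_mset_sum_list)
  then show ?thesis
    by (simp add: assms(2) image_mset_deck_card[OF G] image_mset.compositionality o_def sum_unfold_sum_mset)
qed

lemma length_deck:
  assumes G: "simple_graph_on n G" and "mset cards = truncated_deck k G"
  shows "length cards = n"
  using arg_cong[OF assms(2), of size] by (simp add: image_mset_deck_card[OF G])

lemma set_deck:
  assumes G: "simple_graph_on n G" and "mset cards = truncated_deck k G"
  shows "set cards = deck_card k G ` {..<n}"
  using arg_cong[OF assms(2), of set_mset] by (simp add: image_mset_deck_card[OF G])

section \<open>Walk counts and the rank of the walk matrix\<close>

definition walk_count :: "int mat \<Rightarrow> nat \<Rightarrow> int" where
  "walk_count A t = (\<Sum>i<dim_row A. walks A t i)"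

text \<open>By symmetry \<open>\<langle>A\<^sup>s \<one>, A\<^sup>t \<one>\<rangle> = \<langle>\<one>, A\<^sup>s\<^sup>+\<^sup>t \<one>\<rangle>\<close>. Thus walk numbers up to length \<open>L\<close> give walk counts up to length
\<open>2 L\<close>, and the Hankel matrix of walk counts is a Gram matrix.\<close>

lemma walk_count_dot:
  assumes A: "A \<in> carrier_mat n n" and sym: "\<And>i j. i < n \<Longrightarrow> j < n \<Longrightarrow> A $$ (i, j) = A $$ (j, i)"
  shows "(\<Sum>i<n. walks A s i * walks A t i) = walk_count A (s + t)"
proof (induction s arbitrary: t)
  case 0
  then show ?case using A by (simp add: walk_count_def)
next
  case (Suc s)
  have [simp]: "dim_row A = n" using A by simp
  have "(\<Sum>i<n. walks A (Suc s) i * walks A t i) = (\<Sum>i<n. \<Sum>l<n. A $$ (i, l) * walks A s l * walks A t i)"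
    by (simp add: sum_distrib_right)
  also have "\<dots> = (\<Sum>l<n. \<Sum>i<n. A $$ (l, i) * walks A s l * walks A t i)"
    by (subst sum.swap) (simp add: sym)
  also have "\<dots> = (\<Sum>l<n. walks A s l * walks A (Suc t) l)"
    by (simp add: sum_distrib_left mult_ac)
  finally show ?case using Suc[of "Suc t"] by simp
qed

lemma walk_mat_col:
  assumes A: "A \<in> carrier_mat n n"
  shows "(A ^\<^sub>m k) *\<^sub>v vec n (\<lambda>_. 1) = vec n (walks A k)"
proof (induction k)
  case 0
  then show ?case using A by (intro eq_vecI) auto
next
  case (Suc k)
  have comm: "A ^\<^sub>m Suc k = A * A ^\<^sub>m k"
  proof (induction k)
    case (Suc k)
    have "A ^\<^sub>m Suc (Suc k) = (A * A ^\<^sub>m k) * A" using Suc by simp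
    also have "\<dots> = A * (A ^\<^sub>m k * A)" using A by (intro assoc_mult_mat[of _ n n _ n _ n]) auto
    finally show ?case by simp
  qed (use A in simp)
  have "(A ^\<^sub>m Suc k) *\<^sub>v vec n (\<lambda>_. 1) = A *\<^sub>v ((A ^\<^sub>m k) *\<^sub>v vec n (\<lambda>_. 1))"
    unfolding comm using A by (intro assoc_mult_mat_vec[of _ n n _ n]) auto
  also have "\<dots> = vec n (walks A (Suc k))"
    unfolding Suc using A by (intro eq_vecI) (auto simp: scalar_prod_def atLeast0LessThan)
  finally show ?case .
qed

text \<open>Linear dependence of \<open>\<one>, A \<one>, \<dots>, A\<^sup>m\<^sup>-\<^sup>1 \<one>\<close> is stated for the sequence of vectors and not for the set,
so that a repetition among them counts as a dependence.\<close>

definition walks_dependent :: "int mat \<Rightarrow> nat \<Rightarrow> bool" where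
  "walks_dependent A m \<longleftrightarrow> (\<exists>c :: nat \<Rightarrow> rat. (\<exists>j<m. c j \<noteq> 0) \<and>
     (\<forall>i<dim_row A. (\<Sum>j<m. c j * of_int (walks A j i)) = 0))"

text \<open>If the Gram matrix \<open>H\<close> kills \<open>c\<close>, then the norm of \<open>\<Sum>\<^sub>j c\<^sub>j A\<^sup>j \<one>\<close>, which is \<open>c\<^sup>T H c\<close>, vanishes. The
constant coefficient of the characteristic polynomial stands for the determinant.\<close>

lemma hankel_singular_iff:
  assumes A: "A \<in> carrier_mat n n" and sym: "\<And>i j. i < n \<Longrightarrow> j < n \<Longrightarrow> A $$ (i, j) = A $$ (j, i)"
  shows "coeff (char_poly (mat m m (\<lambda>(i, j). walk_count A (i + j)))) 0 = 0 \<longleftrightarrow> walks_dependent A m"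
proof -
  define H where "H = mat m m (\<lambda>(i, j). walk_count A (i + j))"
  let ?H = "map_mat rat_of_int H"
  have H: "H \<in> carrier_mat m m" "?H \<in> carrier_mat m m" by (auto simp: H_def)
  have [simp]: "dim_row A = n" using A by simp
  let ?w = "\<lambda>j l. rat_of_int (walks A j l)"
  have Hij: "?H $$ (i, j) = (\<Sum>l<n. ?w i l * ?w j l)" if "i < m" "j < m" for i j
    using that by (simp add: H_def walk_count_dot[OF A sym, symmetric])
  have Hv: "(?H *\<^sub>v vec m c) $ i = (\<Sum>l<n. ?w i l * (\<Sum>j<m. c j * ?w j l))" if "i < m" for c i
  proof -
    have "(?H *\<^sub>v vec m c) $ i = (\<Sum>j<m. ?H $$ (i, j) * c j)"
      using H that by (auto simp: scalar_prod_def atLeast0LessThan)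
    also have "\<dots> = (\<Sum>j<m. \<Sum>l<n. ?w i l * (c j * ?w j l))"
    proof (intro sum.cong refl)
      fix j assume "j \<in> {..<m}"
      then have "?H $$ (i, j) * c j = (\<Sum>l<n. ?w i l * ?w j l) * c j" using that by (simp only: Hij lessThan_iff)
      also have "\<dots> = (\<Sum>l<n. ?w i l * (c j * ?w j l))" by (simp add: sum_distrib_left mult_ac)
      finally show "?H $$ (i, j) * c j = (\<Sum>l<n. ?w i l * (c j * ?w j l))" .
    qed
    also have "\<dots> = (\<Sum>l<n. ?w i l * (\<Sum>j<m. c j * ?w j l))"
      by (subst sum.swap) (simp add: sum_distrib_left)
    finally show ?thesis .
  qed
  have hom: "char_poly ?H = map_poly rat_of_int (char_poly H)"
    by (rule of_int_hom.char_poly_hom[OF H(1)])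
  have "coeff (char_poly H) 0 = 0 \<longleftrightarrow> poly (char_poly ?H) 0 = 0"
    unfolding hom by (simp add: poly_0_coeff_0 coeff_map_poly)
  also have "\<dots> \<longleftrightarrow> eigenvalue ?H 0" by (rule eigenvalue_root_char_poly[OF H(2), symmetric])
  also have "\<dots> \<longleftrightarrow> (\<exists>v. v \<in> carrier_vec m \<and> v \<noteq> 0\<^sub>v m \<and> ?H *\<^sub>v v = 0\<^sub>v m)"
  proof -
    have "0 \<cdot>\<^sub>v v = 0\<^sub>v m" if "v \<in> carrier_vec m" for v :: "rat vec"
      using that by (intro eq_vecI) auto
    then show ?thesis using H by (auto simp: eigenvalue_def eigenvector_def)
  qed
  also have "\<dots> \<longleftrightarrow> walks_dependent A m"
  proof
    assume "\<exists>v. v \<in> carrier_vec m \<and> v \<noteq> 0\<^sub>v m \<and> ?H *\<^sub>v v = 0\<^sub>v m"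
    then obtain v where v: "v \<in> carrier_vec m" "v \<noteq> 0\<^sub>v m" "?H *\<^sub>v v = 0\<^sub>v m" by blast
    define c where "c j = v $ j" for j
    have vc: "v = vec m c" using v(1) by (intro eq_vecI) (auto simp: c_def)
    let ?s = "\<lambda>l. \<Sum>j<m. c j * ?w j l"
    have "(\<Sum>l<n. ?s l * ?s l) = (\<Sum>l<n. \<Sum>i<m. c i * (?w i l * ?s l))"
      by (simp add: sum_distrib_right mult.assoc)
    also have "\<dots> = (\<Sum>i<m. c i * (\<Sum>l<n. ?w i l * ?s l))"
      by (subst sum.swap) (simp add: sum_distrib_left)
    also have "\<dots> = (\<Sum>i<m. c i * (?H *\<^sub>v v) $ i)" unfolding vc using Hv by simp
    also have "\<dots> = 0" unfolding v(3) by simp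
    finally have "\<forall>l\<in>{..<n}. ?s l * ?s l = 0" by (subst (asm) sum_nonneg_eq_0_iff) auto
    then have "\<forall>l<n. ?s l = 0" by simp
    moreover have "\<exists>j<m. c j \<noteq> 0" using v(1,2) unfolding vc by (auto simp: vec_eq_iff)
    ultimately show "walks_dependent A m" unfolding walks_dependent_def by auto
  next
    assume "walks_dependent A m"
    then obtain c where c: "\<exists>j<m. c j \<noteq> 0" "\<forall>i<n. (\<Sum>j<m. c j * ?w j i) = 0"
      unfolding walks_dependent_def by auto
    have "?H *\<^sub>v vec m c = 0\<^sub>v m"
      using H by (intro eq_vecI) (auto simp del: index_mult_mat_vec simp: Hv c(2))
    moreover have "vec m c \<noteq> 0\<^sub>v m" using c(1) by (auto simp: vec_eq_iff)
    ultimately show "\<exists>v. v \<in> carrier_vec m \<and> v \<noteq> 0\<^sub>v m \<and> ?H *\<^sub>v v = 0\<^sub>v m"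
      by (intro exI[of _ "vec m c"]) simp
  qed
  finally show ?thesis unfolding H_def .
qed

text \<open>A Krylov sequence never leaves the span of its first \<open>J\<close> vectors once the next vector lies in it.\<close>

lemma walks_in_initial_span:
  assumes A: "A \<in> carrier_mat n n" and J: "\<forall>i<n. rat_of_int (walks A J i) = (\<Sum>j<J. a j * rat_of_int (walks A j i))"
  shows "\<exists>b. \<forall>i<n. rat_of_int (walks A t i) = (\<Sum>j<J. b j * rat_of_int (walks A j i))"
proof (induction t)
  case 0
  show ?case
  proof (cases "J = 0")
    case True
    then have "\<not> i < n" for i using J[rule_format, of i] by auto
    then show ?thesis by blast
  next
    case False
    have "(\<Sum>j<J. (if j = 0 then 1 else 0) * rat_of_int (walks A j i)) = 1" for i
    proof -
      have "(\<Sum>j<J. (if j = 0 then 1 else 0) * rat_of_int (walks A j i)) = (\<Sum>j<J. if j = 0 then 1 else 0)"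
        by (intro sum.cong refl) auto
      also have "\<dots> = 1" using False by simp
      finally show ?thesis .
    qed
    then show ?thesis
      by (intro exI[of _ "\<lambda>j. if j = 0 then 1 else 0"]) simp
  qed
next
  case (Suc t)
  then obtain b where b: "\<forall>i<n. rat_of_int (walks A t i) = (\<Sum>j<J. b j * rat_of_int (walks A j i))" by blast
  have [simp]: "dim_row A = n" using A by simp
  have s: "rat_of_int (walks A (Suc t) i) = (\<Sum>j<J. b j * rat_of_int (walks A (Suc j) i))" if "i < n" for i
  proof -
    have "rat_of_int (walks A (Suc t) i) = (\<Sum>l<n. of_int (A $$ (i, l)) * (\<Sum>j<J. b j * rat_of_int (walks A j l)))"
      using b by simp
    also have "\<dots> = (\<Sum>l<n. \<Sum>j<J. b j * (of_int (A $$ (i, l)) * rat_of_int (walks A j l)))"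
      by (intro sum.cong refl) (simp add: sum_distrib_left mult.left_commute)
    also have "\<dots> = (\<Sum>j<J. b j * (\<Sum>l<n. of_int (A $$ (i, l)) * rat_of_int (walks A j l)))"
      by (subst sum.swap) (simp only: sum_distrib_left)
    finally show ?thesis by simp
  qed
  show ?case
  proof (cases J)
    case 0
    then have "\<forall>i<n. rat_of_int (walks A (Suc t) i) = (\<Sum>j<J. 0 * rat_of_int (walks A j i))" using s by simp
    then show ?thesis by (rule exI[of _ "\<lambda>_. 0"])
  next
    case (Suc J')
    have "rat_of_int (walks A (Suc t) i) =
        (\<Sum>j<J. ((if j = 0 then 0 else b (j - 1)) + b J' * a j) * rat_of_int (walks A j i))" if i: "i < n" for i
    proof -
      have "(\<Sum>j<J. b j * rat_of_int (walks A (Suc j) i)) =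
          (\<Sum>j<J'. b j * rat_of_int (walks A (Suc j) i)) + b J' * rat_of_int (walks A J i)"
        unfolding Suc by (simp del: walks.simps)
      also have "(\<Sum>j<J'. b j * rat_of_int (walks A (Suc j) i)) =
          (\<Sum>j<J. (if j = 0 then 0 else b (j - 1)) * rat_of_int (walks A j i))"
        unfolding Suc by (subst sum.lessThan_Suc_shift) (simp del: walks.simps)
      also have "b J' * rat_of_int (walks A J i) = (\<Sum>j<J. b J' * a j * rat_of_int (walks A j i))"
        unfolding J[rule_format, OF i] by (simp only: sum_distrib_left mult.assoc)
      finally show ?thesis using s[OF i] by (simp only: distrib_right sum.distrib)
    qed
    then show ?thesis
      by (intro exI[of _ "\<lambda>j. (if j = 0 then 0 else b (j - 1)) + b J' * a j"]) simp
  qed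
qed

text \<open>If the first \<open>m\<close> columns are dependent, let \<open>J\<close> be the largest index with nonzero coefficient: all
columns lie in the span of the first \<open>J < m\<close> ones.\<close>

lemma walk_rank_ge_iff:
  assumes G: "simple_graph_on n G" and m: "m \<le> n"
  shows "m \<le> walk_rank G \<longleftrightarrow> \<not> walks_dependent (adj_mat G) m"
proof -
  define A where "A = adj_mat G"
  have A: "A \<in> carrier_mat n n" unfolding A_def using G by simp
  have [simp]: "dim_row A = n" using A by simp
  interpret vec_space "TYPE(rat)" n .
  define w where "w t = vec n (\<lambda>i. rat_of_int (walks A t i))" for t
  define W where "W = mat_of_cols n (map w [0..<n])"
  have wc [simp]: "w t \<in> carrier_vec n" for t by (simp add: w_def)
  have "map_mat rat_of_int (walk_mat G) = W" "dim_row (walk_mat G) = n"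
    unfolding walk_mat_def A_def[symmetric] Let_def W_def
    by (auto intro!: eq_matI simp: walk_mat_col[OF A] mat_of_cols_index w_def)
  then have rk: "walk_rank G = rank W" unfolding walk_rank_def by simp
  have W: "W \<in> carrier_mat n n" unfolding W_def using mat_of_cols_carrier(1)[of n "map w [0..<n]"] by simp
  have cW: "cols W = map w [0..<n]" unfolding W_def by (intro cols_mat_of_cols) auto
  show ?thesis
  proof
    assume ge: "m \<le> walk_rank G"
    show "\<not> walks_dependent (adj_mat G) m"
    proof
      assume "walks_dependent (adj_mat G) m"
      then obtain c where c: "\<exists>j<m. c j \<noteq> 0" "\<forall>i<n. (\<Sum>j<m. c j * rat_of_int (walks A j i)) = 0"
        unfolding walks_dependent_def A_def[symmetric] by auto
      define J where "J = Max {j. j < m \<and> c j \<noteq> 0}"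
      have "J \<in> {j. j < m \<and> c j \<noteq> 0}" unfolding J_def using c(1) by (intro Max_in) auto
      then have J: "J < m" "c J \<noteq> 0" by auto
      have J': "c j = 0" if "J < j" "j < m" for j
        using that Max_ge[of "{j. j < m \<and> c j \<noteq> 0}" j] unfolding J_def by fastforce
      have "rat_of_int (walks A J i) = (\<Sum>j<J. (- c j / c J) * rat_of_int (walks A j i))" if "i < n" for i
      proof -
        have "(\<Sum>j<m. c j * rat_of_int (walks A j i)) = (\<Sum>j<Suc J. c j * rat_of_int (walks A j i))"
          using J J' by (intro sum.mono_neutral_right) auto
        then have "c J * rat_of_int (walks A J i) = - (\<Sum>j<J. c j * rat_of_int (walks A j i))"
          using c(2) that by (simp add: algebra_simps add_eq_0_iff)
        then have "rat_of_int (walks A J i) = - (\<Sum>j<J. c j * rat_of_int (walks A j i)) / c J"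
          using J(2) by (simp add: field_simps)
        then show ?thesis by (simp add: sum_divide_distrib sum_negf)
      qed
      then have sp: "\<exists>b. \<forall>i<n. rat_of_int (walks A t i) = (\<Sum>j<J. b j * rat_of_int (walks A j i))" for t
        by (intro walks_in_initial_span[OF A, of J "\<lambda>j. - c j / c J"]) simp
      let ?U = "w ` {..<J}"
      have U: "?U \<subseteq> carrier_vec n" "finite ?U" by auto
      have part: "vec n (\<lambda>i. \<Sum>j<k. b j * rat_of_int (walks A j i)) \<in> span ?U" if "k \<le> J" for k b
        using that
      proof (induction k)
        case 0
        have "vec n (\<lambda>i. \<Sum>j<0. b j * rat_of_int (walks A j i)) = 0\<^sub>v n" by auto
        then show ?case using span_zero by (metis U(1) span_is_submodule[of ?U] module.span_is_submodule submodule.zero_closed module_vec_simps(2))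
      next
        case (Suc k)
        have "vec n (\<lambda>i. \<Sum>j<Suc k. b j * rat_of_int (walks A j i)) =
            vec n (\<lambda>i. \<Sum>j<k. b j * rat_of_int (walks A j i)) + b k \<cdot>\<^sub>v w k"
          by (intro eq_vecI) (auto simp: w_def)
        moreover have "w k \<in> span ?U" using Suc.prems by (intro span_mem[OF U(1)]) auto
        ultimately show ?case
          using Suc U(1) span_add1[OF U(1)] smult_in_span[OF U(1)] by (simp add: module_vec_simps)
      qed
      have "w t \<in> span ?U" for t
      proof -
        obtain b where "\<forall>i<n. rat_of_int (walks A t i) = (\<Sum>j<J. b j * rat_of_int (walks A j i))" using sp by blast
        then have "w t = vec n (\<lambda>i. \<Sum>j<J. b j * rat_of_int (walks A j i))"
          unfolding w_def by (intro eq_vecI) auto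
        then show ?thesis using part[of J b] by simp
      qed
      then have "set (cols W) \<subseteq> span ?U" unfolding cW by auto
      then have "span (set (cols W)) \<subseteq> span ?U"
        using span_is_subset span_is_submodule U(1) by simp
      moreover have "span ?U \<subseteq> span (set (cols W))"
        unfolding cW using J(1) m by (intro span_is_monotone) auto
      ultimately have "rank W = vectorspace.dim class_ring (span_vs ?U)" unfolding rank_def by simp
      moreover obtain S where S: "maximal S (\<lambda>T. T \<subseteq> ?U \<and> lin_indpt T)"
        using maximal_exists_superset[of ?U "\<lambda>T. T \<subseteq> ?U \<and> lin_indpt T" "{}"] U(2)
          finite_lin_indpt2[of "{}"] by auto
      ultimately have "rank W = card S" using dim_span[OF _ U(2) S] U(1) by simp
      also have "\<dots> \<le> card ?U" using S U(2) by (intro card_mono) (auto simp: maximal_def)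
      also have "\<dots> \<le> J" using card_image_le[of "{..<J}" w] by simp
      finally show False using ge J(1) rk by simp
    qed
  next
    assume indep: "\<not> walks_dependent (adj_mat G) m"
    define V where "V = mat_of_cols n (map w [0..<m])"
    have V: "V \<in> carrier_mat n m" unfolding V_def using mat_of_cols_carrier(1)[of n "map w [0..<m]"] by simp
    have cV: "cols V = map w [0..<m]" unfolding V_def by (intro cols_mat_of_cols) auto
    have dep: "walks_dependent (adj_mat G) m"
      if v: "v \<in> carrier_vec m" "v \<noteq> 0\<^sub>v m" "V *\<^sub>v v = 0\<^sub>v n" for v
    proof -
      have "(\<Sum>j<m. v $ j * rat_of_int (walks A j i)) = 0" if "i < n" for i
      proof -
        have "(V *\<^sub>v v) $ i = (\<Sum>j<m. v $ j * rat_of_int (walks A j i))"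
          using V v(1) that by (auto simp: scalar_prod_def atLeast0LessThan V_def mat_of_cols_index w_def intro!: sum.cong)
        then show ?thesis using v(3) that by simp
      qed
      moreover have "\<exists>j<m. v $ j \<noteq> 0" using v(1,2) by (auto simp: vec_eq_iff)
      ultimately show ?thesis unfolding walks_dependent_def A_def[symmetric] by auto
    qed
    have dist: "distinct (cols V)"
    proof (rule ccontr)
      assume "\<not> distinct (cols V)"
      then obtain a b where ab: "a < m" "b < m" "a \<noteq> b" "w a = w b"
        unfolding cV by (auto simp: distinct_conv_nth)
      have "rat_of_int (walks A a i) = rat_of_int (walks A b i)" if "i < n" for i
        using arg_cong[OF ab(4), of "\<lambda>v. v $ i"] that by (simp add: w_def)
      then have "(\<Sum>j<m. (if j = a then 1 else if j = b then -1 else 0) * rat_of_int (walks A j i)) = 0" if "i < n" for i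
        using ab that by (subst sum.remove[of _ a], simp, simp, subst sum.remove[of _ b]) (auto intro!: sum.neutral)
      then have "walks_dependent (adj_mat G) m"
        unfolding walks_dependent_def A_def[symmetric]
        by (intro exI[of _ "\<lambda>j. if j = a then 1 else if j = b then -1 else 0"] conjI exI[of _ a])
          (use ab(1) in auto)
      with indep show False ..
    qed
    have "lin_indpt (set (cols V))"
      using lin_depE[OF V _ dist] dep indep by blast
    moreover have "set (cols V) \<subseteq> set (cols W)" unfolding cV cW using m by auto
    ultimately have "card (set (cols V)) \<le> rank W" by (intro rank_ge_card_indpt[OF W])
    moreover have "card (set (cols V)) = m" using distinct_card[OF dist] by (simp add: cV)
    ultimately show "m \<le> walk_rank G" by (simp add: rk)
  qed
qed

section \<open>The reconstruction algorithm\<close>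

text \<open>The algorithm is a function on lists of integers; \<open>K\<close> is the number of coefficients per card. Lists
of top coefficients start with the leading coefficient. Entries beyond the end of a list are read
as \<open>0\<close>, so a truncated list can be used like the list of all coefficients with the unknown
ones replaced by \<open>0\<close>.\<close>

abbreviation item :: "int list \<Rightarrow> nat \<Rightarrow> int" where
  "item xs i \<equiv> nth_default 0 xs i"

abbreviation mat_item :: "int list list \<Rightarrow> nat \<Rightarrow> nat \<Rightarrow> int" where
  "mat_item M i j \<equiv> item (nth_default [] M i) j"

definition integrate_deck :: "int list list \<Rightarrow> nat \<Rightarrow> int list" where
  "integrate_deck ls K = map (\<lambda>j. sum_list (map (\<lambda>c. item c j) ls) div (int (length ls) - int j)) [0..<K]"

definition reflect_coeffs :: "nat \<Rightarrow> int list \<Rightarrow> nat \<Rightarrow> int list" where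
  "reflect_coeffs n p K =
    map (\<lambda>l. \<Sum>j<K. (-1) ^ j * item p j * int ((n - j) choose (n - l))) [0..<K]"

definition conv :: "int list \<Rightarrow> int list \<Rightarrow> nat \<Rightarrow> int" where
  "conv a b t = (\<Sum>s<Suc t. item a s * item b (t - s))"

text \<open>A value that exceeds the a priori bound \<open>B\<close> is replaced by \<open>0\<close>. On decks of graphs this never
happens; it makes the loop below have small intermediate results on every input.\<close>

definition clamp :: "int \<Rightarrow> int \<Rightarrow> int" where
  "clamp B v = (if - B \<le> v \<and> v \<le> B then v else 0)"

text \<open>With \<open>C\<close> the coefficients of \<open>a\<^sub>i\<^sup>2\<close> and \<open>D\<close> those of \<open>\<phi>\<^sup>2\<close>, the list \<open>us\<close> of walk numbers \<open>w\<^sub>0, \<dots>, w\<^sub>t\<close> is extended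
by the solution of \<open>C = D u\<^sup>2\<close> at index \<open>t + 1\<close>. There the new number occurs only in the term
\<open>2 D\<^sub>0 u\<^sub>0 u\<^sub>t\<^sub>+\<^sub>1 = 2 u\<^sub>t\<^sub>+\<^sub>1\<close>; the sum runs over the other terms because reading beyond the end of \<open>us\<close> gives \<open>0\<close>.\<close>

definition walk_step :: "int \<Rightarrow> int list \<Rightarrow> int list \<Rightarrow> int list \<Rightarrow> nat \<Rightarrow> int list" where
  "walk_step B C D us t =
    us @ [clamp B ((item C (Suc t) - (\<Sum>a<Suc (Suc t). item D a * conv us us (Suc t - a))) div 2)]"

definition walk_list :: "nat \<Rightarrow> nat \<Rightarrow> int list \<Rightarrow> int list \<Rightarrow> int list \<Rightarrow> int list \<Rightarrow> int list" where
  "walk_list n K P F Pv Fv =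
    foldl (walk_step (int n ^ n)
      (map (\<lambda>t. conv Pv F (Suc t) - conv P Fv (Suc t)) [0..<K - 1])
      (map (\<lambda>t. conv P P t) [0..<K])) [1] [0..<K - 2]"

text \<open>The walk numbers are known for lengths up to \<open>K - 2\<close>, so a length \<open>t \<le> 2 (K - 2)\<close> is split with its first part as long
as possible.\<close>

definition count_list :: "nat \<Rightarrow> nat \<Rightarrow> int list list \<Rightarrow> int list" where
  "count_list n K us =
    map (\<lambda>t. sum_list (map (\<lambda>u. item u (min t (K - 2)) * item u (t - min t (K - 2))) us)) [0..<n + n]"

definition hankel_mult :: "int list \<Rightarrow> nat \<Rightarrow> int list list \<Rightarrow> nat \<Rightarrow> nat \<Rightarrow> int" where
  "hankel_mult N m M i j = (\<Sum>l<m. item N (i + l) * mat_item M l j)"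

text \<open>One Faddeev-LeVerrier step for the Hankel matrix of \<open>N\<close>, from \<open>B\<^sub>m\<^sub>-\<^sub>1\<^sub>-\<^sub>k\<close> to \<open>B\<^sub>m\<^sub>-\<^sub>2\<^sub>-\<^sub>k\<close>. Starting from
\<open>B\<^sub>m\<^sub>-\<^sub>1 = I\<close>, after \<open>m - 1\<close> steps the result is \<open>B\<^sub>0\<close>, the adjugate up to sign.\<close>

definition adjugate_step :: "int list \<Rightarrow> nat \<Rightarrow> int list list \<Rightarrow> nat \<Rightarrow> int list list" where
  "adjugate_step N m M k = map (\<lambda>i. map (\<lambda>j. hankel_mult N m M i j +
      (if i = j then - (\<Sum>a<m. hankel_mult N m M a a) div int (Suc k) else 0)) [0..<m]) [0..<m]"

definition hankel_adjugate :: "int list \<Rightarrow> nat \<Rightarrow> int list list" where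
  "hankel_adjugate N m = foldl (adjugate_step N m)
     (map (\<lambda>i. map (\<lambda>j. if i = j then 1 else 0) [0..<m]) [0..<m]) [0..<m - 1]"

text \<open>Solves for the lowest \<open>m\<close> coefficients with the inverse \<open>M / d\<close> of the Hankel matrix. The inner sum
may run over all \<open>i \<le> n\<close>, because \<open>P\<close> is read as \<open>0\<close> at the unknown coefficients. Both this list and the result of the next
function are full coefficient lists, constant coefficient first.\<close>

definition complete_coeffs :: "nat \<Rightarrow> nat \<Rightarrow> int list \<Rightarrow> int list \<Rightarrow> int list list \<Rightarrow> int \<Rightarrow> int list" where
  "complete_coeffs n m P N M d = map (\<lambda>j. if j < m
     then (\<Sum>l<m. mat_item M j l * - (\<Sum>i<Suc n. item P (n - i) * item N (i + l))) div d
     else item P (n - j)) [0..<Suc n]"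

text \<open>The inner list consists of the coefficients of \<open>f = \<phi> + \<Sum>\<^sub>i a\<^sub>i\<close> from the top.\<close>

definition complement_coeffs :: "nat \<Rightarrow> int list \<Rightarrow> int list \<Rightarrow> int list" where
  "complement_coeffs n phi N = rev (reflect_coeffs n
     (map (\<lambda>l. item phi (n - l) + (\<Sum>t<l. item phi (n - (l - 1 - t)) * item N t)) [0..<Suc n]) (Suc n))"

definition solve_counts :: "nat \<Rightarrow> nat \<Rightarrow> int list \<Rightarrow> int list \<Rightarrow> int list list" where
  "solve_counts n m P N =
    (let M = hankel_adjugate N m; d = hankel_mult N m M 0 0 in
     if d = 0 then [] else
     let phi = complete_coeffs n m P N M d in [phi, complement_coeffs n phi N])"

definition deck_counts :: "nat \<Rightarrow> nat \<Rightarrow> (int list \<times> int list) list \<Rightarrow> int list \<Rightarrow> int list \<Rightarrow> int list" where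
  "deck_counts n K cards P F =
    count_list n K (map (\<lambda>c. walk_list n K P F (fst c) (reflect_coeffs (n - 1) (snd c) K)) cards)"

text \<open>On three vertices the characteristic polynomial is \<open>x\<^sup>3 - e x - 2 T\<close> with \<open>e\<close> edges and \<open>T\<close> triangles,
and \<open>T = 1\<close> exactly if \<open>e = 3\<close>. The complement has \<open>3 - e\<close> edges.\<close>

definition three_vertex_answer :: "int \<Rightarrow> int list list" where
  "three_vertex_answer e =
    [[if e = 3 then -2 else 0, - e, 0, 1], [if e = 0 then -2 else 0, e - 3, 0, 1]]"

definition reconstruct :: "(int list \<times> int list) list \<Rightarrow> int list list" where
  "reconstruct cards =
    (let n = length cards; K = length (fst (nth_default ([], []) cards 0));
         P = integrate_deck (map fst cards) K in
     if n < 4 then three_vertex_answer (- item P 2) else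
     let F = reflect_coeffs n (integrate_deck (map snd cards) K) K in
     solve_counts n (n + 1 - K) P (deck_counts n K cards P F))"

lemma item_map_upt: "item (map f [0..<k]) i = (if i < k then f i else 0)"
  by (simp add: nth_default_def)

section \<open>Solving the Hankel system\<close>

abbreviation hankel_mat :: "(nat \<Rightarrow> int) \<Rightarrow> nat \<Rightarrow> int mat" where
  "hankel_mat N m \<equiv> mat m m (\<lambda>(i, j). N (i + j))"

text \<open>The integer division in the loop is exact by the trace formula, since \<open>m - (m - 1 - s) = s + 1\<close>.\<close>

lemma hankel_adjugate_steps:
  assumes "s < m"
  shows "foldl (adjugate_step N m) (map (\<lambda>i. map (\<lambda>j. if i = j then 1 else 0) [0..<m]) [0..<m]) [0..<s]
    = map (\<lambda>i. map (\<lambda>j. resolvent_coeff (hankel_mat (item N) m) (m - 1 - s) i j) [0..<m]) [0..<m]"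
  using assms
proof (induction s)
  case 0
  let ?H = "hankel_mat (item N) m"
  have "resolvent_coeff ?H (m - 1) i j = (if i = j then 1 else 0)" if "i < m" "j < m" for i j
    by (rule resolvent_coeff_top) (use that in auto)
  then show ?case by simp
next
  case (Suc s)
  let ?H = "hankel_mat (item N) m"
  have H: "?H \<in> carrier_mat m m" by simp
  define k where "k = m - 1 - Suc s"
  have k: "m - 1 - s = Suc k" "int m - int (Suc k) = int (Suc s)" using Suc.prems by (auto simp: k_def)
  let ?M = "map (\<lambda>i. map (\<lambda>j. resolvent_coeff ?H (Suc k) i j) [0..<m]) [0..<m]"
  have mult: "hankel_mult N m ?M i j = (\<Sum>l<m. ?H $$ (i, l) * resolvent_coeff ?H (Suc k) l j)"
    if "i < m" "j < m" for i j
    unfolding hankel_mult_def using that by (intro sum.cong refl) (simp add: nth_default_def)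
  have "(\<Sum>a<m. hankel_mult N m ?M a a) = (\<Sum>a<m. \<Sum>l<m. ?H $$ (a, l) * resolvent_coeff ?H (Suc k) l a)"
    by (intro sum.cong refl) (simp only: mult lessThan_iff)
  also have "\<dots> = - (int (Suc s) * coeff (char_poly ?H) (Suc k))"
    unfolding char_poly_coeff_trace[OF H] using k(2) by (simp add: algebra_simps)
  finally have tr: "- (\<Sum>a<m. hankel_mult N m ?M a a) div int (Suc s) = coeff (char_poly ?H) (Suc k)"
    by (simp del: of_nat_Suc)
  have "adjugate_step N m ?M s = map (\<lambda>i. map (\<lambda>j. resolvent_coeff ?H k i j) [0..<m]) [0..<m]"
    unfolding adjugate_step_def tr
    by (intro map_cong refl) (simp only: mult resolvent_coeff_rec[OF H, of _ _ k] set_upt atLeastLessThan_iff)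
  moreover have "foldl (adjugate_step N m) (map (\<lambda>i. map (\<lambda>j. if i = j then 1 else 0) [0..<m]) [0..<m]) [0..<s] = ?M"
    using Suc.IH Suc.prems unfolding k(1) by simp
  ultimately show ?case unfolding k_def[symmetric] by simp
qed

lemma hankel_adjugate:
  assumes "0 < m"
  shows "hankel_adjugate N m
    = map (\<lambda>i. map (\<lambda>j. resolvent_coeff (hankel_mat (item N) m) 0 i j) [0..<m]) [0..<m]"
  unfolding hankel_adjugate_def using hankel_adjugate_steps[of "m - 1" m N] assms by simp

lemma resolvent_coeff_0_right:
  assumes A: "A \<in> carrier_mat n n" and ij: "i < n" "j < n"
  shows "(\<Sum>l<n. resolvent_coeff A 0 i l * A $$ (l, j)) = (if i = j then - coeff (char_poly A) 0 else 0)"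
  using arg_cong[OF resolvent_right[OF assms], of "\<lambda>p. coeff p 0"]
  by (auto simp: coeff_sum resolvent_coeff_def mult.commute split: if_splits)

text \<open>The \<open>(0, 0)\<close> entry of \<open>H B\<^sub>0 = - \<chi>\<^sub>0 I\<close>, where \<open>\<chi>\<close> is the characteristic polynomial of \<open>H\<close>, decides
singularity. If it is nonzero, multiplying the Hankel equations by \<open>B\<^sub>0\<close> from the left isolates each
unknown coefficient.\<close>

lemma complete_coeffs_correct:
  assumes A: "A \<in> carrier_mat n n" and sym: "\<And>i j. i < n \<Longrightarrow> j < n \<Longrightarrow> A $$ (i, j) = A $$ (j, i)"
    and m: "0 < m" "m \<le> n"
    and P: "\<And>j. item P j = (if j \<le> n - m then coeff (char_poly A) (n - j) else 0)"
    and N: "\<And>t. t < n + m \<Longrightarrow> item N t = walk_count A t"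
  shows "hankel_mult N m (hankel_adjugate N m) 0 0 = 0 \<longleftrightarrow> walks_dependent A m"
    and "\<not> walks_dependent A m \<Longrightarrow>
      complete_coeffs n m P N (hankel_adjugate N m) (hankel_mult N m (hankel_adjugate N m) 0 0)
        = map (coeff (char_poly A)) [0..<Suc n]"
proof -
  let ?H = "hankel_mat (item N) m" and ?M = "hankel_adjugate N m"
  let ?c = "coeff (char_poly A)"
  have H: "?H \<in> carrier_mat m m" by simp
  have Heq: "?H = hankel_mat (walk_count A) m" using m N by (intro eq_matI) auto
  have ent: "mat_item ?M i j = resolvent_coeff ?H 0 i j" if "i < m" "j < m" for i j
    unfolding hankel_adjugate[OF m(1)] using that by (simp add: nth_default_def)
  define d where "d = hankel_mult N m ?M 0 0"
  have "d = (\<Sum>l<m. ?H $$ (0, l) * resolvent_coeff ?H 0 l 0)"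
    unfolding d_def hankel_mult_def using m by (intro sum.cong refl) (simp add: ent)
  then have d: "d = - coeff (char_poly ?H) 0" unfolding resolvent_coeff_0[OF H m(1) m(1)] by simp
  show dep: "hankel_mult N m ?M 0 0 = 0 \<longleftrightarrow> walks_dependent A m"
    using hankel_singular_iff[OF A sym, of m] unfolding d_def[symmetric] d Heq by simp
  assume "\<not> walks_dependent A m"
  then have d0: "d \<noteq> 0" using dep d_def by simp
  have low: "- (\<Sum>i<Suc n. item P (n - i) * item N (i + l)) = (\<Sum>j<m. ?H $$ (l, j) * ?c j)" if l: "l < m" for l
  proof -
    have "(\<Sum>i<Suc n. ?c i * walk_count A (i + l)) = (\<Sum>a<n. \<Sum>i\<le>n. ?c i * walks A (i + l) a)"
      using A by (subst sum.swap) (simp add: walk_count_def sum_distrib_left lessThan_Suc_atMost)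
    also have "\<dots> = 0" using walks_recurrence[OF A] by simp
    finally have "(\<Sum>i<Suc n. ?c i * walk_count A (i + l)) = 0" .
    moreover have "(\<Sum>i<Suc n. ?c i * walk_count A (i + l)) =
      (\<Sum>i<Suc n. (if i < m then ?c i * walk_count A (i + l) else 0) + item P (n - i) * item N (i + l))"
      using N l m by (intro sum.cong refl) (auto simp: P)
    moreover have "(\<Sum>i<Suc n. if i < m then ?c i * walk_count A (i + l) else 0) = (\<Sum>i<m. ?c i * walk_count A (i + l))"
      using m by (intro sum.mono_neutral_cong_right) auto
    moreover have "(\<Sum>i<m. ?c i * walk_count A (i + l)) = (\<Sum>j<m. ?H $$ (l, j) * ?c j)"
      using N l m by (intro sum.cong refl) (auto simp: add.commute)
    ultimately show ?thesis by (simp add: sum.distrib)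
  qed
  have sol: "(\<Sum>l<m. mat_item ?M j l * - (\<Sum>i<Suc n. item P (n - i) * item N (i + l))) = d * ?c j" if j: "j < m" for j
  proof -
    have "(\<Sum>l<m. mat_item ?M j l * - (\<Sum>i<Suc n. item P (n - i) * item N (i + l))) =
      (\<Sum>l<m. resolvent_coeff ?H 0 j l * (\<Sum>k<m. ?H $$ (l, k) * ?c k))"
      by (intro sum.cong refl) (simp only: ent[OF j] low lessThan_iff)
    also have "\<dots> = (\<Sum>k<m. (\<Sum>l<m. resolvent_coeff ?H 0 j l * ?H $$ (l, k)) * ?c k)"
      by (simp only: sum_distrib_left sum_distrib_right mult.assoc) (rule sum.swap)
    also have "\<dots> = (\<Sum>k<m. if j = k then d * ?c j else 0)"
      by (intro sum.cong refl) (simp only: resolvent_coeff_0_right[OF H j] lessThan_iff d, simp)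
    also have "\<dots> = d * ?c j" using j by simp
    finally show ?thesis .
  qed
  show "complete_coeffs n m P N ?M (hankel_mult N m ?M 0 0) = map ?c [0..<Suc n]"
    unfolding complete_coeffs_def d_def[symmetric]
  proof (intro map_cong refl)
    fix j assume "j \<in> set [0..<Suc n]"
    then have "j \<le> n" by auto
    then show "(if j < m then (\<Sum>l<m. mat_item ?M j l * - (\<Sum>i<Suc n. item P (n - i) * item N (i + l))) div d
       else item P (n - j)) = ?c j"
    proof (cases "j < m")
      case True
      have "d * coeff (char_poly A) j div d = coeff (char_poly A) j" using d0 by simp
      then show ?thesis by (simp only: True if_True sol)
    next
      case False
      then have "n - j \<le> n - m" "n - (n - j) = j" using \<open>j \<le> n\<close> m by auto
      then show ?thesis using False by (simp add: P del: sum.lessThan_Suc)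
    qed
  qed
qed

section \<open>Recovering the complement\<close>

lemma item_reflect_coeffs:
  assumes "l < K" "K \<le> Suc n" "\<And>j. j < K \<Longrightarrow> item p j = c j"
  shows "item (reflect_coeffs n p K) l = (\<Sum>j\<le>n. (-1) ^ j * c j * int ((n - j) choose (n - l)))"
proof -
  have "item (reflect_coeffs n p K) l = (\<Sum>j<K. (-1) ^ j * c j * int ((n - j) choose (n - l)))"
    using assms by (simp add: reflect_coeffs_def item_map_upt)
  also have "\<dots> = (\<Sum>j\<le>n. (-1) ^ j * c j * int ((n - j) choose (n - l)))"
    using assms by (intro sum.mono_neutral_left) auto
  finally show ?thesis .
qed

lemma length_reflect_coeffs [simp]: "length (reflect_coeffs n p K) = K"
  by (simp add: reflect_coeffs_def)

lemma coeffs_monic: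
  assumes "degree p = n" "coeff p n = (1 :: int)"
  shows "coeffs p = map (coeff p) [0..<Suc n]"
  using assms by (auto simp: coeffs_def)

lemma complement_coeffs_correct:
  assumes G: "simple_graph_on n G"
    and N: "\<And>t. t < n \<Longrightarrow> item N t = walk_count (adj_mat G) t"
  shows "complement_coeffs n (map (coeff (graph_poly G)) [0..<Suc n]) N = coeffs (graph_poly (complement G))"
proof -
  let ?A = "adj_mat G" and ?q = "graph_poly (complement G)"
  let ?f = "char_poly (minus_ones ?A)"
  have A: "?A \<in> carrier_mat n n" using G by simp
  have [simp]: "dim_row ?A = n" using A by simp
  let ?phi = "map (coeff (graph_poly G)) [0..<Suc n]"
  have f: "item ?phi (n - l) + (\<Sum>t<l. item ?phi (n - (l - 1 - t)) * item N t) = coeff ?f (n - l)" if l: "l \<le> n" for l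
  proof -
    have 1: "item ?phi (n - l) = coeff (char_poly ?A) (n - l)" for l
      by (simp add: item_map_upt graph_poly_def del: upt_Suc)
    have "coeff (\<Sum>i<n. row_num ?A i) (n - l) = (\<Sum>t<l. coeff (char_poly ?A) (n - (l - 1 - t)) * walk_count ?A t)"
    proof (cases l)
      case 0
      have "coeff (row_num ?A i) n = 0" if "i < n" for i
        unfolding coeff_row_num using that by (simp add: resolvent_coeff_ge[OF A])
      then show ?thesis using 0 by (simp add: coeff_sum)
    next
      case (Suc l')
      have "n - l = n - 1 - l'" "l' < n" using Suc l by auto
      then have "coeff (\<Sum>i<n. row_num ?A i) (n - l) =
          (\<Sum>i<n. \<Sum>t\<le>l'. coeff (char_poly ?A) (n - (l' - t)) * walks ?A t i)"
        by (simp only: coeff_sum) (intro sum.cong refl coeff_row_num_walks[OF A], auto)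
      also have "\<dots> = (\<Sum>t\<le>l'. coeff (char_poly ?A) (n - (l' - t)) * walk_count ?A t)"
        by (subst sum.swap) (simp add: walk_count_def sum_distrib_left)
      finally show ?thesis using Suc by (simp add: lessThan_Suc_atMost)
    qed
    moreover have "(\<Sum>t<l. item ?phi (n - (l - 1 - t)) * item N t) =
       (\<Sum>t<l. coeff (char_poly ?A) (n - (l - 1 - t)) * walk_count ?A t)"
      using l by (intro sum.cong refl) (simp only: 1 N lessThan_iff less_le_trans)
    ultimately show ?thesis unfolding char_poly_minus_ones[OF A] 1 by simp
  qed
  let ?F = "map (\<lambda>l. item ?phi (n - l) + (\<Sum>t<l. item ?phi (n - (l - 1 - t)) * item N t)) [0..<Suc n]"
  have F: "item ?F j = coeff ?f (n - j)" if "j < Suc n" for j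
    by (subst item_map_upt) (simp only: that if_True f[OF less_Suc_eq_le[THEN iffD1, OF that]])
  have R: "item (reflect_coeffs n ?F (Suc n)) l = coeff ?q (n - l)" if "l < Suc n" for l
    using item_reflect_coeffs[OF that order.refl F] coeff_graph_poly_complement(2)[OF G, of l] that by simp
  have "reflect_coeffs n ?F (Suc n) = map (\<lambda>l. coeff ?q (n - l)) [0..<Suc n]"
  proof (rule nth_equalityI)
    fix l assume "l < length (reflect_coeffs n ?F (Suc n))"
    then have l: "l < Suc n" by (simp only: length_reflect_coeffs)
    then show "reflect_coeffs n ?F (Suc n) ! l = map (\<lambda>l. coeff ?q (n - l)) [0..<Suc n] ! l"
      using R[OF l] by (simp add: nth_default_nth del: upt_Suc)
  qed simp
  then have "complement_coeffs n ?phi N = map (coeff ?q) (rev (map (\<lambda>l. n - l) [0..<Suc n]))"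
    unfolding complement_coeffs_def by (simp add: rev_map o_def del: upt_Suc)
  also have "rev (map (\<lambda>l. n - l) [0..<Suc n]) = [0..<Suc n]"
    by (rule nth_equalityI) (auto simp: rev_nth simp del: upt_Suc)
  also have "map (coeff ?q) [0..<Suc n] = coeffs ?q"
    using degree_monic_char_poly[OF adjacency_carrier[OF simple_complement[OF G]]]
    by (intro coeffs_monic[symmetric]) (simp_all add: graph_poly_def)
  finally show ?thesis .
qed

section \<open>Walk numbers from a single card\<close>

lemma conv_eq_coeff: "conv a b t = coeff (Poly a * Poly b) t"
  by (simp add: conv_def coeff_mult lessThan_Suc_atMost del: sum.lessThan_Suc sum.atMost_Suc)

text \<open>Let \<open>p\<close>, \<open>v\<close> and \<open>u\<close> be the polynomials in \<open>1 / x\<close> with coefficients \<open>P\<close>, the walk numbers up to \<open>t\<close>, and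
those up to \<open>t + 1\<close>. Then \<open>(p u)\<^sup>2 - p\<^sup>2 v\<^sup>2 = p\<^sup>2 (u - v) (u + v)\<close>, and as \<open>u - v\<close> is a monomial of degree
\<open>t + 1\<close>, only the constant coefficients of \<open>p\<^sup>2\<close> and \<open>u + v\<close>, which are \<open>1\<close> and \<open>2\<close>, matter.\<close>

lemma walk_step_correct:
  assumes P0: "item P 0 = 1" and U0: "U 0 = 1"
    and C: "item C (Suc t) = (\<Sum>s\<le>Suc t. S s * S (Suc t - s))"
    and S: "\<And>s. s \<le> Suc t \<Longrightarrow> S s = (\<Sum>j\<le>s. item P (s - j) * U j)"
    and D: "\<And>a. a \<le> Suc t \<Longrightarrow> item D a = conv P P a"
    and bound: "\<bar>U (Suc t)\<bar> \<le> B"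
  shows "walk_step B C D (map U [0..<Suc t]) t = map U [0..<Suc (Suc t)]"
proof -
  let ?us = "map U [0..<Suc t]"
  define p v w u where "p = Poly P" "v = Poly ?us" "w = monom (U (Suc t)) (Suc t)" "u = v + w"
  have v: "coeff v j = (if j \<le> t then U j else 0)" for j
    by (auto simp: p_v_w_u_def nth_default_def simp del: upt_Suc)
  have u: "coeff u j = U j" if "j \<le> Suc t" for j
    using that by (cases "j = Suc t") (simp_all add: p_v_w_u_def(4) v, simp_all add: p_v_w_u_def(3))
  have pu: "coeff (p * u) s = S s" if "s \<le> Suc t" for s
  proof -
    have "coeff (p * u) s = coeff (u * p) s" by (simp add: mult.commute)
    also have "\<dots> = (\<Sum>j\<le>s. item P (s - j) * U j)"
      unfolding coeff_mult using that by (intro sum.cong refl) (simp add: u p_v_w_u_def(1) mult.commute)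
    finally show ?thesis using S[OF that] by simp
  qed
  have "item C (Suc t) = coeff ((p * u) * (p * u)) (Suc t)"
    unfolding C coeff_mult[of "p * u" "p * u"] by (intro sum.cong refl) (simp add: pu)
  moreover have "(\<Sum>a<Suc (Suc t). item D a * conv ?us ?us (Suc t - a)) = coeff ((p * p) * (v * v)) (Suc t)"
    unfolding coeff_mult[of "p * p"] lessThan_Suc_atMost
    by (intro sum.cong refl) (simp add: D conv_eq_coeff p_v_w_u_def(1,2))
  moreover have "(p * u) * (p * u) - (p * p) * (v * v) = w * (p * p * (u + v))"
    unfolding p_v_w_u_def(4) by (simp add: algebra_simps)
  moreover have "coeff (w * (p * p * (u + v))) (Suc t) = 2 * U (Suc t)"
    unfolding p_v_w_u_def(3) by (simp add: coeff_monom_mult coeff_mult_0 u v U0 p_v_w_u_def(1) P0)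
  ultimately have "item C (Suc t) - (\<Sum>a<Suc (Suc t). item D a * conv ?us ?us (Suc t - a)) = 2 * U (Suc t)"
    by (metis coeff_diff)
  then have "clamp B ((item C (Suc t) - (\<Sum>a<Suc (Suc t). item D a * conv ?us ?us (Suc t - a))) div 2) = U (Suc t)"
    using bound by (simp only:) (simp add: clamp_def abs_le_iff)
  then show ?thesis unfolding walk_step_def by (simp only:) simp
qed

lemma coeff_mult_top:
  fixes p q :: "int poly"
  assumes "degree p \<le> d" "degree q \<le> e" "s \<le> d" "s \<le> e"
  shows "coeff (p * q) (d + e - s) = (\<Sum>j\<le>s. coeff p (d - j) * coeff q (e - (s - j)))"
proof -
  have "coeff (p * q) (d + e - s) = (\<Sum>i\<in>{d - s..d}. coeff p i * coeff q (d + e - s - i))"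
    unfolding coeff_mult
  proof (rule sum.mono_neutral_right)
    show "\<forall>i\<in>{..d + e - s} - {d - s..d}. coeff p i * coeff q (d + e - s - i) = 0"
    proof
      fix i assume "i \<in> {..d + e - s} - {d - s..d}"
      then have "i > d \<or> d + e - s - i > e" using assms(3) by auto
      then show "coeff p i * coeff q (d + e - s - i) = 0"
        using assms(1,2) by (auto simp: coeff_eq_0)
    qed
  qed (use assms in auto)
  also have "\<dots> = (\<Sum>j\<le>s. coeff p (d - j) * coeff q (e - (s - j)))"
  proof (rule sum.reindex_bij_witness[of _ "\<lambda>j. d - j" "\<lambda>i. d - i"])
    fix i assume i: "i \<in> {d - s..d}"
    then have "d - (d - i) = i" "e - (s - (d - i)) = d + e - s - i" using assms by auto
    then show "coeff p (d - (d - i)) * coeff q (e - (s - (d - i))) = coeff p i * coeff q (d + e - s - i)"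
      by simp
  qed (use assms in auto)
  finally show ?thesis .
qed

lemma walks_bound:
  assumes A: "A \<in> carrier_mat n n" and b: "\<And>i j. i < n \<Longrightarrow> j < n \<Longrightarrow> \<bar>A $$ (i, j)\<bar> \<le> 1"
  shows "i < n \<Longrightarrow> \<bar>walks A t i\<bar> \<le> int n ^ t"
proof (induction t arbitrary: i)
  case (Suc t)
  have "\<bar>\<Sum>l<n. A $$ (i, l) * walks A t l\<bar> \<le> (\<Sum>l<n. 1 * int n ^ t)"
  proof (rule order.trans[OF sum_abs sum_mono])
    fix l assume "l \<in> {..<n}"
    then show "\<bar>A $$ (i, l) * walks A t l\<bar> \<le> 1 * int n ^ t"
      unfolding abs_mult using Suc b by (intro mult_mono) auto
  qed
  then show ?case using A by simp
qed simp

text \<open>The equation \<open>f \<phi>\<^sub>i - \<phi> f\<^sub>i = a\<^sub>i\<^sup>2\<close> has degree \<open>2 n - 2\<close> although the products on the left have degree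
\<open>2 n - 1\<close>; the shift by one explains why \<open>K\<close> known coefficients give only \<open>K - 1\<close> walk numbers.\<close>

lemma walk_list_correct:
  assumes A: "A \<in> carrier_mat n n" and sym: "\<And>i j. i < n \<Longrightarrow> j < n \<Longrightarrow> A $$ (i, j) = A $$ (j, i)"
    and b: "\<And>i j. i < n \<Longrightarrow> j < n \<Longrightarrow> \<bar>A $$ (i, j)\<bar> \<le> 1"
    and i: "i < n" and K: "2 \<le> K" "K \<le> n"
    and P: "\<And>j. j < K \<Longrightarrow> item P j = coeff (char_poly A) (n - j)"
    and F: "\<And>j. j < K \<Longrightarrow> item F j = coeff (char_poly (minus_ones A)) (n - j)"
    and Pv: "\<And>j. j < K \<Longrightarrow> item Pv j = coeff (resolvent_num A i i) (n - 1 - j)"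
    and Fv: "\<And>j. j < K \<Longrightarrow> item Fv j = coeff (resolvent_num (minus_ones A) i i) (n - 1 - j)"
  shows "walk_list n K P F Pv Fv = map (\<lambda>t. walks A t i) [0..<K - 1]"
proof -
  let ?U = "\<lambda>t. walks A t i" and ?S = "\<lambda>s. coeff (row_num A i) (n - 1 - s)"
  let ?C = "map (\<lambda>t. conv Pv F (Suc t) - conv P Fv (Suc t)) [0..<K - 1]"
  let ?D = "map (\<lambda>t. conv P P t) [0..<K]"
  have B: "minus_ones A \<in> carrier_mat n n" using A by simp
  have deg: "degree (char_poly A) \<le> n" "degree (char_poly (minus_ones A)) \<le> n"
    "degree (resolvent_num A i i) \<le> n - 1" "degree (resolvent_num (minus_ones A) i i) \<le> n - 1"
    using degree_monic_char_poly[OF A] degree_monic_char_poly[OF B]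
      degree_monic_char_poly[OF mat_delete_carrier[OF A]] degree_monic_char_poly[OF mat_delete_carrier[OF B]]
    by (simp_all add: resolvent_diag[OF A i] resolvent_diag[OF B i])
  have "degree (row_num A i) \<le> n - 1"
  proof (rule degree_le, intro allI impI)
    fix k assume "k > n - 1"
    then have "k \<ge> n" by simp
    then show "coeff (row_num A i) k = 0"
      unfolding coeff_row_num using A i by (simp add: resolvent_coeff_ge[OF A])
  qed
  note deg = deg this
  have C: "item ?C t = (\<Sum>s\<le>t. ?S s * ?S (t - s))" if t: "t < K - 1" for t
  proof -
    let ?N = "n + (n - 1) - Suc t"
    have "conv Pv F (Suc t) = (\<Sum>s\<le>Suc t. coeff (resolvent_num A i i) (n - 1 - s) * coeff (char_poly (minus_ones A)) (n - (Suc t - s)))"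
      unfolding conv_def lessThan_Suc_atMost by (intro sum.cong refl arg_cong2[where f = times] Pv F) (use t in auto)
    also have "\<dots> = coeff (resolvent_num A i i * char_poly (minus_ones A)) (n - 1 + n - Suc t)"
      by (rule coeff_mult_top[symmetric]) (use deg t K in auto)
    finally have 1: "conv Pv F (Suc t) = coeff (char_poly (minus_ones A) * resolvent_num A i i) ?N"
      by (simp add: mult.commute add.commute)
    have "conv P Fv (Suc t) = (\<Sum>s\<le>Suc t. coeff (char_poly A) (n - s) * coeff (resolvent_num (minus_ones A) i i) (n - 1 - (Suc t - s)))"
      unfolding conv_def lessThan_Suc_atMost by (intro sum.cong refl arg_cong2[where f = times] P Fv) (use t in auto)
    also have "\<dots> = coeff (char_poly A * resolvent_num (minus_ones A) i i) ?N"
      by (rule coeff_mult_top[symmetric]) (use deg t K in auto)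
    finally have 2: "conv P Fv (Suc t) = coeff (char_poly A * resolvent_num (minus_ones A) i i) ?N" .
    have "item ?C t = coeff (row_num A i * row_num A i) ?N"
      using t by (simp add: item_map_upt 1 2 flip: coeff_diff rank_one_update[OF A sym i i])
    also have "?N = (n - 1) + (n - 1) - t" using t K by simp
    also have "coeff (row_num A i * row_num A i) \<dots> = (\<Sum>s\<le>t. ?S s * ?S (t - s))"
      by (rule coeff_mult_top) (use deg t K in auto)
    finally show ?thesis .
  qed
  have S: "?S s = (\<Sum>j\<le>s. item P (s - j) * ?U j)" if "s < K" for s
  proof -
    have "?S s = (\<Sum>j\<le>s. coeff (char_poly A) (n - (s - j)) * walks A j i)"
      by (rule coeff_row_num_walks[OF A]) (use that K i in auto)
    also have "\<dots> = (\<Sum>j\<le>s. item P (s - j) * ?U j)"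
      by (intro sum.cong refl) (use that in \<open>simp add: P\<close>)
    finally show ?thesis .
  qed
  have P0: "item P 0 = 1" using P[of 0] K char_poly_coeffs(1)[OF A] by simp
  have "foldl (walk_step (int n ^ n) ?C ?D) [1] [0..<r] = map ?U [0..<Suc r]" if "r \<le> K - 2" for r
    using that
  proof (induction r)
    case (Suc r)
    have "walk_step (int n ^ n) ?C ?D (map ?U [0..<Suc r]) r = map ?U [0..<Suc (Suc r)]"
    proof (rule walk_step_correct[of P ?U _ _ ?S, OF P0])
      show "item ?C (Suc r) = (\<Sum>s\<le>Suc r. ?S s * ?S (Suc r - s))" using Suc.prems by (intro C) auto
      show "?S s = (\<Sum>j\<le>s. item P (s - j) * ?U j)" if "s \<le> Suc r" for s
        using that Suc.prems K by (intro S) auto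
      show "item ?D a = conv P P a" if "a \<le> Suc r" for a
        using that Suc.prems K by (simp add: item_map_upt)
      have "\<bar>?U (Suc r)\<bar> \<le> int n ^ Suc r" by (rule walks_bound[OF A b i])
      also have "\<dots> \<le> int n ^ n" using Suc.prems K by (intro power_increasing) auto
      finally show "\<bar>?U (Suc r)\<bar> \<le> int n ^ n" .
    qed simp
    moreover have "foldl (walk_step (int n ^ n) ?C ?D) [1] [0..<r] = map ?U [0..<Suc r]"
      using Suc by simp
    ultimately show ?case by (simp only: upt_Suc foldl_append foldl_Cons foldl_Nil le0 if_True)
  qed simp
  from this[of "K - 2"] show ?thesis
    unfolding walk_list_def using K by (simp add: Suc_diff_Suc numeral_2_eq_2 del: upt_Suc)
qed

lemma top_coeffs_eq:
  assumes "degree p = n - 1" "k \<le> n" "0 < n"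
  shows "top_coeffs k p = map (\<lambda>j. coeff p (n - 1 - j)) [0..<k]"
  using assms by (simp add: top_coeffs_def)

lemma integrate_deck_correct:
  assumes A: "A \<in> carrier_mat n n" and len: "length ls = n" and j: "j < K" "K \<le> n"
    and sum: "sum_list (map (\<lambda>c. item c j) ls) = (\<Sum>i<n. coeff (char_poly (mat_delete A i i)) (n - 1 - j))"
  shows "item (integrate_deck ls K) j = coeff (char_poly A) (n - j)"
proof -
  have "(\<Sum>i<n. coeff (char_poly (mat_delete A i i)) (n - 1 - j)) = coeff (pderiv (char_poly A)) (n - 1 - j)"
    by (simp add: pderiv_char_poly[OF A] coeff_sum)
  also have "\<dots> = (int n - int j) * coeff (char_poly A) (n - j)"
  proof -
    have "Suc (n - 1 - j) = n - j" using j by simp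
    then show ?thesis using j by (simp add: coeff_pderiv of_nat_diff del: of_nat_Suc)
  qed
  finally show ?thesis using j by (simp add: integrate_deck_def item_map_upt len sum)
qed

section \<open>Correctness of the algorithm\<close>
context
  fixes n G K cards
  assumes G: "simple_graph_on n G" and K: "K \<le> n" and n: "0 < n"
    and cards: "mset cards = truncated_deck K G"
begin

lemma deck_card_fst: "i < n \<Longrightarrow>
    fst (deck_card K G i) = map (\<lambda>j. coeff (resolvent_num (adj_mat G) i i) (n - 1 - j)) [0..<K]"
  using top_coeffs_eq[OF graph_poly_delete_degree[OF G] K n, of i] graph_poly_delete[OF G, of i]
  by (simp add: deck_card_def)

lemma deck_card_snd: "i < n \<Longrightarrow> snd (deck_card K G i) =
    map (\<lambda>j. coeff (graph_poly (delete_vertex (complement G) (Suc i))) (n - 1 - j)) [0..<K]"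
  using top_coeffs_eq[OF graph_poly_delete_degree[OF simple_complement[OF G]] K n, of i]
  by (simp add: deck_card_def)

lemma length_cards: "length cards = n"
  by (rule length_deck[OF G cards])

lemma length_first_card: "length (fst (nth_default ([], []) cards 0)) = K"
proof -
  have "cards ! 0 \<in> set cards" using length_cards n by (intro nth_mem) simp
  then obtain i where "i < n" "cards ! 0 = deck_card K G i" unfolding set_deck[OF G cards] by auto
  then show ?thesis using length_cards n by (simp add: nth_default_nth deck_card_fst)
qed

lemma integrated_deck: "j < K \<Longrightarrow>
    item (integrate_deck (map fst cards) K) j = coeff (graph_poly G) (n - j)"
  unfolding graph_poly_def
proof (rule integrate_deck_correct[OF adjacency_carrier[OF G] _ _ K])
  assume j: "j < K"
  show "sum_list (map (\<lambda>c. item c j) (map fst cards)) =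
      (\<Sum>i<n. coeff (char_poly (mat_delete (adj_mat G) i i)) (n - 1 - j))"
    unfolding map_map o_def sum_list_deck[OF G cards]
    by (intro sum.cong refl)
      (simp add: deck_card_fst item_map_upt j resolvent_diag[OF adjacency_carrier[OF G]])
qed (simp_all add: length_cards)

lemma integrated_complement_deck: "j < K \<Longrightarrow>
    item (integrate_deck (map snd cards) K) j = coeff (graph_poly (complement G)) (n - j)"
  unfolding graph_poly_def
proof (rule integrate_deck_correct[OF adjacency_carrier[OF simple_complement[OF G]] _ _ K])
  assume j: "j < K"
  show "sum_list (map (\<lambda>c. item c j) (map snd cards)) =
      (\<Sum>i<n. coeff (char_poly (mat_delete (adj_mat (complement G)) i i)) (n - 1 - j))"
    unfolding map_map o_def sum_list_deck[OF G cards]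
    by (intro sum.cong refl)
      (simp add: deck_card_snd item_map_upt j graph_poly_def adjacency_delete[OF simple_complement[OF G]])
qed (simp_all add: length_cards)

text \<open>The bound on \<open>t\<close> is what makes both parts of the split of \<open>t\<close> have known walk numbers.\<close>

lemma deck_counts_correct:
  assumes K2: "2 \<le> K" and t: "t \<le> 2 * (K - 2)" "t < 2 * n"
    and P: "P = integrate_deck (map fst cards) K"
    and F: "F = reflect_coeffs n (integrate_deck (map snd cards) K) K"
  shows "item (deck_counts n K cards P F) t = walk_count (adj_mat G) t"
proof -
  let ?A = "adj_mat G" and ?B = "minus_ones (adj_mat G)"
  have A: "?A \<in> carrier_mat n n" using G by simp
  have Pj: "item P j = coeff (char_poly ?A) (n - j)" if "j < K" for j
    using integrated_deck[OF that] by (simp add: P graph_poly_def)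
  have Fj: "item F j = coeff (char_poly ?B) (n - j)" if "j < K" for j
  proof -
    have "item F j = (\<Sum>l\<le>n. (-1) ^ l * coeff (graph_poly (complement G)) (n - l) * int ((n - l) choose (n - j)))"
      unfolding F by (rule item_reflect_coeffs[OF that]) (use K integrated_complement_deck in auto)
    then show ?thesis using coeff_graph_poly_complement(1)[OF G, of j] that K by simp
  qed
  have walk: "walk_list n K P F (fst (deck_card K G i)) (reflect_coeffs (n - 1) (snd (deck_card K G i)) K)
      = map (\<lambda>t. walks ?A t i) [0..<K - 1]" if i: "i < n" for i
  proof (rule walk_list_correct[OF A adjacency_symmetric[OF G] adjacency_bound[OF G] i K2 K Pj Fj])
    show "item (fst (deck_card K G i)) j = coeff (resolvent_num ?A i i) (n - 1 - j)" if "j < K" for j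
      using that by (simp add: deck_card_fst[OF i] item_map_upt)
    show "item (reflect_coeffs (n - 1) (snd (deck_card K G i)) K) j = coeff (resolvent_num ?B i i) (n - 1 - j)"
      if "j < K" for j
    proof -
      have "item (reflect_coeffs (n - 1) (snd (deck_card K G i)) K) j =
        (\<Sum>l\<le>n - 1. (-1) ^ l * coeff (graph_poly (delete_vertex (complement G) (Suc i))) (n - 1 - l)
          * int ((n - 1 - l) choose (n - 1 - j)))"
        by (rule item_reflect_coeffs[OF that]) (use K n in \<open>auto simp: deck_card_snd[OF i] item_map_upt\<close>)
      then show ?thesis using coeff_graph_poly_delete_complement[OF G i, of j] that K by simp
    qed
  qed
  let ?a = "min t (K - 2)"
  have a: "?a < K - 1" "t - ?a < K - 1" "?a + (t - ?a) = t" using t K2 by auto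
  have "item (deck_counts n K cards P F) t =
    (\<Sum>i<n. item (map (\<lambda>t. walks ?A t i) [0..<K - 1]) ?a * item (map (\<lambda>t. walks ?A t i) [0..<K - 1]) (t - ?a))"
    unfolding deck_counts_def count_list_def map_map o_def sum_list_deck[OF G cards]
  proof -
    have "t < n + n" using t(2) by simp
    then show "item (map (\<lambda>t. \<Sum>i<n. item (walk_list n K P F (fst (deck_card K G i)) (reflect_coeffs (n - 1) (snd (deck_card K G i)) K)) (min t (K - 2)) *
        item (walk_list n K P F (fst (deck_card K G i)) (reflect_coeffs (n - 1) (snd (deck_card K G i)) K)) (t - min t (K - 2))) [0..<n + n]) t =
      (\<Sum>i<n. item (map (\<lambda>t. walks ?A t i) [0..<K - 1]) ?a * item (map (\<lambda>t. walks ?A t i) [0..<K - 1]) (t - ?a))"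
      by (subst item_map_upt, simp only: if_True, intro sum.cong refl, simp only: walk lessThan_iff)
  qed
  also have "\<dots> = (\<Sum>i<n. walks ?A ?a i * walks ?A (t - ?a) i)"
    using a(1,2) by (simp only: item_map_upt if_True)
  also have "\<dots> = walk_count ?A t"
    by (subst walk_count_dot[OF A adjacency_symmetric[OF G]]) (simp_all only: a(3))
  finally show ?thesis .
qed

text \<open>The Hankel equations need walk counts up to \<open>n + m - 1 = 2 n - K\<close>, and those up to \<open>2 (K - 2)\<close> are known.
Comparing the two gives the hypothesis \<open>2 n + 4 \<le> 3 K\<close>.\<close>

lemma reconstruct_correct_ge_4:
  assumes n4: "4 \<le> n" and K3: "2 * n + 4 \<le> 3 * K"
  shows "reconstruct cards = (if n + 1 - K \<le> walk_rank G
     then [coeffs (graph_poly G), coeffs (graph_poly (complement G))] else [])"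
proof -
  let ?A = "adj_mat G"
  have A: "?A \<in> carrier_mat n n" using G by simp
  define P where "P = integrate_deck (map fst cards) K"
  define F where "F = reflect_coeffs n (integrate_deck (map snd cards) K) K"
  define N where "N = deck_counts n K cards P F"
  define m where "m = n + 1 - K"
  define M where "M = hankel_adjugate N m"
  define d where "d = hankel_mult N m M 0 0"
  have m: "0 < m" "m \<le> n" using K n4 K3 by (auto simp: m_def)
  have Nt: "item N t = walk_count ?A t" if "t < n + m" for t
    unfolding N_def by (rule deck_counts_correct[OF _ _ _ P_def F_def]) (use that K3 K n4 in \<open>auto simp: m_def\<close>)
  have Pj: "item P j = (if j \<le> n - m then coeff (char_poly ?A) (n - j) else 0)" for j
  proof (cases "j < K")
    case True
    then show ?thesis using integrated_deck[OF True] K by (auto simp: P_def graph_poly_def m_def)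
  next
    case False
    then have "\<not> j \<le> n - m" using K K3 n4 by (auto simp: m_def)
    then show ?thesis using False by (simp add: P_def integrate_deck_def item_map_upt)
  qed
  note solve = complete_coeffs_correct[OF A adjacency_symmetric[OF G] m Pj Nt, folded M_def, folded d_def]
  have "reconstruct cards = solve_counts n m P N"
    unfolding reconstruct_def Let_def length_cards length_first_card
    using n4 by (simp add: P_def F_def N_def m_def)
  also have "\<dots> = (if d = 0 then [] else
      [complete_coeffs n m P N M d, complement_coeffs n (complete_coeffs n m P N M d) N])"
    unfolding solve_counts_def Let_def M_def[symmetric] d_def[symmetric] ..
  also have "\<dots> = (if m \<le> walk_rank G
     then [coeffs (graph_poly G), coeffs (graph_poly (complement G))] else [])"
  proof (cases "d = 0")
    case True
    then show ?thesis using solve(1) walk_rank_ge_iff[OF G m(2)] by simp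
  next
    case False
    then have nd: "\<not> walks_dependent ?A m" using solve(1) by simp
    have c: "complete_coeffs n m P N M d = map (coeff (graph_poly G)) [0..<Suc n]"
      unfolding graph_poly_def by (rule solve(2)) (use nd in auto)
    have cc: "complement_coeffs n (map (coeff (graph_poly G)) [0..<Suc n]) N = coeffs (graph_poly (complement G))"
      by (rule complement_coeffs_correct[OF G]) (use Nt m in auto)
    have gc: "map (coeff (graph_poly G)) [0..<Suc n] = coeffs (graph_poly G)"
      using degree_monic_char_poly[OF A] by (intro coeffs_monic[symmetric]) (simp_all add: graph_poly_def)
    show ?thesis
      using False nd walk_rank_ge_iff[OF G m(2)] unfolding c cc unfolding gc by simp
  qed
  finally show ?thesis unfolding m_def .
qed

end

text \<open>The Faddeev-LeVerrier recursion carried out by hand.\<close>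

lemma char_poly_three:
  fixes A :: "int mat"
  assumes A: "A \<in> carrier_mat 3 3" and sym: "\<And>i j. i < 3 \<Longrightarrow> j < 3 \<Longrightarrow> A $$ (i, j) = A $$ (j, i)"
    and diag: "\<And>i. i < 3 \<Longrightarrow> A $$ (i, i) = 0"
  defines "a \<equiv> A $$ (0, 1)" and "b \<equiv> A $$ (0, 2)" and "c \<equiv> A $$ (1, 2)"
  shows "coeffs (char_poly A) = [- 2 * a * b * c, - (a * a + b * b + c * c), 0, 1]"
proof -
  have s: "A $$ (0, 1) = a" "A $$ (1, 0) = a" "A $$ (0, 2) = b" "A $$ (2, 0) = b"
    "A $$ (1, 2) = c" "A $$ (2, 1) = c" "A $$ (0, 0) = 0" "A $$ (1, 1) = 0" "A $$ (2, 2) = 0"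
    using sym diag by (auto simp: a_def b_def c_def)
  note ss = s s[unfolded One_nat_def]
  have sum3: "(\<Sum>i<3. f i) = f 0 + f 1 + f 2" for f :: "nat \<Rightarrow> int"
    by (simp add: numeral_3_eq_3 numeral_2_eq_2)
  let ?B = "resolvent_coeff A" and ?c = "coeff (char_poly A)"
  have B2: "?B 2 i j = (if i = j then 1 else 0)" if "i < 3" "j < 3" for i j
    using resolvent_coeff_top[OF A that] by simp
  have c2: "?c 2 = 0"
    using char_poly_coeff_trace[OF A, of 2] by (simp add: sum3 B2 ss)
  have B1: "?B 1 i j = A $$ (i, j)" if "i < 3" "j < 3" for i j
  proof -
    have "?B 1 i j = (\<Sum>l<3. A $$ (i, l) * ?B 2 l j) + (if i = j then ?c 2 else 0)"
      using resolvent_coeff_rec[OF A that, of 1] by (simp add: numeral_2_eq_2)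
    also have "\<dots> = (\<Sum>l<3. A $$ (i, l) * ?B 2 l j)" by (simp add: c2)
    also have "\<dots> = (\<Sum>l<3. if l = j then A $$ (i, l) else 0)"
      by (intro sum.cong refl) (simp add: B2 that)
    finally show ?thesis using that by simp
  qed
  have c1: "?c 1 = - (a * a + b * b + c * c)"
    using char_poly_coeff_trace[OF A, of 1] by (simp add: sum3 B1 B1[unfolded One_nat_def] ss)
  have B0: "?B 0 i j = (\<Sum>l<3. A $$ (i, l) * A $$ (l, j)) + (if i = j then ?c 1 else 0)" if "i < 3" "j < 3" for i j
  proof -
    have "(\<Sum>l<3. A $$ (i, l) * ?B 1 l j) = (\<Sum>l<3. A $$ (i, l) * A $$ (l, j))"
      by (intro sum.cong refl) (simp only: B1 that lessThan_iff)
    then show ?thesis using resolvent_coeff_rec[OF A that, of 0] by simp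
  qed
  have c0: "?c 0 = - 2 * a * b * c"
    using char_poly_coeff_trace[OF A, of 0] by (simp add: sum3 B0 ss c1 c1[unfolded One_nat_def])
  have "coeffs (char_poly A) = map ?c [0..<Suc 3]"
    using degree_monic_char_poly[OF A] by (intro coeffs_monic) auto
  also have "\<dots> = [?c 0, ?c 1, ?c 2, ?c 3]" by (simp add: upt_rec numeral_eq_Suc)
  finally show ?thesis using c0 c1 c2 char_poly_coeffs(1)[OF A] by simp
qed

text \<open>The general method fails here: with three coefficients per card only \<open>N\<^sub>0\<close>, \<open>N\<^sub>1\<close>, \<open>N\<^sub>2\<close> are known, while
an equation for the constant coefficient would need \<open>N\<^sub>3\<close>.\<close>

lemma reconstruct_correct_3:
  assumes G: "simple_graph_on 3 G" and cards: "mset cards = truncated_deck K G" and K: "3 < K"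
  shows "reconstruct cards = [coeffs (graph_poly G), coeffs (graph_poly (complement G))]"
proof -
  let ?A = "adj_mat G" and ?A' = "adj_mat (complement G)"
  note G' = simple_complement[OF G]
  have "top_coeffs K p = top_coeffs 3 p" if "degree p = 2" for p
    using that K by (simp add: top_coeffs_def min_def)
  moreover have "degree (graph_poly (delete_vertex G (Suc i))) = 2" "degree (graph_poly (delete_vertex (complement G) (Suc i))) = 2"
    if "i < 3" for i using graph_poly_delete_degree[OF G that] graph_poly_delete_degree[OF G' that] by simp_all
  ultimately have "truncated_deck K G = truncated_deck 3 G"
    unfolding image_mset_deck_card[OF G] by (intro image_mset_cong) (simp add: deck_card_def)
  then have cards3: "mset cards = truncated_deck 3 G" using cards by simp
  note ctx = G order.refl zero_less_numeral cards3
  have len: "length cards = 3" by (rule length_cards[OF ctx])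
  have K3: "length (fst (nth_default ([], []) cards 0)) = 3" by (rule length_first_card[OF ctx])
  have P2: "item (integrate_deck (map fst cards) 3) 2 = coeff (graph_poly G) 1"
    using integrated_deck[OF ctx, of 2] by simp
  define a b c where "a = ?A $$ (0, 1)" "b = ?A $$ (0, 2)" "c = ?A $$ (1, 2)"
  have p: "coeffs (graph_poly G) = [- 2 * a * b * c, - (a * a + b * b + c * c), 0, 1]"
    unfolding graph_poly_def a_b_c_def
    by (rule char_poly_three[OF adjacency_carrier[OF G] adjacency_symmetric[OF G] adjacency_diag[OF G]])
  have compl: "?A' $$ (i, j) = 1 - ?A $$ (i, j)" if "i < 3" "j < 3" "i \<noteq> j" for i j
    unfolding adjacency_complement[OF G] using that carrier_matD[OF adjacency_carrier[OF G]]
    by (simp add: neg_shift_def minus_ones_def)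
  have q: "coeffs (graph_poly (complement G)) = [- 2 * (1 - a) * (1 - b) * (1 - c),
      - ((1 - a) * (1 - a) + (1 - b) * (1 - b) + (1 - c) * (1 - c)), 0, 1]"
    unfolding graph_poly_def a_b_c_def
    using char_poly_three[OF adjacency_carrier[OF G'] adjacency_symmetric[OF G'] adjacency_diag[OF G']]
    by (simp add: compl)
  have "coeff (graph_poly G) 1 = - (a * a + b * b + c * c)"
    using nth_default_coeffs_eq[of "graph_poly G"] unfolding p by (metis (no_types) One_nat_def nth_default_Cons_0 nth_default_Cons_Suc)
  then have e: "- coeff (graph_poly G) 1 = a * a + b * b + c * c" by simp
  have "reconstruct cards = three_vertex_answer (a * a + b * b + c * c)"
    unfolding reconstruct_def Let_def len K3 P2 by (simp only: e, simp)
  moreover have "a \<in> {0, 1}" "b \<in> {0, 1}" "c \<in> {0, 1}"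
    by (auto simp: a_b_c_def adjacency_index[OF G])
  ultimately show ?thesis
    unfolding p q by (auto simp: three_vertex_answer_def)
qed

theorem reconstruct_correct:
  assumes n: "3 \<le> n" and G: "simple_graph_on n G"
    and cards: "mset cards = truncated_deck (nat \<lceil>(2 * real n + 4) / 3\<rceil>) G"
  shows "reconstruct cards = (if int (walk_rank G) \<ge> \<lfloor>(real n - 1) / 3\<rfloor>
     then [coeffs (graph_poly G), coeffs (graph_poly (complement G))] else [])"
proof -
  define K where "K = nat \<lceil>(2 * real n + 4) / 3\<rceil>"
  have "int K = \<lceil>(2 * real n + 4) / 3\<rceil>" unfolding K_def by simp
  then have "real K \<ge> (2 * real n + 4) / 3" "real K < (2 * real n + 4) / 3 + 1"
    using ceiling_correct[of "(2 * real n + 4) / 3"] by linarith+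
  then have r: "3 * real K \<ge> 2 * real n + 4" "3 * real K < 2 * real n + 7" by (simp_all add: field_simps)
  then have K: "2 * n + 4 \<le> 3 * K" "3 * K < 2 * n + 7" by linarith+
  have fl: "\<lfloor>(real n - 1) / 3\<rfloor> = int n + 1 - int K"
    using r by (intro floor_unique) simp_all
  show ?thesis
  proof (cases "n = 3")
    case True
    then have "K = 4" using K by simp
    then show ?thesis
      using reconstruct_correct_3[OF G[unfolded True] cards[folded K_def, unfolded True]] True
      unfolding fl by simp
  next
    case False
    then have "4 \<le> n" "K \<le> n" using n K by auto
    with reconstruct_correct_ge_4[OF G \<open>K \<le> n\<close> _ cards[folded K_def] _ K(1)] show ?thesis
      unfolding fl by auto
  qed
qed

section \<open>Encoded data\<close>
class encodable =
  fixes enc :: "'a \<Rightarrow> val"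

instantiation int :: encodable
begin
definition enc_int :: "int \<Rightarrow> val" where "enc_int k = Num k"
instance ..
end

instantiation bool :: encodable
begin
definition enc_bool :: "bool \<Rightarrow> val" where "enc_bool b = Num (of_bool b)"
instance ..
end

text \<open>Natural numbers serve as indices and loop bounds and are encoded in unary, so that the size of a number
bounds its value. Then intervals, sums and powers with such bounds are polynomial in the size of the
input without side conditions; long numbers are integers.\<close>
instantiation nat :: encodable
begin
definition enc_nat :: "nat \<Rightarrow> val" where "enc_nat n = Lst (replicate n (Lst []))"
instance ..
end

instantiation list :: (encodable) encodable
begin
definition enc_list :: "'a list \<Rightarrow> val" where "enc_list xs = Lst (map enc xs)"
instance ..
end

instantiation prod :: (encodable, encodable) encodable
begin
definition enc_prod :: "'a \<times> 'b \<Rightarrow> val" where "enc_prod z = Lst [enc (fst z), enc (snd z)]"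
instance ..
end

lemmas enc_defs = enc_int_def enc_bool_def enc_nat_def enc_list_def enc_prod_def

abbreviation sz :: "'a::encodable \<Rightarrow> nat" where "sz x \<equiv> vsize (enc x)"

section \<open>Time bounds of programs\<close>

text \<open>Working with upper bounds on the time makes the bounds compositional: a program that runs within
\<open>B\<close> also returns a value of size at most \<open>B\<close>, as every step pays for what it produces.\<close>

definition runs :: "val list \<Rightarrow> exp \<Rightarrow> val \<Rightarrow> nat \<Rightarrow> bool" where
  "runs env e v B \<longleftrightarrow> (\<exists>t\<le>B. eval env e v t)"

lemma eval_size: "eval env e v t \<Longrightarrow> vsize v \<le> t"
  by (induction rule: eval.induct) auto

lemma runs_size: "runs env e v B \<Longrightarrow> vsize v \<le> B"
  using eval_size le_trans unfolding runs_def by blast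

lemma runs_mono: "runs env e v B \<Longrightarrow> B \<le> B' \<Longrightarrow> runs env e v B'"
  unfolding runs_def by (meson le_trans)

lemma floorlog2_mono: "a \<le> b \<Longrightarrow> floorlog 2 a \<le> floorlog 2 b"
  by (rule floorlog_mono)

lemma floorlog2_less: "floorlog 2 a \<le> k \<longleftrightarrow> a < 2 ^ k"
proof
  assume "floorlog 2 a \<le> k"
  then show "a < 2 ^ k"
    using floorlog_bounds[of a 2]
    by (cases "a = 0") (auto intro: less_le_trans[OF _ power_increasing])
next
  assume "a < 2 ^ k"
  then show "floorlog 2 a \<le> k"
    using floorlog_leI[of a 2 k] by simp
qed

lemma floorlog2_lt_pow: "a < 2 ^ floorlog 2 a"
  using floorlog2_less by blast

lemma floorlog2_add: "floorlog 2 (a + b) \<le> 1 + floorlog 2 a + floorlog 2 b"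
proof -
  have "a < 2 ^ (floorlog 2 a + floorlog 2 b)" "b < 2 ^ (floorlog 2 a + floorlog 2 b)"
    using floorlog2_lt_pow[of a] floorlog2_lt_pow[of b]
    by (auto intro: less_le_trans[OF _ power_increasing])
  then show ?thesis
    by (subst floorlog2_less) simp
qed

lemma floorlog2_mult: "floorlog 2 (a * b) \<le> floorlog 2 a + floorlog 2 b"
  by (subst floorlog2_less)
    (simp add: power_add mult_strict_mono' floorlog2_lt_pow)

lemma floorlog2_le: "floorlog 2 a \<le> a"
  using floorlog2_less[of a a] less_exp[of a] by blast

lemma vsize_Num_mono: "\<bar>a\<bar> \<le> \<bar>b\<bar> \<Longrightarrow> vsize (Num a) \<le> vsize (Num b)"
  by (simp add: floorlog2_mono)

lemma vsize_Num_add: "vsize (Num (a + b)) \<le> vsize (Num a) + vsize (Num b)"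
proof -
  have "nat \<bar>a + b\<bar> \<le> nat \<bar>a\<bar> + nat \<bar>b\<bar>" by linarith
  from floorlog2_mono[OF this] show ?thesis
    using floorlog2_add[of "nat \<bar>a\<bar>" "nat \<bar>b\<bar>"] by simp
qed

lemma vsize_Num_mult: "vsize (Num (a * b)) \<le> vsize (Num a) + vsize (Num b)"
  using floorlog2_mult[of "nat \<bar>a\<bar>" "nat \<bar>b\<bar>"]
  by (simp add: abs_mult nat_mult_distrib)

lemma abs_div_le: "\<bar>a div b\<bar> \<le> \<bar>a :: int\<bar>"
proof (cases "b = 0")
  case False
  have "\<bar>a div b\<bar> \<le> \<bar>a\<bar>" if "b > 0" for a b :: int
  proof (cases "a \<ge> 0")
    case True
    have "a div b \<le> a div 1" by (rule zdiv_mono2) (use True that in auto)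
    then show ?thesis using True that by (simp add: pos_imp_zdiv_nonneg_iff)
  next
    case False
    have "a div b \<ge> a"
    proof -
      have "b * (a div b) + a mod b = a" by simp
      moreover have "a mod b < b" using that by simp
      ultimately have "b * (a div b) > a - b" by linarith
      show ?thesis
      proof (rule ccontr)
        assume "\<not> a div b \<ge> a"
        then have "a div b \<le> a - 1" by simp
        then have "b * (a div b) \<le> b * (a - 1)" using that by simp
        moreover have "b * (a - 1) \<le> a - b"
          using False that mult_right_mono_neg[of 1 b a] by (simp add: algebra_simps)
        ultimately show False using \<open>b * (a div b) > a - b\<close> by linarith
      qed
    qed
    moreover have "a div b < 0" using False that by (simp add: div_neg_pos_less0)
    ultimately show ?thesis using False by linarith
  qed
  from this[of b a] this[of "- b" "- a"] False show ?thesis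
    by (cases "b > 0") auto
qed simp

lemma binop_val_size: "binop_val f v w = Some u \<Longrightarrow> vsize u \<le> vsize v + vsize w + 2"
proof (induction f v w rule: binop_val.induct)
  case (1 a b) then show ?case using vsize_Num_add[of a b] by auto
next
  case (2 a b) then show ?case using vsize_Num_add[of a "- b"] by auto
next
  case (3 a b) then show ?case using vsize_Num_mult[of a b] by auto
next
  case (4 a b) then show ?case using vsize_Num_mono[OF abs_div_le[of a b]] by auto
next
  case (5 a b)
  have "\<bar>a mod b\<bar> \<le> \<bar>if b = 0 then a else b\<bar>"
    using pos_mod_bound[of b a] neg_mod_bound[of b a] pos_mod_sign[of b a] neg_mod_sign[of b a]
    by (cases "b > 0"; cases "b = 0") (auto simp: less_imp_le)
  from vsize_Num_mono[OF this] 5 show ?case by (auto split: if_splits)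
qed (auto simp: floorlog_def)

lemma unop_val_size: "unop_val f v = Some u \<Longrightarrow> vsize u \<le> vsize v + 2"
  by (induction f v rule: unop_val.induct) (auto simp: floorlog_def)

lemma runs_Var: "i < length env \<Longrightarrow> env ! i = v \<Longrightarrow> runs env (Var i) v (1 + vsize v)"
  unfolding runs_def using eval.Var by blast

lemma runs_Empty: "runs env Empty (Lst []) 2"
  unfolding runs_def by (rule exI[of _ "1 + vsize (Lst [])"]) (use eval.Empty in simp)

lemma runs_Const: "runs env (Const k) (Num k) (1 + vsize (Num k))"
  unfolding runs_def using eval.Const by blast

lemma runs_Unary:
  assumes "runs env e v B" "unop_val f v = Some w"
  shows "runs env (Unary f e) w (3 * B + 3)"
proof -
  obtain t where t: "t \<le> B" "eval env e v t" using assms(1) unfolding runs_def by blast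
  have "1 + t + vsize v + vsize w \<le> 3 * B + 3"
    using t(1) eval_size[OF t(2)] unop_val_size[OF assms(2)] by linarith
  with eval.Unary[OF t(2) assms(2)] show ?thesis unfolding runs_def by blast
qed

lemma runs_Binary:
  assumes "runs env e1 v1 B1" "runs env e2 v2 B2" "binop_val f v1 v2 = Some w"
  shows "runs env (Binary f e1 e2) w (3 * (B1 + B2) + 3)"
proof -
  obtain t1 t2 where t: "t1 \<le> B1" "t2 \<le> B2" "eval env e1 v1 t1" "eval env e2 v2 t2"
    using assms(1,2) unfolding runs_def by blast
  have "1 + t1 + t2 + vsize v1 + vsize v2 + vsize w \<le> 3 * (B1 + B2) + 3"
  proof -
    have "vsize v1 \<le> B1" "vsize v2 \<le> B2"
      using t(1,2) eval_size[OF t(3)] eval_size[OF t(4)] by linarith+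
    moreover from this have "vsize w \<le> B1 + B2 + 2" using binop_val_size[OF assms(3)] by linarith
    ultimately show ?thesis using t(1,2) by simp
  qed
  with eval.Binary[OF t(3,4) assms(3)] show ?thesis unfolding runs_def by blast
qed

lemma runs_LetIn:
  assumes "runs env e1 v B1" "runs (v # env) e2 w B2"
  shows "runs env (LetIn e1 e2) w (1 + B1 + B2)"
proof -
  obtain t1 t2 where t: "t1 \<le> B1" "t2 \<le> B2" "eval env e1 v t1" "eval (v # env) e2 w t2"
    using assms unfolding runs_def by blast
  then have "1 + t1 + t2 \<le> 1 + B1 + B2" by linarith
  with eval.LetIn[OF t(3,4)] show ?thesis unfolding runs_def by blast
qed

lemma runs_Cond:
  assumes "runs env c (Num k) B" "k \<noteq> 0 \<Longrightarrow> runs env e1 w B1" "k = 0 \<Longrightarrow> runs env e2 w B2"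
  shows "runs env (Cond c e1 e2) w (1 + B + B1 + B2)"
proof (cases "k = 0")
  case True
  obtain t1 t2 where t: "t1 \<le> B" "t2 \<le> B2" "eval env c (Num 0) t1" "eval env e2 w t2"
    using assms(1) assms(3) True unfolding runs_def by auto
  then have "1 + t1 + t2 \<le> 1 + B + B1 + B2" by linarith
  with eval.CondF[OF t(3,4)] show ?thesis unfolding runs_def by blast
next
  case False
  obtain t1 t2 where t: "t1 \<le> B" "t2 \<le> B1" "eval env c (Num k) t1" "eval env e1 w t2"
    using assms(1) assms(2) False unfolding runs_def by auto
  then have "1 + t1 + t2 \<le> 1 + B + B1 + B2" by linarith
  with eval.CondT[OF t(3) False t(4)] show ?thesis unfolding runs_def by blast
qed

lemma runs_WhileF:
  assumes "runs (v # env) c (Num 0) B"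
  shows "runs (v # env) (While c b) v (1 + B + vsize v)"
proof -
  obtain t where t: "t \<le> B" "eval (v # env) c (Num 0) t" using assms unfolding runs_def by blast
  then have "1 + t + vsize v \<le> 1 + B + vsize v" by linarith
  with eval.WhileF[OF t(2)] show ?thesis unfolding runs_def by blast
qed

lemma runs_WhileT:
  assumes "runs (v # env) c (Num k) B1" "k \<noteq> 0" "runs (v # env) b v' B2"
    "runs (v' # env) (While c b) w B3"
  shows "runs (v # env) (While c b) w (1 + B1 + B2 + B3)"
proof -
  obtain t1 t2 t3 where t: "t1 \<le> B1" "t2 \<le> B2" "t3 \<le> B3" "eval (v # env) c (Num k) t1"
    "eval (v # env) b v' t2" "eval (v' # env) (While c b) w t3"
    using assms unfolding runs_def by blast
  then have "1 + t1 + t2 + t3 \<le> 1 + B1 + B2 + B3" by linarith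
  with eval.WhileT[OF t(4) assms(2) t(5,6)] show ?thesis unfolding runs_def by blast
qed

lemma poly_nat_mono: "a \<le> b \<Longrightarrow> poly (p :: nat poly) a \<le> poly p b"
  by (induction p) (auto intro: add_mono mult_mono)

section \<open>Polynomial-time functions\<close>

definition poly_bounded :: "('a::encodable \<Rightarrow> nat) \<Rightarrow> bool" where
  "poly_bounded g \<longleftrightarrow> (\<exists>p. \<forall>x. g x \<le> poly p (sz x))"

lemma pb_const: "poly_bounded (\<lambda>x. c)"
  unfolding poly_bounded_def by (rule exI[of _ "[:c:]"]) simp

lemma pb_sz: "poly_bounded (\<lambda>x. sz x)"
  unfolding poly_bounded_def by (rule exI[of _ "[:0, 1:]"]) simp

lemma pb_add: "poly_bounded f \<Longrightarrow> poly_bounded g \<Longrightarrow> poly_bounded (\<lambda>x. f x + g x)"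
  unfolding poly_bounded_def
proof (elim exE)
  fix p q assume "\<forall>x. f x \<le> poly p (sz x)" "\<forall>x. g x \<le> poly q (sz x)"
  then show "\<exists>p. \<forall>x. f x + g x \<le> poly p (sz x)"
    by (intro exI[of _ "p + q"]) (simp add: add_mono)
qed

lemma pb_mult: "poly_bounded f \<Longrightarrow> poly_bounded g \<Longrightarrow> poly_bounded (\<lambda>x. f x * g x)"
  unfolding poly_bounded_def
proof (elim exE)
  fix p q assume "\<forall>x. f x \<le> poly p (sz x)" "\<forall>x. g x \<le> poly q (sz x)"
  then show "\<exists>p. \<forall>x. f x * g x \<le> poly p (sz x)"
    by (intro exI[of _ "p * q"]) (simp add: mult_mono)
qed

lemma pb_Suc: "poly_bounded f \<Longrightarrow> poly_bounded (\<lambda>x. Suc (f x))"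
  using pb_add[OF pb_const[of 1]] by simp

lemma pb_poly: "poly_bounded f \<Longrightarrow> poly_bounded (\<lambda>x. poly p (f x))"
  unfolding poly_bounded_def
proof (elim exE)
  fix q assume "\<forall>x. f x \<le> poly q (sz x)"
  then show "\<exists>q. \<forall>x. poly p (f x) \<le> poly q (sz x)"
    by (intro exI[of _ "pcompose p q"]) (simp add: poly_pcompose poly_nat_mono)
qed

lemmas pb_intros = pb_const pb_sz pb_add pb_mult pb_Suc pb_poly

text \<open>The program may be run in any environment that has its argument as variable \<open>0\<close>. It never looks at the rest, so it
can be used unchanged under further bindings. The lemmas named \<open>pt_\<dots>\<close> are in
pointwise form and are applied backwards to the body of a function.\<close>

definition polytime :: "('a::encodable \<Rightarrow> 'b::encodable) \<Rightarrow> bool" where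
  "polytime f \<longleftrightarrow> (\<exists>e p. \<forall>x env. runs (enc x # env) e (enc (f x)) (poly p (sz x)))"

lemma polytimeI:
  assumes "\<And>x env. runs (enc x # env) e (enc (f x)) (B x)" "poly_bounded B"
  shows "polytime f"
proof -
  obtain p where "\<And>x. B x \<le> poly p (sz x)" using assms(2) unfolding poly_bounded_def by blast
  then have "runs (enc x # env) e (enc (f x)) (poly p (sz x))" for x env
    using runs_mono[OF assms(1)] by blast
  then show ?thesis unfolding polytime_def by blast
qed

lemma polytimeE:
  assumes "polytime f"
  obtains e p where "\<And>x env. runs (enc x # env) e (enc (f x)) (poly p (sz x))"
  using assms unfolding polytime_def by blast

lemma pb_polytime: assumes "polytime f" shows "poly_bounded (\<lambda>x. sz (f x))"
proof -
  obtain e p where "\<And>x env. runs (enc x # env) e (enc (f x)) (poly p (sz x))"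
    using polytimeE[OF assms] by blast
  from runs_size[OF this] show ?thesis unfolding poly_bounded_def by blast
qed

lemma polytime_same_enc:
  assumes "polytime f" "\<And>x. enc (g x) = enc (f x)"
  shows "polytime g"
  using assms unfolding polytime_def by simp

lemma pt_id: "polytime (\<lambda>x. x)"
proof (rule polytimeI)
  show "runs (enc x # env) (Var 0) (enc x) (1 + sz x)" for x :: 'a and env
    by (rule runs_Var) simp_all
qed (intro pb_intros)

lemma polytime_comp:
  assumes "polytime f" "polytime g"
  shows "polytime (\<lambda>x. f (g x))"
proof -
  obtain e p where e: "\<And>x env. runs (enc x # env) e (enc (f x)) (poly p (sz x))"
    using polytimeE[OF assms(1)] by blast
  obtain d q where d: "\<And>x env. runs (enc x # env) d (enc (g x)) (poly q (sz x))"
    using polytimeE[OF assms(2)] by blast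
  show ?thesis
    by (rule polytimeI[OF runs_LetIn[OF d e]]) (intro pb_intros pb_polytime assms)
qed

text \<open>Constants of any type are available because programs can spell out any value.\<close>

lemma expressible_val: "\<exists>e B. \<forall>env. runs env e v B"
proof (induction v)
  case (Num k)
  show ?case using runs_Const by blast
next
  case (Lst vs)
  then show ?case
  proof (induction vs)
    case Nil
    show ?case using runs_Empty by blast
  next
    case (Cons v vs)
    have "\<exists>e B. \<forall>env. runs env e v B" by (rule Cons.prems) simp
    then obtain e1 B1 where 1: "runs env e1 v B1" for env by blast
    have "\<exists>e B. \<forall>env. runs env e (Lst vs) B" by (rule Cons.IH) (rule Cons.prems, simp)
    then obtain e2 B2 where 2: "runs env e2 (Lst vs) B2" for env by blast
    have "runs env (Binary ConsOp e1 e2) (Lst (v # vs)) (3 * (B1 + B2) + 3)" for env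
      by (rule runs_Binary[OF 1 2]) simp
    then show ?case by blast
  qed
qed

lemma pt_const: "polytime (\<lambda>x. c)"
proof -
  obtain e B where "runs env e (enc c) B" for env using expressible_val by blast
  then show ?thesis by (rule polytimeI) (rule pb_const)
qed

lemma polytime_unop:
  assumes "polytime f" "\<And>x. unop_val u (enc (f x)) = Some (enc (h x))"
  shows "polytime h"
proof -
  obtain e p where e: "\<And>x env. runs (enc x # env) e (enc (f x)) (poly p (sz x))"
    using polytimeE[OF assms(1)] by blast
  show ?thesis
    by (rule polytimeI[OF runs_Unary[OF e assms(2)]]) (intro pb_intros)
qed

lemma polytime_binop:
  assumes "polytime f" "polytime g" "\<And>x. binop_val u (enc (f x)) (enc (g x)) = Some (enc (h x))"
  shows "polytime h"
proof -
  obtain e p where e: "\<And>x env. runs (enc x # env) e (enc (f x)) (poly p (sz x))"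
    using polytimeE[OF assms(1)] by blast
  obtain d q where d: "\<And>x env. runs (enc x # env) d (enc (g x)) (poly q (sz x))"
    using polytimeE[OF assms(2)] by blast
  show ?thesis
    by (rule polytimeI[OF runs_Binary[OF e d assms(3)]]) (intro pb_intros)
qed

lemma pt_if:
  assumes "polytime b" "polytime f" "polytime g"
  shows "polytime (\<lambda>x. if b x then f x else g x)"
proof -
  obtain c r where c: "\<And>x env. runs (enc x # env) c (enc (b x)) (poly r (sz x))"
    using polytimeE[OF assms(1)] by blast
  obtain e p where e: "\<And>x env. runs (enc x # env) e (enc (f x)) (poly p (sz x))"
    using polytimeE[OF assms(2)] by blast
  obtain d q where d: "\<And>x env. runs (enc x # env) d (enc (g x)) (poly q (sz x))"
    using polytimeE[OF assms(3)] by blast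
  have "runs (enc x # env) (Cond c e d) (enc (if b x then f x else g x))
     (1 + poly r (sz x) + poly p (sz x) + poly q (sz x))" for x env
    by (rule runs_Cond[OF c[unfolded enc_bool_def]]) (auto intro: d e)
  then show ?thesis
    by (rule polytimeI) (intro pb_intros)
qed

lemma pt_fst: "polytime f \<Longrightarrow> polytime (\<lambda>x. fst (f x))"
  by (rule polytime_unop[of f HdOp]) (auto simp: enc_defs)

lemma pt_snd: assumes "polytime f" shows "polytime (\<lambda>x. snd (f x))"
proof -
  have 1: "polytime (\<lambda>x. [snd (f x)])"
    by (rule polytime_unop[OF assms, of TlOp]) (auto simp: enc_defs)
  show ?thesis
    by (rule polytime_unop[OF 1, of HdOp]) (auto simp: enc_defs)
qed

lemma pt_Cons: "polytime f \<Longrightarrow> polytime g \<Longrightarrow> polytime (\<lambda>x. f x # g x)"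
  by (rule polytime_binop[of f g ConsOp]) (auto simp: enc_defs)

lemma pt_Pair: assumes "polytime f" "polytime g" shows "polytime (\<lambda>x. (f x, g x))"
proof -
  have 1: "polytime (\<lambda>x. [g x])" by (intro pt_Cons assms pt_const)
  show ?thesis
    by (rule polytime_binop[OF assms(1) 1, of ConsOp]) (auto simp: enc_defs)
qed

lemma polytime_comp2:
  assumes "polytime (\<lambda>z. f (fst z) (snd z))" "polytime g" "polytime h"
  shows "polytime (\<lambda>x. f (g x) (h x))"
  using polytime_comp[OF assms(1) pt_Pair[OF assms(2,3)]] by simp

lemma pt_int_ops:
  fixes f g :: "'a::encodable \<Rightarrow> int"
  assumes "polytime f" "polytime g"
  shows "polytime (\<lambda>x. f x + g x)" "polytime (\<lambda>x. f x - g x)" "polytime (\<lambda>x. f x * g x)"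
    "polytime (\<lambda>x. f x div g x)" "polytime (\<lambda>x. f x < g x)" "polytime (\<lambda>x. f x = g x)"
  by (rule polytime_binop[OF assms, of AddOp] polytime_binop[OF assms, of SubOp]
      polytime_binop[OF assms, of MulOp] polytime_binop[OF assms, of DivOp]
      polytime_binop[OF assms, of LessOp] polytime_binop[OF assms, of EqOp]; auto simp: enc_defs)+

lemma pt_uminus: "polytime f \<Longrightarrow> polytime (\<lambda>x. - f x :: int)"
  using pt_int_ops(2)[OF pt_const[of 0]] by simp

lemma pt_not: assumes "polytime b" shows "polytime (\<lambda>x. \<not> b x)"
proof -
  have "polytime (\<lambda>x. if b x then False else True)" by (intro pt_if pt_const assms)
  moreover have "(\<lambda>x. if b x then False else True) = (\<lambda>x. \<not> b x)" by auto
  ultimately show ?thesis by simp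
qed

lemma pt_conj: assumes "polytime b" "polytime c" shows "polytime (\<lambda>x. b x \<and> c x)"
proof -
  have "polytime (\<lambda>x. if b x then c x else False)" by (intro pt_if pt_const assms)
  moreover have "(\<lambda>x. if b x then c x else False) = (\<lambda>x. b x \<and> c x)" by auto
  ultimately show ?thesis by simp
qed

lemma pt_int_le:
  fixes f g :: "'a::encodable \<Rightarrow> int"
  assumes "polytime f" "polytime g"
  shows "polytime (\<lambda>x. f x \<le> g x)"
  using pt_not[OF pt_int_ops(5)[OF assms(2,1)]] by (simp add: not_less)

section \<open>Loops and lists\<close>

lemma pt_null: "polytime f \<Longrightarrow> polytime (\<lambda>x. f x = [])"
  by (rule polytime_unop[of f NullOp]) (auto simp: enc_defs)

lemma pt_tl: assumes "polytime f" shows "polytime (\<lambda>x. tl (f x))"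
proof -
  obtain c r where c: "\<And>x env. runs (enc x # env) c (enc (f x = [])) (poly r (sz x))"
    using polytimeE[OF pt_null[OF assms]] by blast
  obtain e p where e: "\<And>x env. runs (enc x # env) e (enc (f x)) (poly p (sz x))"
    using polytimeE[OF assms] by blast
  have "runs (enc x # env) (Cond c Empty (Unary TlOp e)) (enc (tl (f x)))
     (1 + poly r (sz x) + 2 + (3 * poly p (sz x) + 3))" for x env
  proof (rule runs_Cond[OF c[unfolded enc_bool_def]])
    assume "of_bool (f x = []) \<noteq> (0 :: int)"
    then show "runs (enc x # env) Empty (enc (tl (f x))) 2"
      using runs_Empty by (simp add: enc_defs)
  next
    assume "of_bool (f x = []) = (0 :: int)"
    then show "runs (enc x # env) (Unary TlOp e) (enc (tl (f x))) (3 * poly p (sz x) + 3)"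
      by (intro runs_Unary[OF e]) (cases "f x"; simp add: enc_defs)
  qed
  then show ?thesis
    by (rule polytimeI) (intro pb_intros)
qed

lemma pt_hd_default:
  assumes "polytime f" "polytime d"
  shows "polytime (\<lambda>x. if f x = [] then d x else hd (f x))"
proof -
  obtain c r where c: "\<And>x env. runs (enc x # env) c (enc (f x = [])) (poly r (sz x))"
    using polytimeE[OF pt_null[OF assms(1)]] by blast
  obtain e p where e: "\<And>x env. runs (enc x # env) e (enc (f x)) (poly p (sz x))"
    using polytimeE[OF assms(1)] by blast
  obtain g q where g: "\<And>x env. runs (enc x # env) g (enc (d x)) (poly q (sz x))"
    using polytimeE[OF assms(2)] by blast
  have "runs (enc x # env) (Cond c g (Unary HdOp e)) (enc (if f x = [] then d x else hd (f x)))
     (1 + poly r (sz x) + poly q (sz x) + (3 * poly p (sz x) + 3))" for x env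
  proof (rule runs_Cond[OF c[unfolded enc_bool_def]])
    assume "of_bool (f x = []) \<noteq> (0 :: int)"
    then show "runs (enc x # env) g (enc (if f x = [] then d x else hd (f x))) (poly q (sz x))"
      using g by simp
  next
    assume "of_bool (f x = []) = (0 :: int)"
    then show "runs (enc x # env) (Unary HdOp e) (enc (if f x = [] then d x else hd (f x)))
        (3 * poly p (sz x) + 3)"
      by (intro runs_Unary[OF e]) (cases "f x"; simp add: enc_defs)
  qed
  then show ?thesis
    by (rule polytimeI) (intro pb_intros)
qed

lemma runs_proj:
  assumes "runs env e (Lst [a, Lst [b, c]]) B"
  shows "runs env (Unary HdOp e) a (3 * B + 3)"
    "runs env (Unary HdOp (Unary HdOp (Unary TlOp e))) b (27 * B + 39)"
    "runs env (Unary HdOp (Unary TlOp (Unary HdOp (Unary TlOp e)))) c (81 * B + 120)"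
proof -
  have 1: "runs env (Unary TlOp e) (Lst [Lst [b, c]]) (3 * B + 3)"
    by (rule runs_Unary[OF assms]) simp
  have 2: "runs env (Unary HdOp (Unary TlOp e)) (Lst [b, c]) (9 * B + 12)"
    using runs_Unary[OF 1, of HdOp] by (simp add: algebra_simps)
  have 3: "runs env (Unary TlOp (Unary HdOp (Unary TlOp e))) (Lst [c]) (27 * B + 39)"
    using runs_Unary[OF 2, of TlOp] by (simp add: algebra_simps)
  show "runs env (Unary HdOp e) a (3 * B + 3)"
    by (rule runs_Unary[OF assms]) simp
  show "runs env (Unary HdOp (Unary HdOp (Unary TlOp e))) b (27 * B + 39)"
    using runs_Unary[OF 2, of HdOp] by (simp add: algebra_simps)
  show "runs env (Unary HdOp (Unary TlOp (Unary HdOp (Unary TlOp e)))) c (81 * B + 120)"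
    using runs_Unary[OF 3, of HdOp] by (simp add: algebra_simps)
qed

lemma runs_triple:
  assumes "runs env e1 a B" "runs env e2 b C" "runs env e3 c D"
  shows "runs env (Binary ConsOp e1 (Binary ConsOp (Binary ConsOp e2 (Binary ConsOp e3 Empty)) Empty))
    (Lst [a, Lst [b, c]]) (3 * B + 27 * C + 81 * D + 300)"
  by (rule runs_mono[OF runs_Binary[OF assms(1) runs_Binary[OF runs_Binary[OF assms(2)
            runs_Binary[OF assms(3) runs_Empty]] runs_Empty]]]) auto

lemma sz_pos: "sz x \<ge> 1"
  by (cases "enc x") auto

lemma sz_Nil: "sz [] = 1" and sz_Cons: "sz (x # xs) = sz x + sz xs"
  by (auto simp: enc_list_def)

lemma length_le_sz: "length xs \<le> sz xs"
proof (induction xs)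
  case (Cons x xs)
  then show ?case using sz_pos[of x] by (simp add: sz_Cons)
qed simp

text \<open>A fold is a loop whose variable holds the triple of the parameter \<open>x\<close>, the accumulator and the rest
of the list. If \<open>S\<close> bounds the size of all accumulators, then each iteration costs at most a
polynomial \<open>M\<close> in the sizes of \<open>x\<close> and the list and in \<open>S\<close>.\<close>

lemma runs_fold:
  fixes h :: "'x::encodable \<Rightarrow> 's::encodable \<Rightarrow> 'y::encodable \<Rightarrow> 's"
  assumes h: "\<And>x s y env. runs (enc (x, s, y) # env) d (enc (h x s y)) (poly q (sz (x, s, y)))"
  shows "\<exists>e r. \<forall>x s ys env S. (\<forall>j. sz (foldl (h x) s (take j ys)) \<le> S) \<longrightarrow>
    runs (enc (x, s, ys) # env) e (enc (foldl (h x) s ys)) (poly r (sz x + sz ys + S))"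
proof -
  \<comment> \<open>The loop condition, the construction of the next triple, and the loop body.\<close>
  define st where "st = Binary SubOp (Const 1)
     (Unary NullOp (Unary HdOp (Unary TlOp (Unary HdOp (Unary TlOp (Var 0))))))"
  let ?rest = "Unary HdOp (Unary TlOp (Unary HdOp (Unary TlOp (Var 0))))"
  let ?s = "Unary HdOp (Unary HdOp (Unary TlOp (Var 0)))"
  let ?x = "Unary HdOp (Var 0)"
  let ?tr = "\<lambda>e1 e2 e3. Binary ConsOp e1 (Binary ConsOp (Binary ConsOp e2 (Binary ConsOp e3 Empty)) Empty)"
  define pass where "pass = ?tr (Unary HdOp (Var 1)) (Var 0)
     (Unary TlOp (Unary HdOp (Unary TlOp (Unary HdOp (Unary TlOp (Var 1))))))"
  define bd where "bd = LetIn (LetIn (?tr ?x ?s (Unary HdOp ?rest)) d) pass"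
  \<comment> \<open>Bounds for the size of the triple, for the condition, for the body and for a whole iteration.\<close>
  define V where "V = (\<lambda>a::nat. a + 5)"
  define Cc where "Cc = (\<lambda>a::nat. 3 * (3 + (3 * (81 * (1 + V a) + 120) + 3)) + 3)"
  define Bb where "Bb = (\<lambda>a::nat. 1 + (1 + (3 * (3 * (1 + V a) + 3) + 27 * (27 * (1 + V a) + 39) + 81 * (3 * (81 * (1 + V a) + 120) + 3) + 300) + poly q (V a))
     + (3 * (3 * (1 + V a) + 3) + 27 * (1 + V a) + 81 * (3 * (81 * (1 + V a) + 120) + 3) + 300))"
  define M where "M = (\<lambda>a::nat. 1 + Cc a + Bb a + V a)"
  have Vsz: "sz (x, s, ys) \<le> V a" if "sz x + sz ys + sz s \<le> a" for x and s :: 's and ys :: "'y list" and a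
    using that by (simp add: enc_prod_def V_def)
  have cond: "runs (enc (x, s, ys) # env) st (Num (if ys = [] then 0 else 1)) (Cc a)"
    if "sz x + sz ys + sz s \<le> a" for x and s :: 's and ys :: "'y list" and env a
  proof -
    have v: "runs (enc (x, s, ys) # env) (Var 0) (Lst [enc x, Lst [enc s, enc ys]]) (1 + V a)"
      by (rule runs_mono[OF runs_Var]) (use Vsz[OF that] in \<open>auto simp: enc_prod_def\<close>)
    note 1 = runs_Unary[OF runs_proj(3)[OF v], of NullOp "Num (if ys = [] then 1 else 0)"]
    show ?thesis unfolding st_def Cc_def
      by (rule runs_mono[OF runs_Binary[OF runs_Const 1]]) (auto simp: enc_list_def floorlog_def)
  qed
  have body: "runs (enc (x, s, y # ys) # env) bd (enc (x, h x s y, ys)) (Bb a)"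
    if "sz x + sz (y # ys) + sz s \<le> a" "sz x + sz ys + sz (h x s y) \<le> a"
    for x and s :: 's and y and ys :: "'y list" and env a
  proof -
    have v: "runs (enc (x, s, y # ys) # env) (Var 0) (Lst [enc x, Lst [enc s, enc (y # ys)]]) (1 + V a)"
      by (rule runs_mono[OF runs_Var]) (use Vsz[OF that(1)] in \<open>auto simp: enc_prod_def\<close>)
    have v1: "runs (enc (h x s y) # enc (x, s, y # ys) # env) (Var 1) (Lst [enc x, Lst [enc s, enc (y # ys)]]) (1 + V a)"
      by (rule runs_mono[OF runs_Var]) (use Vsz[OF that(1)] in \<open>auto simp: enc_prod_def\<close>)
    have v0: "runs (enc (h x s y) # enc (x, s, y # ys) # env) (Var 0) (enc (h x s y)) (1 + V a)"
      by (rule runs_mono[OF runs_Var]) (use that(2) in \<open>auto simp: V_def\<close>)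
    have y: "runs (enc (x, s, y # ys) # env) (Unary HdOp ?rest) (enc y) (3 * (81 * (1 + V a) + 120) + 3)"
      by (rule runs_Unary[OF runs_proj(3)[OF v]]) (simp add: enc_list_def)
    have "runs (enc (x, s, y # ys) # env) (?tr ?x ?s (Unary HdOp ?rest)) (enc (x, s, y))
      (3 * (3 * (1 + V a) + 3) + 27 * (27 * (1 + V a) + 39) + 81 * (3 * (81 * (1 + V a) + 120) + 3) + 300)"
      using runs_triple[OF runs_proj(1)[OF v] runs_proj(2)[OF v] y] by (simp add: enc_prod_def)
    note 1 = runs_LetIn[OF this h]
    have "sz (x, s, y) \<le> V a"
      using that(1) by (simp add: enc_prod_def enc_list_def V_def)
    then have "poly q (sz (x, s, y)) \<le> poly q (V a)" by (rule poly_nat_mono)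
    then have 2: "runs (enc (x, s, y # ys) # env) (LetIn (?tr ?x ?s (Unary HdOp ?rest)) d) (enc (h x s y))
      (1 + (3 * (3 * (1 + V a) + 3) + 27 * (27 * (1 + V a) + 39) + 81 * (3 * (81 * (1 + V a) + 120) + 3) + 300) + poly q (V a))"
      by (intro runs_mono[OF 1]) simp
    have t: "runs (enc (h x s y) # enc (x, s, y # ys) # env)
      (Unary TlOp (Unary HdOp (Unary TlOp (Unary HdOp (Unary TlOp (Var 1)))))) (enc ys) (3 * (81 * (1 + V a) + 120) + 3)"
      by (rule runs_Unary[OF runs_proj(3)[OF v1]]) (simp add: enc_list_def)
    have 3: "runs (enc (h x s y) # enc (x, s, y # ys) # env) pass (enc (x, h x s y, ys))
      (3 * (3 * (1 + V a) + 3) + 27 * (1 + V a) + 81 * (3 * (81 * (1 + V a) + 120) + 3) + 300)"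
      unfolding pass_def using runs_triple[OF runs_proj(1)[OF v1] v0 t] by (simp add: enc_prod_def)
    show ?thesis
      unfolding bd_def Bb_def using runs_LetIn[OF 2 3] .
  qed
  have loop: "runs (enc (x, s, ys) # env) (While st bd) (enc (x, foldl (h x) s ys, [] :: 'y list))
      ((length ys + 1) * M (sz x + T + S))"
    if "\<forall>j. sz (foldl (h x) s (take j ys)) \<le> S" "sz ys \<le> T" for x s ys env S T
    using that
  proof (induction ys arbitrary: s)
    case Nil
    let ?a = "sz x + T + S"
    from Nil have s: "sz s \<le> S" by simp
    have a: "sz x + sz ([] :: 'y list) + sz s \<le> ?a" using Nil.prems(2) s by simp
    have "1 + Cc ?a + sz (x, s, [] :: 'y list) \<le> M ?a" using Vsz[OF a] by (simp add: M_def)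
    moreover have "runs (enc (x, s, [] :: 'y list) # env) st (Num 0) (Cc ?a)" using cond[OF a] by simp
    ultimately show ?case by (auto intro: runs_mono[OF runs_WhileF])
  next
    case (Cons y ys)
    let ?a = "sz x + T + S"
    have s: "sz s \<le> S" using Cons.prems(1)[rule_format, of 0] by simp
    have s': "sz (h x s y) \<le> S" using Cons.prems(1)[rule_format, of 1] by simp
    have T: "sz ys \<le> T" using Cons.prems(2) by (simp add: enc_list_def)
    have st: "\<forall>j. sz (foldl (h x) (h x s y) (take j ys)) \<le> S"
      using Cons.prems(1)[rule_format, of "Suc j" for j] by simp
    have a: "sz x + sz (y # ys) + sz s \<le> ?a" "sz x + sz ys + sz (h x s y) \<le> ?a"
      using s s' T Cons.prems(2) by simp_all
    have c: "runs (enc (x, s, y # ys) # env) st (Num 1) (Cc ?a)" using cond[OF a(1)] by simp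
    have "runs (enc (x, s, y # ys) # env) (While st bd) (enc (x, foldl (h x) (h x s y) ys, [] :: 'y list))
        (1 + Cc ?a + Bb ?a + (length ys + 1) * M ?a)"
      by (rule runs_WhileT[OF c _ body[OF a] Cons.IH[OF st T]]) simp
    then show ?case by (auto intro: runs_mono simp: M_def)
  qed
  define VP :: "nat poly" where "VP = [:5, 1:]"
  have VP: "V a = poly VP a" for a by (simp add: V_def VP_def)
  define MP where "MP = 1 + [:3:] * ([:3:] + ([:3:] * ([:81:] * (1 + VP) + [:120:]) + [:3:])) + [:3:]
     + (1 + (1 + ([:3:] * ([:3:] * (1 + VP) + [:3:]) + [:27:] * ([:27:] * (1 + VP) + [:39:]) + [:81:] * ([:3:] * ([:81:] * (1 + VP) + [:120:]) + [:3:]) + [:300:]) + pcompose q VP)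
     + ([:3:] * ([:3:] * (1 + VP) + [:3:]) + [:27:] * (1 + VP) + [:81:] * ([:3:] * ([:81:] * (1 + VP) + [:120:]) + [:3:]) + [:300:])) + VP"
  have MP: "M a = poly MP a" for a
    unfolding M_def Cc_def Bb_def MP_def VP by (simp add: poly_pcompose)
  define R where "R = [:39:] + [:27:] * ([:1, 1:] * MP)"
  show ?thesis
  proof (intro exI[of _ "Unary HdOp (Unary HdOp (Unary TlOp (While st bd)))"] exI[of _ R] allI impI)
    fix x s and ys :: "'y list" and env S
    assume S: "\<forall>j. sz (foldl (h x) s (take j ys)) \<le> S"
    let ?a = "sz x + sz ys + S"
    have "(length ys + 1) * M ?a \<le> (?a + 1) * M ?a"
      using length_le_sz[of ys] by (intro mult_right_mono) auto
    then have "27 * ((length ys + 1) * M ?a) + 39 \<le> poly R ?a"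
      by (simp add: R_def MP)
    with runs_proj(2)[OF loop[OF S order.refl, unfolded enc_prod_def[of "(_, _)"] fst_conv snd_conv]]
    show "runs (enc (x, s, ys) # env) (Unary HdOp (Unary HdOp (Unary TlOp (While st bd))))
         (enc (foldl (h x) s ys)) (poly R (sz x + sz ys + S))"
      by (auto intro: runs_mono simp: enc_prod_def)
  qed
qed

text \<open>The bound on the partial results cannot be dropped: iterated squaring is a fold of a polynomial-time
function with results of exponential size.\<close>

lemma pt_foldl:
  assumes h: "polytime (\<lambda>z. h (fst z) (fst (snd z)) (snd (snd z)))"
    and "polytime i" "polytime l"
    and bound: "\<And>x j. sz (foldl (h x) (i x) (take j (l x))) \<le> B x" and pb: "poly_bounded B"
  shows "polytime (\<lambda>x. foldl (h x) (i x) (l x))"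
proof -
  obtain d q where "\<And>x env. runs (enc x # env) d (enc (h (fst x) (fst (snd x)) (snd (snd x)))) (poly q (sz x))"
    using polytimeE[OF h] by blast
  then have d: "runs (enc (x, s, y) # env) d (enc (h x s y)) (poly q (sz (x, s, y)))" for x s y env
    by fastforce
  obtain e r where e: "\<And>x s ys env S. (\<forall>j. sz (foldl (h x) s (take j ys)) \<le> S) \<Longrightarrow>
    runs (enc (x, s, ys) # env) e (enc (foldl (h x) s ys)) (poly r (sz x + sz ys + S))"
    using runs_fold[OF d] by blast
  have "polytime (\<lambda>x. (x, i x, l x))" by (intro pt_Pair pt_id assms)
  then obtain c p where c: "\<And>x env. runs (enc x # env) c (enc (x, i x, l x)) (poly p (sz x))"
    using polytimeE by blast
  have "runs (enc x # env) (LetIn c e) (enc (foldl (h x) (i x) (l x)))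
    (1 + poly p (sz x) + poly r (sz x + sz (l x) + B x))" for x env
    by (rule runs_LetIn[OF c e]) (use bound in auto)
  then show ?thesis
    by (rule polytimeI) (intro pb_intros pb_polytime assms)
qed

lemma sz_append: "sz (xs @ ys) + 1 = sz xs + sz ys"
  by (induction xs) (auto simp: sz_Nil sz_Cons)

lemma sz_rev: "sz (rev xs) = sz xs"
  by (simp add: enc_list_def flip: rev_map)

lemma sz_take: "sz (take j xs) \<le> sz xs"
  using sz_append[of "take j xs" "drop j xs"] sz_pos[of "drop j xs"] by simp

lemma sz_elem: "x \<in> set xs \<Longrightarrow> sz x \<le> sz xs"
  by (induction xs) (auto simp: sz_Cons)

lemma sz_list_le: "(\<And>y. y \<in> set ys \<Longrightarrow> sz y \<le> C) \<Longrightarrow> sz ys \<le> 1 + length ys * C"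
proof (induction ys)
  case (Cons y ys)
  have "sz y \<le> C" "sz ys \<le> 1 + length ys * C" using Cons by simp_all
  then show ?case by (simp add: sz_Cons)
qed (simp add: sz_Nil)
lemma pt_rev: assumes "polytime f" shows "polytime (\<lambda>x. rev (f x))"
proof -
  have *: "foldl (\<lambda>s y. y # s) s ys = rev ys @ s" for s and ys :: "'b list"
    by (induction ys arbitrary: s) auto
  have "polytime (\<lambda>x. foldl (\<lambda>s y. y # s) [] (f x))"
    by (rule pt_foldl[where B = "\<lambda>x. sz (f x)"])
      (auto simp: * sz_rev sz_take intro!: pt_Cons pt_fst pt_snd pt_id pt_const assms pb_polytime)
  then show ?thesis by (simp add: *)
qed

lemma pt_append: assumes "polytime f" "polytime g" shows "polytime (\<lambda>x. f x @ g x)"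
proof -
  have *: "foldl (\<lambda>s y. y # s) s ys = rev ys @ s" for s and ys :: "'b list"
    by (induction ys arbitrary: s) auto
  have "sz (rev (take j (rev xs)) @ ys) \<le> sz xs + sz ys" for j and xs ys :: "'b list"
    using sz_append[of "rev (take j (rev xs))" ys] sz_take[of j "rev xs"] by (simp add: sz_rev)
  then have "polytime (\<lambda>x. foldl (\<lambda>s y. y # s) (g x) (rev (f x)))"
    by (intro pt_foldl[where B = "\<lambda>x. sz (f x) + sz (g x)"])
      (auto simp: * intro!: pt_Cons pt_fst pt_snd pt_id pt_const pt_rev assms pb_polytime pb_add)
  then show ?thesis by (simp add: *)
qed

lemma pt_map:
  assumes h: "polytime (\<lambda>z. h (fst z) (snd z))" and l: "polytime l"
  shows "polytime (\<lambda>x. map (h x) (l x))"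
proof -
  obtain p where p: "\<And>z. sz (h (fst z) (snd z)) \<le> poly p (sz z)"
    using pb_polytime[OF h] unfolding poly_bounded_def by blast
  have p': "sz (h x y) \<le> poly p (sz x + sz ys + 1)" if "y \<in> set ys" for x y ys
  proof -
    have "sz (x, y) \<le> sz x + sz ys + 1" using sz_elem[OF that] by (simp add: enc_prod_def)
    from poly_nat_mono[OF this] show ?thesis using p[of "(x, y)"] by (simp add: le_trans)
  qed
  have *: "foldl (\<lambda>s y. g y # s) s ys = rev (map g ys) @ s" for s ys and g :: "'b \<Rightarrow> 'c"
    by (induction ys arbitrary: s) auto
  have "polytime (\<lambda>x. foldl (\<lambda>s y. h x y # s) [] (l x))"
  proof (rule pt_foldl[where B = "\<lambda>x. 1 + sz (l x) * poly p (sz x + sz (l x) + 1)"])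
    show "polytime (\<lambda>z. h (fst z) (snd (snd z)) # fst (snd z))"
      by (intro pt_Cons polytime_comp2[OF h] pt_fst pt_snd pt_id)
    fix x j
    have "sz (map (h x) (take j (l x))) \<le> 1 + length (map (h x) (take j (l x))) * poly p (sz x + sz (l x) + 1)"
      by (rule sz_list_le) (use p' in \<open>auto dest: in_set_takeD\<close>)
    also have "\<dots> \<le> 1 + sz (l x) * poly p (sz x + sz (l x) + 1)"
      using length_le_sz[of "l x"] by (intro add_left_mono mult_right_mono) auto
    finally show "sz (foldl (\<lambda>s y. h x y # s) [] (take j (l x))) \<le> \<dots>"
      by (simp add: * sz_rev)
  qed (intro pb_intros pt_const l pb_polytime)+
  from pt_rev[OF this] show ?thesis by (simp add: *)
qed

text \<open>The size of a sum or product is at most the sum of the sizes, so these folds are always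
polynomial.\<close>

lemma pt_sum_list:
  assumes "polytime l" shows "polytime (\<lambda>x. sum_list (l x) :: int)"
proof -
  have *: "sz (sum_list xs) \<le> sz xs" for xs :: "int list"
  proof (induction xs)
    case (Cons a xs)
    then show ?case using vsize_Num_add[of a "sum_list xs"]
      by (simp add: enc_int_def sz_Cons del: vsize.simps)
  qed (simp add: enc_defs floorlog_def)
  have eq: "foldl (+) s xs = s + sum_list xs" for s and xs :: "int list"
    by (induction xs arbitrary: s) auto
  have "polytime (\<lambda>x. foldl (\<lambda>s y. s + y) 0 (l x))"
    by (rule pt_foldl[where B = "\<lambda>x. sz (l x)"])
      (auto simp: eq intro!: pt_int_ops pt_fst pt_snd pt_id pt_const assms pb_polytime
        intro: order.trans[OF * sz_take])
  then show ?thesis by (simp add: eq)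
qed

lemma pt_prod_list:
  assumes "polytime l" shows "polytime (\<lambda>x. prod_list (l x) :: int)"
proof -
  have *: "sz (prod_list xs) \<le> sz xs + 1" for xs :: "int list"
  proof (induction xs)
    case (Cons a xs)
    then show ?case using vsize_Num_mult[of a "prod_list xs"]
      by (simp add: enc_int_def sz_Cons del: vsize.simps)
  qed (simp add: enc_defs floorlog_def)
  have eq: "foldl (*) s xs = s * prod_list xs" for s and xs :: "int list"
    by (induction xs arbitrary: s) (auto simp: mult.assoc)
  have "polytime (\<lambda>x. foldl (\<lambda>s y. s * y) 1 (l x))"
  proof (rule pt_foldl[where B = "\<lambda>x. sz (l x) + 1"])
    show "sz (foldl (\<lambda>s y. s * y) 1 (take j (l x))) \<le> sz (l x) + 1" for x j
      using *[of "take j (l x)"] sz_take[of j "l x"] by (simp add: eq)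
  qed (auto intro!: pt_int_ops pt_fst pt_snd pt_id pt_const assms pb_polytime pb_intros)
  then show ?thesis by (simp add: eq)
qed

section \<open>Natural numbers in unary\<close>

text \<open>A number has the same encoding as a list of that many empty lists, so list operations are also
operations on numbers: appending adds, dropping subtracts.\<close>

abbreviation tally :: "nat \<Rightarrow> int list list" where "tally n \<equiv> replicate n []"

lemma enc_tally: "enc (tally n) = enc n"
  by (simp add: enc_defs)

lemma pt_tally: "polytime f \<Longrightarrow> polytime (\<lambda>x. tally (f x))"
  by (erule polytime_same_enc) (rule enc_tally)

lemma polytime_from_tally: "polytime (\<lambda>x. tally (f x)) \<Longrightarrow> polytime f"
  by (erule polytime_same_enc) (rule enc_tally[symmetric])

lemma sz_nat: "sz (n :: nat) = n + 1"
  by (induction n) (auto simp: enc_nat_def)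

lemma pt_length: "polytime f \<Longrightarrow> polytime (\<lambda>x. length (f x))"
  by (rule polytime_from_tally, simp flip: map_replicate_const) (intro pt_map pt_const)

lemma pt_int: assumes "polytime f" shows "polytime (\<lambda>x. int (f x))"
proof -
  have "polytime (\<lambda>x. sum_list (map (\<lambda>_. 1 :: int) (tally (f x))))"
    by (intro pt_sum_list pt_map pt_tally assms pt_const)
  then show ?thesis by (simp add: sum_list_replicate)
qed

lemma pt_nat_comparisons:
  fixes f g :: "'a::encodable \<Rightarrow> nat"
  assumes "polytime f" "polytime g"
  shows "polytime (\<lambda>x. f x < g x)" "polytime (\<lambda>x. f x \<le> g x)" "polytime (\<lambda>x. f x = g x)"
  using pt_int_ops(5,6)[OF assms[THEN pt_int]] pt_int_le[OF assms[THEN pt_int]] by simp_all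

lemma pt_nat_plus:
  fixes f g :: "'a::encodable \<Rightarrow> nat"
  assumes "polytime f" "polytime g"
  shows "polytime (\<lambda>x. f x + g x)"
  by (rule polytime_from_tally, simp add: replicate_add) (intro pt_append pt_tally assms)

lemma pt_Suc: "polytime f \<Longrightarrow> polytime (\<lambda>x. Suc (f x))"
  using pt_nat_plus[OF pt_const[of 1]] by simp

lemma pt_drop:
  assumes "polytime n" "polytime l"
  shows "polytime (\<lambda>x. drop (n x) (l x))"
proof -
  have *: "foldl (\<lambda>s _. tl s) xs ys = drop (length ys) xs" for xs :: "'b list" and ys :: "int list list"
    by (induction ys arbitrary: xs) (auto simp: drop_Suc)
  have "sz (drop j xs) \<le> sz xs" for j and xs :: "'b list"
    using sz_append[of "take j xs" "drop j xs"] sz_pos[of "take j xs"] by simp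
  then have "polytime (\<lambda>x. foldl (\<lambda>s _. tl s) (l x) (tally (n x)))"
    by (intro pt_foldl[where B = "\<lambda>x. sz (l x)"] pt_tally assms pb_polytime pt_tl pt_fst pt_snd pt_id)
      (auto simp: *)
  then show ?thesis by (simp add: *)
qed

lemma pt_nat_minus:
  fixes f g :: "'a::encodable \<Rightarrow> nat"
  assumes "polytime f" "polytime g"
  shows "polytime (\<lambda>x. f x - g x)"
proof (rule polytime_from_tally)
  have "polytime (\<lambda>x. drop (g x) (tally (f x)))" by (intro pt_drop pt_tally assms)
  then show "polytime (\<lambda>x. tally (f x - g x))" by simp
qed

lemma pt_min:
  fixes f g :: "'a::encodable \<Rightarrow> nat"
  assumes "polytime f" "polytime g"
  shows "polytime (\<lambda>x. min (f x) (g x))"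
  unfolding min_def by (intro pt_if pt_nat_comparisons assms)

lemma pt_nth_default:
  assumes "polytime d" "polytime l" "polytime n"
  shows "polytime (\<lambda>x. nth_default (d x) (l x) (n x))"
proof -
  have "nth_default d xs n = (if drop n xs = [] then d else hd (drop n xs))" for d and xs :: "'b list" and n
    by (auto simp: nth_default_def hd_drop_conv_nth)
  then show ?thesis
    by (simp only:) (intro pt_hd_default pt_drop assms)
qed

lemma pt_upt_0: assumes "polytime n" shows "polytime (\<lambda>x. [0..<n x])"
proof -
  have *: "foldl (\<lambda>s _. length s # s) (rev [0..<k]) ys = rev [0..<k + length ys]" for ys :: "int list list" and k
  proof (induction ys arbitrary: k)
    case (Cons y ys)
    from Cons.IH[of "Suc k"] show ?case by simp
  qed simp
  have eq: "foldl (\<lambda>s _. length s # s) [] ys = rev [0..<length ys]" for ys :: "int list list"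
    using *[of 0 ys] by simp
  have szu: "sz [0..<k] \<le> 1 + k * (k + 1)" for k
  proof (induction k)
    case (Suc k)
    then show ?case using sz_append[of "[0..<k]" "[k]"] by (simp add: sz_Cons sz_Nil sz_nat)
  qed (simp add: sz_Nil)
  have "polytime (\<lambda>x. foldl (\<lambda>s _. length s # s) [] (tally (n x)))"
  proof (rule pt_foldl[where B = "\<lambda>x. 1 + sz (n x) * (sz (n x) + 1)"])
    show "sz (foldl (\<lambda>s _. length s # s) [] (take j (tally (n x)))) \<le> 1 + sz (n x) * (sz (n x) + 1)" for x j
      unfolding eq sz_rev
      by (rule order.trans[OF szu]) (intro add_left_mono mult_mono, auto simp: sz_nat)
  qed (intro pt_Cons pt_length pt_fst pt_snd pt_id pt_const pt_tally assms pb_polytime pb_intros)+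
  from pt_rev[OF this] show ?thesis by (simp add: eq)
qed

lemma pt_sum:
  fixes n :: "'a::encodable \<Rightarrow> nat"
  assumes "polytime (\<lambda>z. f (fst z) (snd z))" "polytime n"
  shows "polytime (\<lambda>x. \<Sum>j<n x. f x j :: int)"
proof -
  have "polytime (\<lambda>x. sum_list (map (f x) [0..<n x]))"
    by (intro pt_sum_list pt_map pt_upt_0 assms)
  then show ?thesis by (simp add: interv_sum_list_conv_sum_set_nat atLeast0LessThan)
qed

lemma pt_prod:
  fixes n :: "'a::encodable \<Rightarrow> nat"
  assumes "polytime (\<lambda>z. f (fst z) (snd z))" "polytime n"
  shows "polytime (\<lambda>x. \<Prod>j<n x. f x j :: int)"
proof -
  have "polytime (\<lambda>x. prod_list (map (f x) [0..<n x]))"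
    by (intro pt_prod_list pt_map pt_upt_0 assms)
  then show ?thesis by (simp add: prod.distinct_set_conv_list[symmetric] atLeast0LessThan)
qed

lemma pt_power:
  fixes n :: "'a::encodable \<Rightarrow> nat"
  assumes "polytime f" "polytime n"
  shows "polytime (\<lambda>x. f x ^ n x :: int)"
proof -
  have "polytime (\<lambda>x. \<Prod>j<n x. f x)"
    by (rule pt_prod[OF polytime_comp[OF assms(1) pt_fst[OF pt_id]] assms(2)])
  then show ?thesis by simp
qed

lemma pt_fact: assumes "polytime n" shows "polytime (\<lambda>x. fact (n x) :: int)"
proof -
  have "polytime (\<lambda>x. \<Prod>j<n x. int (Suc j))"
    by (intro pt_prod pt_int pt_Suc pt_snd pt_id assms)
  then show ?thesis by (simp add: fact_prod_Suc atLeast0LessThan)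
qed

lemma pt_binomial:
  assumes "polytime n" "polytime k"
  shows "polytime (\<lambda>x. int (n x choose k x))"
proof -
  have "int (n choose k) = (if k \<le> n then fact n div (fact k * fact (n - k)) else 0)" for n k :: nat
    by (simp add: binomial_fact' zdiv_int)
  then show ?thesis
    by (simp only:) (intro pt_if pt_nat_comparisons pt_int_ops pt_fact pt_nat_minus pt_const assms)
qed

lemmas polytime_intros = pt_id pt_const pt_if pt_fst pt_snd pt_Cons pt_Pair pt_int_ops pt_uminus
  pt_not pt_conj pt_int_le pt_null pt_tl pt_rev pt_append pt_map pt_sum_list pt_prod_list
  pt_length pt_int pt_nat_comparisons pt_nat_plus pt_Suc pt_nat_minus pt_min pt_nth_default
  pt_upt_0 pt_sum pt_power pt_binomial

section \<open>Running time of the reconstruction\<close>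

lemma pt_Let:
  assumes "polytime a" "polytime (\<lambda>z. f (fst z) (snd z))"
  shows "polytime (\<lambda>x. let y = a x in f x y)"
  using polytime_comp[OF assms(2) pt_Pair[OF pt_id assms(1)]] by simp

lemma pt_abs: "polytime f \<Longrightarrow> polytime (\<lambda>x. \<bar>f x :: int\<bar>)"
  unfolding abs_if by (intro polytime_intros)

lemma sz_map_upt_le:
  assumes "\<And>j. j < m \<Longrightarrow> sz (f j) \<le> C"
  shows "sz (map f [0..<m]) \<le> 1 + m * C"
proof -
  have "sz (map f [0..<m]) \<le> 1 + length (map f [0..<m]) * C"
  proof (rule sz_list_le)
    fix y assume "y \<in> set (map f [0..<m])"
    then obtain j where "j < m" "y = f j" by auto
    then show "sz y \<le> C" using assms by blast
  qed
  then show ?thesis by simp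
qed

lemma floorlog2_power: "floorlog 2 (a ^ s) \<le> 1 + s * floorlog 2 a"
proof (induction s)
  case (Suc s)
  have "floorlog 2 (a * a ^ s) \<le> floorlog 2 a + floorlog 2 (a ^ s)" by (rule floorlog2_mult)
  then show ?case using Suc by simp
qed (simp add: floorlog_def)

lemma sz_int_mono: "\<bar>a\<bar> \<le> \<bar>b\<bar> \<Longrightarrow> sz (a :: int) \<le> sz b"
  unfolding enc_int_def by (rule vsize_Num_mono)

lemma sz_int_power: "sz (a ^ s :: int) \<le> 2 + s * sz a"
proof -
  have "nat \<bar>a ^ s\<bar> = nat \<bar>a\<bar> ^ s" by (simp add: power_abs nat_power_eq)
  then have "sz (a ^ s) \<le> 2 + s * floorlog 2 (nat \<bar>a\<bar>)"
    using floorlog2_power[of "nat \<bar>a\<bar>" s] by (simp add: enc_int_def)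
  also have "\<dots> \<le> 2 + s * sz a" by (simp add: enc_int_def)
  finally show ?thesis .
qed

lemma pt_conv:
  assumes "polytime a" "polytime b" "polytime t"
  shows "polytime (\<lambda>x. conv (a x) (b x) (t x))"
  unfolding conv_def by (intro polytime_intros assms[THEN polytime_comp])

lemma pt_clamp:
  assumes "polytime B" "polytime v"
  shows "polytime (\<lambda>x. clamp (B x) (v x))"
  unfolding clamp_def by (intro polytime_intros assms)

lemma pt_walk_step:
  assumes "polytime B" "polytime C" "polytime D" "polytime us" "polytime t"
  shows "polytime (\<lambda>x. walk_step (B x) (C x) (D x) (us x) (t x))"
  unfolding walk_step_def
  by (intro polytime_intros pt_clamp pt_conv assms[THEN polytime_comp])

lemma pt_reflect_coeffs:
  assumes "polytime n" "polytime p" "polytime K"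
  shows "polytime (\<lambda>x. reflect_coeffs (n x) (p x) (K x))"
  unfolding reflect_coeffs_def by (intro pt_binomial polytime_intros assms[THEN polytime_comp])

lemma pt_integrate_deck:
  assumes "polytime ls" "polytime K"
  shows "polytime (\<lambda>x. integrate_deck (ls x) (K x))"
  unfolding integrate_deck_def by (intro polytime_intros assms[THEN polytime_comp])

text \<open>Each new entry of the list is clamped, so it is no larger than the bound.\<close>

lemma sz_walk_steps:
  "sz (foldl (walk_step B C D) us ts) \<le> sz us + length ts * sz B"
proof (induction ts arbitrary: us)
  case (Cons t ts)
  have "sz (clamp B v) \<le> sz B" for v by (rule sz_int_mono) (auto simp: clamp_def)
  then have "sz (walk_step B C D us t) \<le> sz us + sz B"
    using sz_append[of us "[clamp B v]" for v] by (auto simp: walk_step_def sz_Cons sz_Nil)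
  with Cons[of "walk_step B C D us t"] show ?case by simp
qed simp

lemma pt_walk_list:
  assumes "polytime n" "polytime K" "polytime P" "polytime F" "polytime Pv" "polytime Fv"
  shows "polytime (\<lambda>x. walk_list (n x) (K x) (P x) (F x) (Pv x) (Fv x))"
  unfolding walk_list_def
proof (rule pt_foldl[where B = "\<lambda>x. sz [1 :: int] + sz [0..<K x - 2] * sz (int (n x) ^ n x)"])
  show "polytime (\<lambda>z. walk_step (int (n (fst z)) ^ n (fst z))
      (map (\<lambda>t. conv (Pv (fst z)) (F (fst z)) (Suc t) - conv (P (fst z)) (Fv (fst z)) (Suc t)) [0..<K (fst z) - 1])
      (map (\<lambda>t. conv (P (fst z)) (P (fst z)) t) [0..<K (fst z)]) (fst (snd z)) (snd (snd z)))"
    by (intro pt_walk_step pt_conv polytime_intros assms[THEN polytime_comp])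
  fix x j
  let ?B = "int (n x) ^ n x" and ?C = "map (\<lambda>t. conv (Pv x) (F x) (Suc t) - conv (P x) (Fv x) (Suc t)) [0..<K x - 1]"
    and ?D = "map (\<lambda>t. conv (P x) (P x) t) [0..<K x]"
  have "sz (foldl (walk_step ?B ?C ?D) [1] (take j [0..<K x - 2])) \<le> sz [1 :: int] + length (take j [0..<K x - 2]) * sz ?B"
    by (rule sz_walk_steps)
  also have "\<dots> \<le> sz [1 :: int] + sz [0..<K x - 2] * sz ?B"
    using length_le_sz[of "[0..<K x - 2]"] by (intro add_left_mono mult_right_mono) auto
  finally show "sz (foldl (walk_step ?B ?C ?D) [1] (take j [0..<K x - 2])) \<le> \<dots>" .
qed (intro pb_add pb_mult pb_const pb_polytime polytime_intros assms[THEN polytime_comp])+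

lemma pt_count_list:
  assumes "polytime n" "polytime K" "polytime us"
  shows "polytime (\<lambda>x. count_list (n x) (K x) (us x))"
  unfolding count_list_def by (intro polytime_intros assms[THEN polytime_comp])

lemma pt_deck_counts:
  assumes "polytime n" "polytime K" "polytime cards" "polytime P" "polytime F"
  shows "polytime (\<lambda>x. deck_counts (n x) (K x) (cards x) (P x) (F x))"
  unfolding deck_counts_def
  by (intro pt_count_list pt_walk_list pt_reflect_coeffs polytime_intros assms[THEN polytime_comp])

lemma pt_hankel_mult:
  assumes "polytime N" "polytime m" "polytime M" "polytime i" "polytime j"
  shows "polytime (\<lambda>x. hankel_mult (N x) (m x) (M x) (i x) (j x))"
  unfolding hankel_mult_def by (intro polytime_intros assms[THEN polytime_comp])

lemma pt_adjugate_step: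
  assumes "polytime N" "polytime m" "polytime M" "polytime k"
  shows "polytime (\<lambda>x. adjugate_step (N x) (m x) (M x) (k x))"
  unfolding adjugate_step_def by (intro polytime_intros pt_hankel_mult assms[THEN polytime_comp])

lemma sum_list_abs_nonneg: "0 \<le> sum_list (map abs (N :: int list))"
  by (rule sum_list_nonneg) auto

lemma abs_item_le: "\<bar>item N i\<bar> \<le> sum_list (map abs N)"
proof (cases "i < length N")
  case True
  then have "\<bar>item N i\<bar> \<in> set (map abs N)" by (simp add: nth_default_nth)
  then show ?thesis by (rule member_le_sum_list) auto
qed (simp add: nth_default_def sum_list_abs_nonneg)

text \<open>The estimate holds for every list \<open>N\<close>, because the loop computes the coefficients of
\<open>adj (x I - H)\<close> for every Hankel matrix \<open>H\<close>, singular or not.\<close>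

lemma sz_adjugate_steps:
  assumes "s \<le> m - 1"
  shows "sz (foldl (adjugate_step N m) (map (\<lambda>i. map (\<lambda>j. if i = j then 1 else 0) [0..<m]) [0..<m]) [0..<s])
    \<le> 1 + m * (1 + m * (2 + m * sz (int m * (1 + sum_list (map abs N)) * (int m + 1))))"
proof (cases "m = 0")
  case True
  then show ?thesis using assms by (simp add: sz_Nil)
next
  case False
  let ?h = "1 + sum_list (map abs N)"
  let ?a = "int m * ?h * (int m + 1)"
  let ?H = "hankel_mat (item N) m"
  have h: "\<bar>?H $$ (i, j)\<bar> \<le> ?h" if "i < m" "j < m" for i j
    using abs_item_le[of N "i + j"] that by simp
  have h1: "1 \<le> ?h" using sum_list_abs_nonneg[of N] by simp
  have s: "s < m" using False assms by simp
  have e: "sz (resolvent_coeff ?H (m - 1 - s) i j) \<le> 2 + m * sz ?a" if "i < m" "j < m" for i j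
  proof -
    have "\<bar>resolvent_coeff ?H (m - 1 - s) i j\<bar> \<le> ?a ^ s"
      by (rule resolvent_coeff_bound[OF _ h h1 s that]) auto
    then have "sz (resolvent_coeff ?H (m - 1 - s) i j) \<le> sz (?a ^ s)"
      by (intro sz_int_mono) auto
    also have "\<dots> \<le> 2 + s * sz ?a" by (rule sz_int_power)
    also have "\<dots> \<le> 2 + m * sz ?a" using s by (intro add_left_mono mult_right_mono) auto
    finally show ?thesis .
  qed
  have r: "sz (map (\<lambda>j. resolvent_coeff ?H (m - 1 - s) i j) [0..<m]) \<le> 1 + m * (2 + m * sz ?a)" if "i < m" for i
    by (rule sz_map_upt_le) (rule e[OF that])
  show ?thesis
    unfolding hankel_adjugate_steps[OF s]
    by (rule sz_map_upt_le) (rule r)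
qed

lemma pt_hankel_adjugate:
  assumes "polytime N" "polytime m"
  shows "polytime (\<lambda>x. hankel_adjugate (N x) (m x))"
  unfolding hankel_adjugate_def
proof (rule pt_foldl[where B = "\<lambda>x. 1 + sz (m x) * (1 + sz (m x) * (2 + sz (m x) *
      sz (int (m x) * (1 + sum_list (map abs (N x))) * (int (m x) + 1))))"])
  show "polytime (\<lambda>z. adjugate_step (N (fst z)) (m (fst z)) (fst (snd z)) (snd (snd z)))"
    by (intro pt_adjugate_step polytime_intros assms[THEN polytime_comp])
  fix x j
  let ?a = "int (m x) * (1 + sum_list (map abs (N x))) * (int (m x) + 1)"
  have "take j [0..<m x - 1] = [0..<min j (m x - 1)]" by (simp add: min_def take_upt)
  then have "sz (foldl (adjugate_step (N x) (m x)) (map (\<lambda>i. map (\<lambda>j. if i = j then 1 else 0) [0..<m x]) [0..<m x])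
      (take j [0..<m x - 1])) \<le> 1 + m x * (1 + m x * (2 + m x * sz ?a))"
    using sz_adjugate_steps[of "min j (m x - 1)" "m x" "N x"] by simp
  also have "\<dots> \<le> 1 + sz (m x) * (1 + sz (m x) * (2 + sz (m x) * sz ?a))"
    by (intro add_left_mono mult_mono) (auto simp: sz_nat)
  finally show "sz (foldl (adjugate_step (N x) (m x)) (map (\<lambda>i. map (\<lambda>j. if i = j then 1 else 0) [0..<m x]) [0..<m x])
      (take j [0..<m x - 1])) \<le> \<dots>" .
qed (intro pb_add pb_mult pb_const pb_polytime pt_abs polytime_intros assms[THEN polytime_comp])+

lemma pt_complete_coeffs:
  assumes "polytime n" "polytime m" "polytime P" "polytime N" "polytime M" "polytime d"
  shows "polytime (\<lambda>x. complete_coeffs (n x) (m x) (P x) (N x) (M x) (d x))"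
  unfolding complete_coeffs_def by (intro polytime_intros assms[THEN polytime_comp])

lemma pt_complement_coeffs:
  assumes "polytime n" "polytime phi" "polytime N"
  shows "polytime (\<lambda>x. complement_coeffs (n x) (phi x) (N x))"
  unfolding complement_coeffs_def
  by (intro pt_reflect_coeffs polytime_intros assms[THEN polytime_comp])

lemma pt_solve_counts:
  assumes "polytime n" "polytime m" "polytime P" "polytime N"
  shows "polytime (\<lambda>x. solve_counts (n x) (m x) (P x) (N x))"
  unfolding solve_counts_def
  by (intro pt_Let pt_hankel_adjugate pt_hankel_mult pt_complete_coeffs pt_complement_coeffs
      polytime_intros assms[THEN polytime_comp])

lemma polytime_reconstruct: "polytime reconstruct"
  unfolding reconstruct_def[abs_def] three_vertex_answer_def
  by (intro pt_Let pt_integrate_deck pt_reflect_coeffs pt_solve_counts pt_deck_counts polytime_intros)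

lemma sz_top_coeffs:
  assumes B: "B \<in> carrier_mat (n - 1) (n - 1)" and b: "\<And>i j. i < n - 1 \<Longrightarrow> j < n - 1 \<Longrightarrow> \<bar>B $$ (i, j)\<bar> \<le> 1"
    and n: "0 < n"
  shows "sz (top_coeffs k (char_poly B)) \<le> 1 + n * (2 + n * (n * n + 1))"
proof -
  have deg: "degree (char_poly B) = n - 1" using degree_monic_char_poly[OF B] by simp
  let ?a = "int (n - 1) * 1 * (int (n - 1) + 1)"
  have a: "?a = int ((n - 1) * n)" using n by (simp add: of_nat_diff)
  have "sz ?a \<le> n * n + 1"
  proof -
    have "floorlog 2 ((n - 1) * n) \<le> n * n"
      using floorlog2_le[of "(n - 1) * n"] by (rule order.trans) (intro mult_right_mono, auto)
    then show ?thesis unfolding a by (simp add: enc_int_def del: of_nat_mult of_nat_diff)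
  qed
  then have p: "(n - 1) * sz ?a \<le> n * (n * n + 1)" by (intro mult_mono) auto
  have c: "sz (coeff (char_poly B) j) \<le> 2 + n * (n * n + 1)" for j
  proof -
    have "\<bar>coeff (char_poly B) j\<bar> \<le> ?a ^ (n - 1)" by (rule char_poly_coeff_bound[OF B b]) auto
    then have "sz (coeff (char_poly B) j) \<le> sz (?a ^ (n - 1))" by (intro sz_int_mono) auto
    also have "\<dots> \<le> 2 + (n - 1) * sz ?a" by (rule sz_int_power)
    finally show ?thesis using p by linarith
  qed
  have "sz (top_coeffs k (char_poly B)) \<le> 1 + min k (n - 1 + 1) * (2 + n * (n * n + 1))"
    unfolding top_coeffs_def deg by (rule sz_map_upt_le) (rule c)
  also have "\<dots> \<le> 1 + n * (2 + n * (n * n + 1))"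
    using n by (intro add_left_mono mult_right_mono) auto
  finally show ?thesis .
qed

text \<open>The time has to be polynomial in \<open>n\<close> and not only in the size of the input; coefficients of
characteristic polynomials of graphs have a polynomial number of digits.\<close>

lemma sz_cards:
  assumes G: "simple_graph_on n G" and n: "0 < n" and cards: "mset cards = truncated_deck k G"
  shows "sz cards \<le> 1 + n * (1 + 2 * (1 + n * (2 + n * (n * n + 1))))"
proof -
  have "sz c \<le> 1 + 2 * (1 + n * (2 + n * (n * n + 1)))" if c: "c \<in> set cards" for c
  proof -
    obtain i where i: "i < n" "c = deck_card k G i" using c unfolding set_deck[OF G cards] by auto
    have "sz (top_coeffs k (graph_poly (delete_vertex G' (Suc i)))) \<le> 1 + n * (2 + n * (n * n + 1))"
      if G': "simple_graph_on n G'" for G'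
      unfolding graph_poly_def adjacency_delete[OF G' i(1)]
    proof (rule sz_top_coeffs[OF mat_delete_carrier[OF adjacency_carrier[OF G']] _ n])
      fix a b assume "a < n - 1" "b < n - 1"
      then show "\<bar>mat_delete (adj_mat G') i i $$ (a, b)\<bar> \<le> 1"
        using adjacency_bound[OF G'] carrier_matD[OF adjacency_carrier[OF G']] by (auto simp: mat_delete_def)
    qed
    from this[OF G] this[OF simple_complement[OF G]] show ?thesis
      unfolding i(2) deck_card_def enc_prod_def fst_conv snd_conv vsize.simps list.map sum_list.Cons sum_list.Nil
      unfolding mult_2 add_0_right by (intro add_left_mono add_mono)
  qed
  then have "sz cards \<le> 1 + length cards * (1 + 2 * (1 + n * (2 + n * (n * n + 1))))"
    by (rule sz_list_le)
  then show ?thesis unfolding length_deck[OF G cards] .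
qed

theorem theorem5:
  shows "\<exists>(prog :: exp) (time :: nat poly).
    \<forall>n\<ge>3. \<forall>G. simple_graph_on n G \<longrightarrow>
      (\<forall>cards. mset cards = truncated_deck (nat \<lceil>(2 * real n + 4) / 3\<rceil>) G \<longrightarrow>
        (\<exists>t \<le> poly time n.
           eval [enc_cards cards] prog
             (enc_answer
               (if int (walk_rank G) \<ge> \<lfloor>(real n - 1) / 3\<rfloor>
                then Some (graph_poly G, graph_poly (complement G))
                else None)) t))"
proof -
  obtain e p where e: "\<And>x env. runs (enc x # env) e (enc (reconstruct x)) (poly p (sz x))"
    using polytimeE[OF polytime_reconstruct] by blast
  define q :: "nat poly" where
    "q = 1 + [:0, 1:] * (1 + [:2:] * (1 + [:0, 1:] * ([:2:] + [:0, 1:] * ([:0, 1:] * [:0, 1:] + 1))))"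
  have q: "poly q n = 1 + n * (1 + 2 * (1 + n * (2 + n * (n * n + 1))))" for n
    by (simp add: q_def)
  have enc_ints: "enc xs = enc_ints xs" for xs
    unfolding enc_list_def enc_ints_def by (intro arg_cong[of _ _ Lst] map_cong refl) (simp add: enc_int_def)
  have enc_cards: "enc cards = enc_cards cards" for cards :: "(int list \<times> int list) list"
    unfolding enc_list_def[of cards] enc_cards_def
    by (intro arg_cong[of _ _ Lst] map_cong refl) (auto simp: enc_prod_def enc_ints)
  show ?thesis
  proof (intro exI[of _ e] exI[of _ "pcompose p q"] allI impI)
    fix n G cards
    assume n: "3 \<le> n" and G: "simple_graph_on n G"
      and cards: "mset cards = truncated_deck (nat \<lceil>(2 * real n + 4) / 3\<rceil>) G"
    let ?ans = "if int (walk_rank G) \<ge> \<lfloor>(real n - 1) / 3\<rfloor>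
                then Some (graph_poly G, graph_poly (complement G)) else None"
    have "enc (reconstruct cards) = enc_answer ?ans"
      unfolding reconstruct_correct[OF n G cards]
      by (simp add: enc_list_def[of "[_, _]"] enc_list_def[of "[]"] enc_ints)
    then have "runs [enc_cards cards] e (enc_answer ?ans) (poly p (sz cards))"
      using e[of cards "[]"] by (simp add: enc_cards)
    moreover have "poly p (sz cards) \<le> poly (pcompose p q) n"
      using sz_cards[OF G _ cards] n by (simp add: poly_pcompose q poly_nat_mono)
    ultimately have "runs [enc_cards cards] e (enc_answer ?ans) (poly (pcompose p q) n)"
      by (rule runs_mono)
    then show "\<exists>t\<le>poly (pcompose p q) n. eval [enc_cards cards] e (enc_answer ?ans) t"
      unfolding runs_def .
  qed
qed

end
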